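(* Let $M$ be a closed surface. Then $M$ has only finitely many regular cell decompositions $C$ with $\delta(\mathrm{Sk}_1(C))\geq 7$.
   Context: A cell decomposition of a surface is regular if there are no identifications on the boundary of any cell. $\mathrm{Sk}_1(C)$ denotes the $1$-skeleton (the graph of vertices and edges) of $C$, and $\delta(G)$ denotes the minimum vertex degree of a graph $G$.
   Formalization: Every face is also required to have at least three sides (no digons), since cutting the sphere along k ≥ 7 meridians gives infinitely many regular decompositions; "finitely many" is meant up to self-homeomorphisms of M. *)

theory Defs
  imports "HOL-Analysis.Analysis"
begin

definition closed_surface :: "'a topology \<Rightarrow> bool" where
  "closed_surface M \<longleftrightarrow>
     topspace M \<noteq> {} \<and> compact_space M \<and> connected_space M \<and> Hausdorff_space M \<and>
     (\<forall>x \<in> topspace M. \<exists>U. openin M U \<and> x \<in> U \<and>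
        subtopology M U homeomorphic_space Euclidean_space 2)"

text \<open>For \<open>n = 0\<close> both balls are a single point and the sphere is empty.\<close>

definition closed_unit_ball :: "nat \<Rightarrow> (nat \<Rightarrow> real) set" where
  "closed_unit_ball n = {x \<in> topspace (Euclidean_space n). (\<Sum>i<n. (x i)\<^sup>2) \<le> 1}"

definition open_unit_ball :: "nat \<Rightarrow> (nat \<Rightarrow> real) set" where
  "open_unit_ball n = {x \<in> topspace (Euclidean_space n). (\<Sum>i<n. (x i)\<^sup>2) < 1}"

definition unit_sphere :: "nat \<Rightarrow> (nat \<Rightarrow> real) set" where
  "unit_sphere n = {x \<in> topspace (Euclidean_space n). (\<Sum>i<n. (x i)\<^sup>2) = 1}"

text \<open>
  A decomposition is represented by the set \<open>C\<close> of its open cells;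
  \<open>cells M C n\<close> consists of those of dimension \<open>n\<close>.
\<close>

definition cells :: "'a topology \<Rightarrow> 'a set set \<Rightarrow> nat \<Rightarrow> 'a set set" where
  "cells M C n = {e \<in> C. subtopology M e homeomorphic_space
                          subtopology (Euclidean_space n) (open_unit_ball n)}"

definition characteristic_map ::
    "'a topology \<Rightarrow> 'a set set \<Rightarrow> nat \<Rightarrow> 'a set \<Rightarrow> ((nat \<Rightarrow> real) \<Rightarrow> 'a) \<Rightarrow> bool" where
  "characteristic_map M C n e f \<longleftrightarrow>
     continuous_map (subtopology (Euclidean_space n) (closed_unit_ball n)) M f \<and>
     homeomorphic_map (subtopology (Euclidean_space n) (open_unit_ball n)) (subtopology M e) f \<and>
     f ` unit_sphere n \<subseteq> (\<Union>m<n. \<Union>(cells M C m))"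

text \<open>
  CW decompositions of a compact Hausdorff space: such a decomposition has only finitely many
  cells, and for finitely many cells closure finiteness and the weak topology are automatic.
\<close>

definition cell_decomposition :: "'a topology \<Rightarrow> 'a set set \<Rightarrow> bool" where
  "cell_decomposition M C \<longleftrightarrow>
     finite C \<and> disjoint C \<and> \<Union>C = topspace M \<and>
     (\<forall>e \<in> C. \<exists>n f. characteristic_map M C n e f)"

text \<open>
  No identifications on the boundary of a cell: it has a characteristic map that is injective on
  the whole closed ball.
\<close>

definition regular_cell_decomposition :: "'a topology \<Rightarrow> 'a set set \<Rightarrow> bool" where
  "regular_cell_decomposition M C \<longleftrightarrow>
     cell_decomposition M C \<and>
     (\<forall>e \<in> C. \<exists>n f. characteristic_map M C n e f \<and> inj_on f (closed_unit_ball n))"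

text \<open>
  Every face is a polygon with at least three sides. For a regular decomposition this only
  excludes digons. It has to be required: cutting the sphere along \<open>k \<ge> 7\<close> meridians
  gives, for every such \<open>k\<close>, \<open>k\<close> digons and two vertices of degree \<open>k\<close>. It
  holds automatically if the 1-skeleton of a regular decomposition has no parallel edges.
\<close>

definition polygonal_faces :: "'a topology \<Rightarrow> 'a set set \<Rightarrow> bool" where
  "polygonal_faces M C \<longleftrightarrow>
     (\<forall>f \<in> cells M C 2. 3 \<le> card {e \<in> cells M C 1. e \<subseteq> M closure_of f})"

text \<open>Undirected graphs in which parallel edges and loops are allowed.\<close>

record ('v, 'e) multigraph =
  verts :: "'v set"
  edges :: "'e set"
  ends :: "'e \<Rightarrow> 'v set"

text \<open>A loop counts twice.\<close>

definition degree :: "('v, 'e) multigraph \<Rightarrow> 'v \<Rightarrow> nat" where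
  "degree G v = card {e \<in> edges G. v \<in> ends G e} + card {e \<in> edges G. ends G e = {v}}"

definition min_degree :: "('v, 'e) multigraph \<Rightarrow> nat" where
  "min_degree G = Min (degree G ` verts G)"

definition one_skeleton :: "'a topology \<Rightarrow> 'a set set \<Rightarrow> ('a set, 'a set) multigraph" where
  "one_skeleton M C =
     \<lparr>verts = cells M C 0, edges = cells M C 1,
      ends = (\<lambda>e. {v \<in> cells M C 0. v \<subseteq> M closure_of e})\<rparr>"

text \<open>
  Two decompositions count as the same if some self-homeomorphism of the space carries the cells
  of one onto the cells of the other.
\<close>

definition same_decomposition :: "'a topology \<Rightarrow> ('a set set \<times> 'a set set) set" where
  "same_decomposition M =
     {(C, D). \<exists>h. homeomorphic_map M M h \<and> (\<lambda>e. h ` e) ` C = D}"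

end

theory Submission
  imports Defs "HOL-Homology.Invariance_of_Domain"
begin

text \<open>
  Write \<open>V\<close>, \<open>E\<close>, \<open>F\<close> for the numbers of cells. Counting incidences gives \<open>7 V \<le> 2 E\<close> and,
  since an edge lies on at most two faces, \<open>3 F \<le> 2 E\<close>; hence \<open>E \<le> 21 (E - V - F)\<close>, and it suffices
  to bound \<open>E - V - F\<close> in terms of \<open>M\<close> alone. Over the field with two elements, \<open>E - V - F\<close> is at most
  the dimension of the first cohomology of the cell complex, because the cocycles among the sets of
  edges have codimension at most \<open>F\<close> and the coboundaries have dimension at most \<open>V\<close>. Parallel
  transport turns a cellular cocycle into an Alexander-Spanier cocycle on \<open>M\<close> that is trivial only if
  the cellular cocycle is a coboundary, and compactness of \<open>M\<close> bounds the number of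
  Alexander-Spanier classes. So the number of cells is bounded, only finitely many
  incidence relations remain, and an isomorphism of incidence relations extends radially, cell by
  cell, to a homeomorphism of \<open>M\<close>.
\<close>

section \<open>Alexander-Spanier cocycles modulo two\<close>

text \<open>The bound must be uniform over decompositions that have nothing in common.
  Alexander-Spanier cochains are functions of pairs of points of \<open>M\<close>, so the cocycles
  of all decompositions are compared within one finite set that is attached to \<open>M\<close>
  alone. Degree 7 is the threshold: 1 - 2/7 - 2/3 = 1/21 is positive, whereas degree 6 would give 1
  - 2/6 - 2/3 = 0 and no bound. Dimension counts over the field with two elements appear as
  cardinalities of power sets: an injection defined on \<open>Pow C1\<close> takes the place of a
  rank computation. The definition of a decomposition asks only that the boundary of a cell lie in
  the union of the lower cells. That closures are unions of cells, that edges occupy arcs of the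
  boundary circles of faces, and that an edge lies on at most two faces are consequences of
  injective characteristic maps together with invariance of domain in dimensions one and
  two.\<close>

lemma locally_constant_on_connectedin:
  assumes S: "connectedin M S"
    and loc: "\<And>x. x \<in> S \<Longrightarrow> \<exists>U. openin M U \<and> x \<in> U \<and> (\<forall>y\<in>U \<inter> S. k y = k x)"
    and "x \<in> S" "y \<in> S"
  shows "k x = k y"
proof (rule ccontr)
  assume ne: "k x \<noteq> k y"
  define E1 where "E1 = \<Union>{U. openin M U \<and> (\<forall>z\<in>U \<inter> S. k z = k x)}"
  define E2 where "E2 = \<Union>{U. openin M U \<and> (\<forall>z\<in>U \<inter> S. k z \<noteq> k x)}"
  have "openin M E1" "openin M E2"
    by (auto simp: E1_def E2_def)
  moreover have "S \<subseteq> E1 \<union> E2"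
  proof
    fix z assume "z \<in> S"
    with loc obtain U where "openin M U" "z \<in> U" "\<forall>w\<in>U \<inter> S. k w = k z"
      by blast
    then show "z \<in> E1 \<union> E2"
      by (cases "k z = k x") (auto simp: E1_def E2_def)
  qed
  moreover have "E1 \<inter> E2 \<inter> S = {}"
    by (auto simp: E1_def E2_def)
  moreover have "E1 \<inter> S \<noteq> {}"
    using loc[OF \<open>x \<in> S\<close>] \<open>x \<in> S\<close> by (auto simp: E1_def)
  moreover have "E2 \<inter> S \<noteq> {}"
  proof -
    obtain U where "openin M U" "y \<in> U" "\<forall>z\<in>U \<inter> S. k z = k y"
      using loc[OF \<open>y \<in> S\<close>] by blast
    then have "y \<in> E2"
      unfolding E2_def using ne by (intro UnionI[of U]) auto
    then show ?thesis using \<open>y \<in> S\<close> by blast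
  qed
  ultimately show False
    using S unfolding connectedin by blast
qed

text \<open>
  The type \<^typ>\<open>bool\<close> with exclusive or plays the field with two elements. Only the values of
  \<open>\<phi>\<close> near the diagonal matter.
\<close>

definition primitive_on :: "'a topology \<Rightarrow> ('a \<Rightarrow> 'a \<Rightarrow> bool) \<Rightarrow> 'a set \<Rightarrow> ('a \<Rightarrow> bool) \<Rightarrow> bool" where
  "primitive_on M \<phi> S g \<longleftrightarrow>
     (\<forall>x\<in>S. \<exists>U. openin M U \<and> x \<in> U \<and> (\<forall>y\<in>U \<inter> S. (g x \<noteq> g y) = \<phi> x y))"

definition cocycle :: "'a topology \<Rightarrow> ('a \<Rightarrow> 'a \<Rightarrow> bool) \<Rightarrow> bool" where
  "cocycle M \<phi> \<longleftrightarrow>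
     (\<forall>x\<in>topspace M. \<exists>U g. openin M U \<and> x \<in> U \<and> primitive_on M \<phi> U g)"

lemma primitive_onE:
  assumes "primitive_on M \<phi> S g" "x \<in> S"
  obtains U where "openin M U" "x \<in> U" "\<And>y. y \<in> U \<Longrightarrow> y \<in> S \<Longrightarrow> (g x \<noteq> g y) = \<phi> x y"
  using assms unfolding primitive_on_def by (metis IntI)

lemma primitive_on_subset: "primitive_on M \<phi> T g \<Longrightarrow> S \<subseteq> T \<Longrightarrow> primitive_on M \<phi> S g"
  unfolding primitive_on_def by (meson Int_mono in_mono order_refl)

lemma primitive_on_flip: "primitive_on M \<phi> S g \<Longrightarrow> primitive_on M \<phi> S (\<lambda>x. g x \<noteq> c)"
  unfolding primitive_on_def by (cases c) auto

lemma primitive_on_cong: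
  "primitive_on M \<phi> S g \<Longrightarrow> (\<And>x. x \<in> S \<Longrightarrow> g x = h x) \<Longrightarrow> primitive_on M \<phi> S h"
  unfolding primitive_on_def by auto

text \<open>Both functions have the increments prescribed by \<open>\<phi>\<close> near each point,
  so whether they agree is a locally constant property on the connected set.\<close>

lemma primitive_on_unique:
  assumes g: "primitive_on M \<phi> S g" and h: "primitive_on M \<phi> S h"
    and "connectedin M S" "x \<in> S" "y \<in> S"
  shows "(g x = h x) = (g y = h y)"
proof (rule locally_constant_on_connectedin[where k = "\<lambda>x. g x = h x"])
  fix z assume z: "z \<in> S"
  obtain U where U: "openin M U" "z \<in> U" "\<forall>y\<in>U \<inter> S. (g z \<noteq> g y) = \<phi> z y"
    using g z unfolding primitive_on_def by blast
  obtain V where V: "openin M V" "z \<in> V" "\<forall>y\<in>V \<inter> S. (h z \<noteq> h y) = \<phi> z y"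
    using h z unfolding primitive_on_def by blast
  show "\<exists>U. openin M U \<and> z \<in> U \<and> (\<forall>y\<in>U \<inter> S. (g y = h y) = (g z = h z))"
    using U V by (intro exI[of _ "U \<inter> V"]) blast
qed (use assms in auto)

text \<open>Openness lets a neighbourhood that works within one of the two sets be shrunk into that
  set, where points outside it cannot interfere.\<close>

lemma primitive_on_Un:
  assumes "primitive_on M \<phi> A g" "primitive_on M \<phi> B g" "openin M A" "openin M B"
  shows "primitive_on M \<phi> (A \<union> B) g"
  unfolding primitive_on_def
proof
  fix x assume x: "x \<in> A \<union> B"
  have *: "\<exists>U. openin M U \<and> x \<in> U \<and> (\<forall>y\<in>U \<inter> (A \<union> B). (g x \<noteq> g y) = \<phi> x y)"
    if S: "primitive_on M \<phi> S g" "openin M S" "x \<in> S" for S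
  proof -
    obtain U where "openin M U" "x \<in> U" "\<And>y. y \<in> U \<Longrightarrow> y \<in> S \<Longrightarrow> (g x \<noteq> g y) = \<phi> x y"
      using primitive_onE[OF S(1,3)] by blast
    then show ?thesis
      using S by (intro exI[of _ "U \<inter> S"]) blast
  qed
  then show "\<exists>U. openin M U \<and> x \<in> U \<and> (\<forall>y\<in>U \<inter> (A \<union> B). (g x \<noteq> g y) = \<phi> x y)"
    using x assms by blast
qed

section \<open>The Poincare lemma modulo two on Euclidean space\<close>

text \<open>The union of the \<epsilon>-balls around \<open>K\<close> is the Minkowski sum of
  \<open>K\<close> with a ball, hence convex as well as open. A convex domain around a segment is
  what keeps its overlap with the next ball connected.\<close>

lemma convex_open_between:
  fixes K U :: "'b::euclidean_space set"
  assumes "compact K" "convex K" "open U" "K \<subseteq> U"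
  obtains A where "open A" "convex A" "K \<subseteq> A" "A \<subseteq> U"
proof -
  obtain \<epsilon> where e: "\<epsilon> > 0" "(\<Union>x\<in>K. ball x \<epsilon>) \<subseteq> U"
    using compact_subset_open_imp_ball_epsilon_subset[OF \<open>compact K\<close> \<open>open U\<close> \<open>K \<subseteq> U\<close>] by metis
  have eq: "(\<Union>x\<in>K. ball x \<epsilon>) = (\<Union>x\<in>K. \<Union>y\<in>ball 0 \<epsilon>. {x + y})"
  proof (intro Set.set_eqI iffI)
    fix z assume "z \<in> (\<Union>x\<in>K. ball x \<epsilon>)"
    then obtain x where "x \<in> K" "dist x z < \<epsilon>" by auto
    then show "z \<in> (\<Union>x\<in>K. \<Union>y\<in>ball 0 \<epsilon>. {x + y})"
      by (intro UN_I[of x] UN_I[of "z - x"]) (auto simp: dist_norm norm_minus_commute)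
  next
    fix z assume "z \<in> (\<Union>x\<in>K. \<Union>y\<in>ball 0 \<epsilon>. {x + y})"
    then obtain x y where "x \<in> K" "norm y < \<epsilon>" "z = x + y" by auto
    then show "z \<in> (\<Union>x\<in>K. ball x \<epsilon>)"
      by (intro UN_I[of x]) (auto simp: dist_norm)
  qed
  have "convex (\<Union>x\<in>K. ball x \<epsilon>)"
    unfolding eq by (intro convex_sums \<open>convex K\<close> convex_ball)
  moreover have "open (\<Union>x\<in>K. ball x \<epsilon>)" by blast
  moreover have "K \<subseteq> (\<Union>x\<in>K. ball x \<epsilon>)" using e by auto
  ultimately show ?thesis using that e by blast
qed

lemma cocycle_euclideanE:
  fixes x :: "'b::topological_space"
  assumes "cocycle euclidean \<phi>"
  obtains U g where "open U" "x \<in> U" "primitive_on euclidean \<phi> U g"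
  using assms unfolding cocycle_def by (metis UNIV_I topspace_euclidean open_openin)

text \<open>The parameters \<open>t\<close> for which some convex neighbourhood of the segment from
  0 to \<open>t z\<close> carries a primitive form a set that contains 0 and is open and closed in
  the unit interval. Convexity makes overlaps connected, so a local primitive matches the old one
  after at most one flip.\<close>

lemma primitive_on_segment:
  fixes z :: "'b::euclidean_space"
  assumes \<phi>: "cocycle euclidean \<phi>"
  shows "\<exists>A g. open A \<and> convex A \<and> closed_segment 0 z \<subseteq> A \<and> primitive_on euclidean \<phi> A g"
proof -
  define T where "T = {t. \<exists>A g. open A \<and> convex A \<and> closed_segment 0 (t *\<^sub>R z) \<subseteq> A
                              \<and> primitive_on euclidean \<phi> A g}"
  \<comment> \<open>Membership in \<open>T\<close> passes between any two parameters whose points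
    lie in one convex open set with a primitive; used in both directions, this yields openness and
    closedness together.\<close>
  have step: "s' \<in> T"
    if "s \<in> T" "s \<in> {0..1}" "s' \<in> {0..1}" and sB: "s *\<^sub>R z \<in> B" "s' *\<^sub>R z \<in> B"
      and B: "open B" "convex B" "primitive_on euclidean \<phi> B h" for s s' B h
  proof -
    obtain A g where A: "open A" "convex A" "closed_segment 0 (s *\<^sub>R z) \<subseteq> A"
        "primitive_on euclidean \<phi> A g"
      using \<open>s \<in> T\<close> unfolding T_def by blast
    have sA: "s *\<^sub>R z \<in> A" using A by auto
    define c where "c = (g (s *\<^sub>R z) \<noteq> h (s *\<^sub>R z))"
    define G where "G = (\<lambda>x. if x \<in> A then g x else h x \<noteq> c)"
    have agree: "g x = (h x \<noteq> c)" if "x \<in> A \<inter> B" for x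
    proof -
      have "(g x = h x) = (g (s *\<^sub>R z) = h (s *\<^sub>R z))"
      proof (rule primitive_on_unique)
        show "primitive_on euclidean \<phi> (A \<inter> B) g" "primitive_on euclidean \<phi> (A \<inter> B) h"
          using A B primitive_on_subset by (metis inf_le1, metis inf_le2)
        show "connectedin euclidean (A \<inter> B)"
          using A B by (simp add: convex_Int convex_connected)
      qed (use that sA sB in auto)
      then show ?thesis unfolding c_def by auto
    qed
    have "primitive_on euclidean \<phi> (A \<union> B) G"
    proof (rule primitive_on_Un)
      show "primitive_on euclidean \<phi> A G"
        using A(4) by (rule primitive_on_cong) (simp add: G_def)
      show "primitive_on euclidean \<phi> B G"
        using primitive_on_flip[OF B(3), of c] by (rule primitive_on_cong) (use agree in \<open>auto simp: G_def\<close>)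
    qed (use A B in auto)
    \<comment> \<open>Points up to parameter \<open>s\<close> lie on the old segment, all others
      between the two given points of the convex set \<open>B\<close>.\<close>
    moreover have "closed_segment 0 (s' *\<^sub>R z) \<subseteq> A \<union> B"
    proof
      fix x assume "x \<in> closed_segment 0 (s' *\<^sub>R z)"
      then obtain u where u: "0 \<le> u" "u \<le> 1" "x = (u * s') *\<^sub>R z"
        by (auto simp: in_segment)
      show "x \<in> A \<union> B"
      proof (cases "u * s' \<le> s")
        case True
        have "x \<in> closed_segment 0 (s *\<^sub>R z)"
        proof (cases "s = 0")
          case True
          moreover have "0 \<le> u * s'" using u that(3) by simp
          ultimately have "u * s' = 0" using \<open>u * s' \<le> s\<close> by linarith
          then show ?thesis using u True by simp
        next
          case False
          then have "x = (u * s' / s) *\<^sub>R (s *\<^sub>R z)" "0 \<le> u * s' / s" "u * s' / s \<le> 1"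
            using u that True by auto
          then show ?thesis unfolding in_segment by (intro exI[of _ "u * s' / s"]) auto
        qed
        then show ?thesis using A by auto
      next
        case False
        have "u * s' \<le> s'" using u that(3) by (simp add: mult_left_le_one_le)
        then have "u * s' \<in> closed_segment s s'"
          using False by (auto simp: closed_segment_eq_real_ivl)
        then have "x \<in> (\<lambda>r. r *\<^sub>R z) ` closed_segment s s'" using u by auto
        also have "\<dots> = closed_segment (s *\<^sub>R z) (s' *\<^sub>R z)"
          by (intro closed_segment_linear_image[symmetric])
             (simp add: linear_scaleR_left)
        also have "\<dots> \<subseteq> B" using B sB by (simp add: closed_segment_subset)
        finally show ?thesis by auto
      qed
    qed
    \<comment> \<open>The union of \<open>A\<close> and \<open>B\<close> need not be convex; a
      smaller neighbourhood of the segment restores convexity.\<close>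
    then obtain D where "open D" "convex D" "closed_segment 0 (s' *\<^sub>R z) \<subseteq> D" "D \<subseteq> A \<union> B"
      using convex_open_between[of "closed_segment 0 (s' *\<^sub>R z)" "A \<union> B"] A B by auto
    ultimately have "open D \<and> convex D \<and> closed_segment 0 (s' *\<^sub>R z) \<subseteq> D \<and> primitive_on euclidean \<phi> D G"
      using primitive_on_subset by metis
    then show ?thesis
      unfolding T_def by blast
  qed
  have "(0 \<in> T) = (1 \<in> T)"
  proof (rule locally_constant_on_connectedin[where k = "\<lambda>t. t \<in> T"])
    show "connectedin euclidean {0..1::real}" by simp
    fix t :: real assume t: "t \<in> {0..1}"
    obtain U h where U: "open U" "t *\<^sub>R z \<in> U" "primitive_on euclidean \<phi> U h"
      using cocycle_euclideanE[OF \<phi>] by blast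
    then obtain r where r: "r > 0" "ball (t *\<^sub>R z) r \<subseteq> U"
      by (meson open_contains_ball)
    define N where "N = (\<lambda>s. s *\<^sub>R z) -` ball (t *\<^sub>R z) r"
    have N: "open N" "t \<in> N"
      using r by (auto simp: N_def intro!: open_vimage continuous_intros)
    have B: "primitive_on euclidean \<phi> (ball (t *\<^sub>R z) r) h"
      using U r primitive_on_subset by blast
    have "(s \<in> T) = (t \<in> T)" if "s \<in> N \<inter> {0..1}" for s
      using step[of s t "ball (t *\<^sub>R z) r" h] step[of t s "ball (t *\<^sub>R z) r" h] B that t N(2)
      unfolding N_def by auto
    then show "\<exists>U. openin euclidean U \<and> t \<in> U \<and> (\<forall>y\<in>U \<inter> {0..1}. (y \<in> T) = (t \<in> T))"
      using N by auto
  qed auto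
  moreover have "0 \<in> T"
  proof -
    obtain U h where U: "open U" "0 \<in> U" "primitive_on euclidean \<phi> U h"
      using cocycle_euclideanE[OF \<phi>] by blast
    then obtain r where "r > 0" "ball 0 r \<subseteq> U"
      by (meson open_contains_ball)
    then show ?thesis
      unfolding T_def using U primitive_on_subset[OF U(3)]
      by (auto intro!: exI[of _ "ball 0 r"])
  qed
  ultimately show ?thesis by (auto simp: T_def)
qed

text \<open>Primitives on convex sets \<open>A z\<close> containing 0 and \<open>z\<close> are
  normalised to be false at 0. Any two agree on their overlap, which is convex and contains 0, so
  the diagonal values \<open>g z z\<close> form a global primitive.\<close>

lemma cocycle_euclidean_primitive:
  fixes \<phi> :: "'b::euclidean_space \<Rightarrow> 'b \<Rightarrow> bool"
  assumes \<phi>: "cocycle euclidean \<phi>"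
  shows "\<exists>g. primitive_on euclidean \<phi> UNIV g"
proof -
  have "\<exists>A g. open A \<and> convex A \<and> 0 \<in> A \<and> z \<in> A \<and> primitive_on euclidean \<phi> A g \<and> \<not> g 0" for z
  proof -
    obtain A g where "open A" "convex A" "closed_segment 0 z \<subseteq> A" "primitive_on euclidean \<phi> A g"
      using primitive_on_segment[OF \<phi>] by blast
    then show ?thesis
      using primitive_on_flip[of euclidean \<phi> A g "g 0"] by (intro exI[of _ A] exI[of _ "\<lambda>x. g x \<noteq> g 0"]) auto
  qed
  then obtain A g where A: "\<And>z. open (A z)" "\<And>z. convex (A z)" "\<And>z. 0 \<in> A z" "\<And>z. z \<in> A z"
      and g: "\<And>z. primitive_on euclidean \<phi> (A z) (g z)" "\<And>z. \<not> g z 0"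
    by metis
  have eq: "g z z = g w z" if "z \<in> A w" for z w
  proof -
    have "(g z 0 = g w 0) = (g z z = g w z)"
    proof (rule primitive_on_unique)
      show "primitive_on euclidean \<phi> (A z \<inter> A w) (g z)" "primitive_on euclidean \<phi> (A z \<inter> A w) (g w)"
        using g primitive_on_subset by (metis inf_le1, metis inf_le2)
      show "connectedin euclidean (A z \<inter> A w)"
        using A by (simp add: convex_Int convex_connected)
    qed (use that A in auto)
    then show ?thesis using g by simp
  qed
  have "primitive_on euclidean \<phi> UNIV (\<lambda>z. g z z)"
    unfolding primitive_on_def
  proof
    fix w :: 'b
    obtain U where U: "open U" "w \<in> U" "\<forall>y\<in>U \<inter> A w. (g w w \<noteq> g w y) = \<phi> w y"
      using g(1)[of w] A(4)[of w] unfolding primitive_on_def by auto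
    then show "\<exists>U. openin euclidean U \<and> w \<in> U \<and> (\<forall>y\<in>U \<inter> UNIV. (g w w \<noteq> g y y) = \<phi> w y)"
      using A eq by (intro exI[of _ "U \<inter> A w"]) auto
  qed
  then show ?thesis by blast
qed

section \<open>Cocycles on a space with planar charts\<close>

text \<open>Chart domains are homeomorphic to the whole plane, not merely to an open part of it, so
  that every cocycle has a primitive on an entire chart.\<close>

definition locally_planar :: "'a topology \<Rightarrow> bool" where
  "locally_planar M \<longleftrightarrow> (\<forall>x\<in>topspace M. \<exists>U \<psi>. openin M U \<and> x \<in> U \<and>
     homeomorphic_map (euclidean :: complex topology) (subtopology M U) \<psi>)"

lemma locally_planarE:
  assumes "locally_planar M" "x \<in> topspace M"
  obtains U and \<psi> :: "complex \<Rightarrow> 'a" where "openin M U" "x \<in> U" "homeomorphic_map euclidean (subtopology M U) \<psi>"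
  using assms unfolding locally_planar_def by metis

lemma homeomorphic_map_openin_image:
  assumes "homeomorphic_map (euclidean :: 'b::topological_space topology) (subtopology M U) \<psi>" "openin M U" "open N"
  shows "openin M (\<psi> ` N)"
proof -
  have "openin (subtopology M U) (\<psi> ` N)"
    using assms homeomorphic_map_openness[of euclidean "subtopology M U" \<psi> N] by simp
  then show ?thesis using assms openin_trans_full by blast
qed

lemma homeomorphic_map_open_vimage:
  assumes "homeomorphic_map (euclidean :: 'b::topological_space topology) (subtopology M U) \<psi>" "openin M W"
  shows "open (\<psi> -` W)"
proof -
  have "continuous_map euclidean M \<psi>"
    using homeomorphic_imp_continuous_map[OF assms(1)] continuous_map_into_fulltopology by blast
  from openin_continuous_map_preimage[OF this assms(2)] show ?thesis
    by (simp add: vimage_def)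
qed

text \<open>Being a primitive is a local topological condition, so the cocycle is pulled back along
  the chart, integrated on the plane, and the result is carried back by the inverse of the
  chart.\<close>

lemma cocycle_chart_primitive:
  fixes \<psi> :: "complex \<Rightarrow> 'a"
  assumes \<phi>: "cocycle M \<phi>" and U: "openin M U"
    and \<psi>: "homeomorphic_map euclidean (subtopology M U) \<psi>"
  shows "\<exists>g. primitive_on M \<phi> U g"
proof -
  have UM: "U \<subseteq> topspace M" using U openin_subset by blast
  have bij: "bij_betw \<psi> UNIV U"
    using homeomorphic_imp_injective_map[OF \<psi>] homeomorphic_imp_surjective_map[OF \<psi>] UM
    by (simp add: bij_betw_def inf.absorb2)
  have img: "\<psi> z \<in> U" for z using bij by (auto simp: bij_betw_def)
  have "cocycle euclidean (\<lambda>a b. \<phi> (\<psi> a) (\<psi> b))"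
    unfolding cocycle_def
  proof
    fix a :: complex
    obtain W g where W: "openin M W" "\<psi> a \<in> W" and g: "primitive_on M \<phi> W g"
      using \<phi> img UM unfolding cocycle_def by blast
    have "primitive_on euclidean (\<lambda>a b. \<phi> (\<psi> a) (\<psi> b)) (\<psi> -` W) (g \<circ> \<psi>)"
      unfolding primitive_on_def
    proof
      fix b assume "b \<in> \<psi> -` W"
      then obtain N where "openin M N" "\<psi> b \<in> N" "\<forall>y\<in>N \<inter> W. (g (\<psi> b) \<noteq> g y) = \<phi> (\<psi> b) y"
        using g unfolding primitive_on_def by blast
      then show "\<exists>U. openin euclidean U \<and> b \<in> U \<and>
          (\<forall>y\<in>U \<inter> \<psi> -` W. ((g \<circ> \<psi>) b \<noteq> (g \<circ> \<psi>) y) = \<phi> (\<psi> b) (\<psi> y))"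
        using homeomorphic_map_open_vimage[OF \<psi>] by (intro exI[of _ "\<psi> -` N"]) auto
    qed
    then show "\<exists>U g. openin euclidean U \<and> a \<in> U \<and> primitive_on euclidean (\<lambda>a b. \<phi> (\<psi> a) (\<psi> b)) U g"
      using W homeomorphic_map_open_vimage[OF \<psi>] by auto
  qed
  then obtain g where g: "primitive_on euclidean (\<lambda>a b. \<phi> (\<psi> a) (\<psi> b)) UNIV g"
    using cocycle_euclidean_primitive by blast
  have inv: "inv_into UNIV \<psi> (\<psi> z) = z" for z
    using bij by (simp add: bij_betw_def)
  have "primitive_on M \<phi> U (g \<circ> inv_into UNIV \<psi>)"
    unfolding primitive_on_def
  proof
    fix x assume "x \<in> U"
    then obtain a where a: "x = \<psi> a" using bij by (auto simp: bij_betw_def)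
    obtain N where "open N" "a \<in> N" "\<forall>y\<in>N. (g a \<noteq> g y) = \<phi> (\<psi> a) (\<psi> y)"
      using g unfolding primitive_on_def by auto
    then show "\<exists>V. openin M V \<and> x \<in> V \<and> (\<forall>y\<in>V \<inter> U. ((g \<circ> inv_into UNIV \<psi>) x \<noteq> (g \<circ> inv_into UNIV \<psi>) y) = \<phi> x y)"
      using homeomorphic_map_openin_image[OF \<psi> U] by (intro exI[of _ "\<psi> ` N"]) (auto simp: a inv)
  qed
  then show ?thesis by blast
qed

lemma locally_planar_connected_neighbourhood:
  fixes M :: "'a topology"
  assumes "locally_planar M" "openin M W" "p \<in> W"
  obtains N :: "'a set" where "openin M N" "p \<in> N" "N \<subseteq> W" "connectedin M N"
proof -
  have "p \<in> topspace M" using assms openin_subset by blast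
  then obtain U and \<psi> :: "complex \<Rightarrow> 'a" where U: "openin M U" "p \<in> U"
    and \<psi>: "homeomorphic_map euclidean (subtopology M U) \<psi>"
    using locally_planarE[OF assms(1)] by blast
  have "\<psi> ` UNIV = U"
    using homeomorphic_imp_surjective_map[OF \<psi>] U(1) openin_subset by fastforce
  then obtain a where a: "p = \<psi> a" using U by auto
  have "open (\<psi> -` W)" "a \<in> \<psi> -` W"
    using homeomorphic_map_open_vimage[OF \<psi> assms(2)] a assms(3) by auto
  then obtain r where r: "r > 0" "ball a r \<subseteq> \<psi> -` W"
    by (meson open_contains_ball)
  have "continuous_map euclidean M \<psi>"
    using homeomorphic_imp_continuous_map[OF \<psi>] continuous_map_into_fulltopology by blast
  then have "connectedin M (\<psi> ` ball a r)"
    by (rule connectedin_continuous_map_image) simp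
  then show ?thesis
    using that[of "\<psi> ` ball a r"] homeomorphic_map_openin_image[OF \<psi> U(1)] r a by auto
qed

text \<open>
  On each of finitely many charts a cocycle has a primitive. Two primitives differ by a locally
  constant function on the overlap, and \<open>D\<close> records this difference at one point in each member of a
  finite cover of the overlap by connected sets.
\<close>

theorem finitely_many_cocycle_classes:
  fixes M :: "'a topology"
  assumes comp: "compact_space M" and haus: "Hausdorff_space M" and plan: "locally_planar M"
  obtains P :: "('a \<times> 'a \<times> 'a) set" and D
  where "finite P" "\<And>\<phi>. D \<phi> \<subseteq> P"
    "\<And>\<phi> \<phi>'. cocycle M \<phi> \<Longrightarrow> cocycle M \<phi>' \<Longrightarrow> D \<phi> = D \<phi>' \<Longrightarrow>
       \<exists>g. primitive_on M (\<lambda>x y. \<phi> x y \<noteq> \<phi>' x y) (topspace M) g"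
proof -
  have reg: "regular_space M"
    using comp haus compact_Hausdorff_imp_regular_space by blast
  \<comment> \<open>The closed sets between \<open>V x\<close> and \<open>U x\<close> make the
    overlaps \<open>A x \<inter> A y\<close> compact, while the primitives live on the larger open
    sets \<open>U x\<close>.\<close>
  have "\<exists>U V A. openin M U \<and> openin M V \<and> closedin M A \<and> x \<in> V \<and> V \<subseteq> A \<and> A \<subseteq> U \<and>
      (\<forall>\<phi>. cocycle M \<phi> \<longrightarrow> (\<exists>g. primitive_on M \<phi> U g))" if x: "x \<in> topspace M" for x
  proof -
    obtain U and \<psi> :: "complex \<Rightarrow> 'a" where U: "openin M U" "x \<in> U"
      and \<psi>: "homeomorphic_map euclidean (subtopology M U) \<psi>"
      using locally_planarE[OF plan x] by blast
    moreover obtain V A where "openin M V" "closedin M A" "x \<in> V" "V \<subseteq> A" "A \<subseteq> U"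
      using reg U unfolding neighbourhood_base_of_closedin[symmetric] neighbourhood_base_of by metis
    ultimately show ?thesis
      using cocycle_chart_primitive by metis
  qed
  then obtain U V A where U: "\<And>x. x \<in> topspace M \<Longrightarrow> openin M (U x)"
    and V: "\<And>x. x \<in> topspace M \<Longrightarrow> openin M (V x) \<and> x \<in> V x \<and> V x \<subseteq> A x"
    and A: "\<And>x. x \<in> topspace M \<Longrightarrow> closedin M (A x) \<and> A x \<subseteq> U x"
    and prim: "\<And>x \<phi>. x \<in> topspace M \<Longrightarrow> cocycle M \<phi> \<Longrightarrow> \<exists>g. primitive_on M \<phi> (U x) g"
    by metis
  have "topspace M \<subseteq> \<Union>(V ` topspace M)" using V by blast
  then obtain \<F> where "finite \<F>" "\<F> \<subseteq> V ` topspace M" "topspace M \<subseteq> \<Union>\<F>"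
    using compactinD[of M "topspace M" "V ` topspace M"] comp V unfolding compact_space_def by blast
  then obtain X where X: "finite X" "X \<subseteq> topspace M" "topspace M \<subseteq> (\<Union>x\<in>X. V x)"
    by (metis finite_subset_image)
  \<comment> \<open>Sample points: every \<open>q\<close> in the overlap lies with one of them in a
    connected part of \<open>U x \<inter> U y\<close>, on which the difference of two primitives is
    constant.\<close>
  have "\<exists>P. finite P \<and> P \<subseteq> A x \<inter> A y \<and> (\<forall>q\<in>A x \<inter> A y. \<exists>p\<in>P. \<exists>N. connectedin M N \<and> N \<subseteq> U x \<inter> U y
      \<and> p \<in> N \<and> q \<in> N)" if xy: "x \<in> X" "y \<in> X" for x y
  proof -
    have xy': "x \<in> topspace M" "y \<in> topspace M" using xy X by auto
    have "\<exists>N. openin M N \<and> p \<in> N \<and> N \<subseteq> U x \<inter> U y \<and> connectedin M N" if "p \<in> A x \<inter> A y" for p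
      using locally_planar_connected_neighbourhood[OF plan, of "U x \<inter> U y" p] that U A xy'
      by (metis IntD1 IntD2 IntI openin_Int subsetD)
    then obtain N where N: "\<And>p. p \<in> A x \<inter> A y \<Longrightarrow> openin M (N p) \<and> p \<in> N p \<and> N p \<subseteq> U x \<inter> U y
         \<and> connectedin M (N p)"
      by metis
    have "compactin M (A x \<inter> A y)"
      using A xy' comp by (simp add: closedin_Int closedin_compact_space)
    moreover have "A x \<inter> A y \<subseteq> \<Union>(N ` (A x \<inter> A y))" using N by blast
    ultimately have "\<exists>\<F>. finite \<F> \<and> \<F> \<subseteq> N ` (A x \<inter> A y) \<and> A x \<inter> A y \<subseteq> \<Union>\<F>"
      using N compactinD[of M "A x \<inter> A y" "N ` (A x \<inter> A y)"] by blast
    then obtain P where P: "finite P" "P \<subseteq> A x \<inter> A y" "A x \<inter> A y \<subseteq> (\<Union>p\<in>P. N p)"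
      by (metis finite_subset_image)
    have "\<exists>p\<in>P. \<exists>N. connectedin M N \<and> N \<subseteq> U x \<inter> U y \<and> p \<in> N \<and> q \<in> N"
      if q: "q \<in> A x \<inter> A y" for q
    proof -
      obtain p where p: "p \<in> P" "q \<in> N p" using q P(3) by blast
      then show ?thesis using N[of p] P(2) by blast
    qed
    then show ?thesis using P by blast
  qed
  then obtain Q where Q: "\<And>x y. x \<in> X \<Longrightarrow> y \<in> X \<Longrightarrow> finite (Q x y) \<and> Q x y \<subseteq> A x \<inter> A y \<and>
      (\<forall>q\<in>A x \<inter> A y. \<exists>p\<in>Q x y. \<exists>N. connectedin M N \<and> N \<subseteq> U x \<inter> U y \<and> p \<in> N \<and> q \<in> N)"
    by metis
  define P where "P = {(x, y, p). x \<in> X \<and> y \<in> X \<and> p \<in> Q x y}"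
  define G where "G = (\<lambda>\<phi> x. SOME g. primitive_on M \<phi> (U x) g)"
  have G: "primitive_on M \<phi> (U x) (G \<phi> x)" if "cocycle M \<phi>" "x \<in> X" for \<phi> x
  proof -
    have "x \<in> topspace M" using that X by auto
    then have "\<exists>g. primitive_on M \<phi> (U x) g" using prim that by simp
    then show ?thesis unfolding G_def by (rule someI_ex)
  qed
  \<comment> \<open>The Cech cochain of the chosen primitives, read off at the sample
    points.\<close>
  define D where "D = (\<lambda>\<phi>. {(x, y, p) \<in> P. G \<phi> x p \<noteq> G \<phi> y p})"
  show ?thesis
  proof
    have "P = (\<Union>x\<in>X. \<Union>y\<in>X. \<Union>p\<in>Q x y. {(x, y, p)})" by (auto simp: P_def)
    then show "finite P" using X Q by simp
    show "D \<phi> \<subseteq> P" for \<phi> by (auto simp: D_def)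
    fix \<phi> \<phi>' assume \<phi>: "cocycle M \<phi>" and \<phi>': "cocycle M \<phi>'" and D: "D \<phi> = D \<phi>'"
    \<comment> \<open>\<open>k x\<close> is the difference of the two chosen primitives on chart
      \<open>x\<close>. Equal samples make these functions agree on overlaps, so they glue to a
      primitive of the difference of the cocycles.\<close>
    define k where "k = (\<lambda>x q. G \<phi> x q \<noteq> G \<phi>' x q)"
    have k: "k x q = k y q" if xy: "x \<in> X" "y \<in> X" and q: "q \<in> A x \<inter> A y" for x y q
    proof -
      obtain p N where p: "p \<in> Q x y" and N: "connectedin M N" "N \<subseteq> U x \<inter> U y" "p \<in> N" "q \<in> N"
        using Q xy q by blast
      have "(G \<phi> x p \<noteq> G \<phi> y p) = (G \<phi>' x p \<noteq> G \<phi>' y p)"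
      proof -
        have "(x, y, p) \<in> D \<phi> \<longleftrightarrow> (x, y, p) \<in> D \<phi>'" using D by simp
        then show ?thesis using p xy by (simp add: D_def P_def)
      qed
      moreover have "(G \<theta> x p = G \<theta> y p) = (G \<theta> x q = G \<theta> y q)" if "cocycle M \<theta>" for \<theta>
      proof (rule primitive_on_unique[OF _ _ N(1,3,4)])
        show "primitive_on M \<theta> N (G \<theta> x)" "primitive_on M \<theta> N (G \<theta> y)"
          using primitive_on_subset[OF G[OF that xy(1)]] primitive_on_subset[OF G[OF that xy(2)]] N(2)
          by blast+
      qed
      ultimately show ?thesis using \<phi> \<phi>' unfolding k_def by blast
    qed
    define i where "i = (\<lambda>q. SOME x. x \<in> X \<and> q \<in> A x)"
    have i: "i q \<in> X \<and> q \<in> A (i q)" if q: "q \<in> topspace M" for q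
    proof -
      obtain x where "x \<in> X" "q \<in> V x" using q X(3) by blast
      then have "x \<in> X \<and> q \<in> A x" using V X(2) by blast
      then show ?thesis unfolding i_def by (rule someI)
    qed
    have kx: "k (i q) q = k x q" if "q \<in> A x" "x \<in> X" for q x
    proof -
      have "q \<in> topspace M" using that A[of x] X(2) closedin_subset by blast
      then show ?thesis using k[of "i q" x q] i[of q] that by simp
    qed
    have "primitive_on M (\<lambda>x y. \<phi> x y \<noteq> \<phi>' x y) (topspace M) (\<lambda>q. k (i q) q)"
      unfolding primitive_on_def
    proof
      fix q assume q: "q \<in> topspace M"
      \<comment> \<open>Away from the sets \<open>A x\<close> that miss \<open>q\<close>, every
        index of a nearby point \<open>y\<close> is also an index of \<open>q\<close>; hence both
        values can be read in the chart chosen for \<open>y\<close>.\<close>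
      define W where "W = topspace M - \<Union>(A ` {x\<in>X. q \<notin> A x})"
      have "openin M W" unfolding W_def
        by (intro openin_diff openin_topspace closedin_Union) (use X A in auto)
      moreover have "q \<in> W" using q by (auto simp: W_def)
      moreover have "\<exists>B. openin M B \<and> q \<in> B \<and> (\<forall>y\<in>B \<inter> U x. (G \<theta> x q \<noteq> G \<theta> x y) = \<theta> q y)"
        if "cocycle M \<theta>" "x \<in> X" "q \<in> A x" for \<theta> x
      proof -
        have "q \<in> U x" using that A[of x] X(2) by blast
        then show ?thesis
          using primitive_onE[OF G[OF that(1,2)]] by (metis IntD1 IntD2)
      qed
      then have "\<forall>\<theta> x. \<exists>B. cocycle M \<theta> \<longrightarrow> x \<in> X \<longrightarrow> q \<in> A x \<longrightarrow>
          openin M B \<and> q \<in> B \<and> (\<forall>y\<in>B \<inter> U x. (G \<theta> x q \<noteq> G \<theta> x y) = \<theta> q y)" by blast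
      then obtain B where B: "\<And>\<theta> x. cocycle M \<theta> \<Longrightarrow> x \<in> X \<Longrightarrow> q \<in> A x \<Longrightarrow>
          openin M (B \<theta> x) \<and> q \<in> B \<theta> x \<and> (\<forall>y\<in>B \<theta> x \<inter> U x. (G \<theta> x q \<noteq> G \<theta> x y) = \<theta> q y)"
        by metis
      define W' where "W' = W \<inter> \<Inter>((\<lambda>x. B \<phi> x \<inter> B \<phi>' x) ` {x\<in>X. q \<in> A x})"
      have W': "W' \<subseteq> W" "\<And>x. x \<in> X \<Longrightarrow> q \<in> A x \<Longrightarrow> W' \<subseteq> B \<phi> x \<inter> B \<phi>' x" by (auto simp: W'_def)
      have "openin M W'"
      proof -
        have "{x\<in>X. q \<in> A x} \<noteq> {}" using i[OF q] by auto
        then have "openin M (\<Inter>((\<lambda>x. B \<phi> x \<inter> B \<phi>' x) ` {x\<in>X. q \<in> A x}))"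
          by (intro openin_INT2) (use X B \<phi> \<phi>' in auto)
        then show ?thesis using \<open>openin M W\<close> unfolding W'_def by blast
      qed
      moreover have "q \<in> W'"
        using B \<phi> \<phi>' \<open>q \<in> W\<close> by (auto simp: W'_def)
      moreover have "(k (i q) q \<noteq> k (i y) y) = (\<phi> q y \<noteq> \<phi>' q y)" if y: "y \<in> W' \<inter> topspace M" for y
      proof -
        define x where "x = i y"
        have x: "x \<in> X" "y \<in> A x" using i y by (auto simp: x_def)
        have qx: "q \<in> A x" using x y W' unfolding W_def by blast
        have "y \<in> U x" using x A X by blast
        have "(G \<phi> x q \<noteq> G \<phi> x y) = \<phi> q y" "(G \<phi>' x q \<noteq> G \<phi>' x y) = \<phi>' q y"
          using B[OF \<phi> x(1) qx] B[OF \<phi>' x(1) qx] W'(2)[OF x(1) qx] y \<open>y \<in> U x\<close> by blast+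
        moreover have "k (i q) q = k x q" using kx qx x by blast
        ultimately show ?thesis unfolding x_def[symmetric] k_def by auto
      qed
      ultimately show "\<exists>U. openin M U \<and> q \<in> U \<and> (\<forall>y\<in>U \<inter> topspace M.
          (k (i q) q \<noteq> k (i y) y) = (\<phi> q y \<noteq> \<phi>' q y))" by blast
    qed
    then show "\<exists>g. primitive_on M (\<lambda>x y. \<phi> x y \<noteq> \<phi>' x y) (topspace M) g" by blast
  qed
qed

section \<open>Parametrized cells\<close>

text \<open>The dimension of the cell is that of the type \<open>'b\<close>: \<open>real\<close> for
  edges and \<open>complex\<close> for faces. Injectivity on the closed ball expresses regularity;
  compactness of the ball then makes the inverse continuous when \<open>M\<close> is
  Hausdorff.\<close>

definition cell_parametrization ::
    "'a topology \<Rightarrow> ('b::euclidean_space \<Rightarrow> 'a) \<Rightarrow> 'a set \<Rightarrow> bool" where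
  "cell_parametrization M P e \<longleftrightarrow>
     continuous_map (top_of_set (cball 0 1)) M P \<and> inj_on P (cball 0 1) \<and> P ` ball 0 1 = e"

context
  fixes M :: "'a topology" and P :: "'b::euclidean_space \<Rightarrow> 'a" and e :: "'a set"
  assumes haus: "Hausdorff_space M" and param: "cell_parametrization M P e"
begin

lemma cell_parametrization_subset: "P ` cball 0 1 \<subseteq> topspace M"
  using param unfolding cell_parametrization_def continuous_map_def by fastforce

lemma cell_parametrization_image_closedin:
  assumes "compact K" "K \<subseteq> cball 0 1" shows "closedin M (P ` K)"
proof -
  have "compactin M (P ` K)"
    using param assms unfolding cell_parametrization_def
    by (intro image_compactin[of "top_of_set (cball 0 1)"]) (auto simp: compactin_subtopology)
  then show ?thesis using haus compactin_imp_closedin by blast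
qed

text \<open>The image of the closed ball is compact, hence closed, and continuity puts the images of
  boundary points into the closure of the open cell.\<close>

lemma cell_parametrization_closure: "M closure_of e = P ` cball 0 1"
proof
  have e: "e = P ` ball 0 1" using param by (simp add: cell_parametrization_def)
  show "M closure_of e \<subseteq> P ` cball 0 1"
    unfolding e using cell_parametrization_image_closedin[OF compact_cball order_refl] ball_subset_cball
    by (intro closure_of_minimal) blast+
  have "P ` (top_of_set (cball 0 1) closure_of ball 0 1) \<subseteq> M closure_of (P ` ball 0 1)"
    using param unfolding cell_parametrization_def
    by (intro continuous_map_image_closure_subset) auto
  moreover have "top_of_set (cball 0 1) closure_of ball 0 1 = cball (0::'b) 1"
    by (simp add: closure_of_subtopology Int_absorb1)
  ultimately show "P ` cball 0 1 \<subseteq> M closure_of e" by (simp add: e)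
qed

lemma cell_parametrization_boundary: "P ` sphere 0 1 \<inter> e = {}"
proof -
  have "sphere (0::'b) 1 \<subseteq> cball 0 1" "ball (0::'b) 1 \<subseteq> cball 0 1" "sphere (0::'b) 1 \<inter> ball 0 1 = {}" by auto
  then show ?thesis
    using param unfolding cell_parametrization_def
    by (metis Int_commute image_empty inj_on_image_Int)
qed

lemma cell_parametrization_closure_eq: "M closure_of e = e \<union> P ` sphere 0 1"
proof -
  have "cball (0::'b) 1 = ball 0 1 \<union> sphere 0 1" by auto
  then show ?thesis
    using param unfolding cell_parametrization_closure cell_parametrization_def by (metis image_Un)
qed

lemma cell_parametrization_nonempty: "e \<noteq> {}"
  using param unfolding cell_parametrization_def by (auto simp: ball_eq_empty)

lemma cell_parametrization_connectedin: "connectedin M e" "connectedin M (M closure_of e)"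
proof -
  have "connectedin M (P ` S)" if "S \<subseteq> cball 0 1" "connected S" for S
    using param that unfolding cell_parametrization_def
    by (intro connectedin_continuous_map_image[of "top_of_set (cball 0 1)"])
       (auto simp: connectedin_subtopology)
  from this[of "ball 0 1"] this[of "cball 0 1"]
  show "connectedin M e" "connectedin M (M closure_of e)"
    using param ball_subset_cball unfolding cell_parametrization_closure cell_parametrization_def
    by (auto simp: convex_connected)
qed

lemma cell_parametrization_homeomorphic:
  "homeomorphic_map (top_of_set (cball 0 1)) (subtopology M (P ` cball 0 1)) P"
proof (rule continuous_imp_homeomorphic_map)
  show "compact_space (top_of_set (cball (0::'b) 1))" by (simp add: compact_space_subtopology)
  show "Hausdorff_space (subtopology M (P ` cball 0 1))" using haus Hausdorff_space_subtopology by blast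
  show "continuous_map (top_of_set (cball 0 1)) (subtopology M (P ` cball 0 1)) P"
    using param unfolding cell_parametrization_def by (simp add: continuous_map_in_subtopology)
  show "P ` topspace (top_of_set (cball 0 1)) = topspace (subtopology M (P ` cball 0 1))"
    using cell_parametrization_subset by auto
  show "inj_on P (topspace (top_of_set (cball 0 1)))"
    using param unfolding cell_parametrization_def by simp
qed

lemma cell_parametrization_inverse_continuous:
  "continuous_map (subtopology M (M closure_of e)) (top_of_set (cball 0 1)) (inv_into (cball 0 1) P)"
proof -
  obtain Q where Q: "homeomorphic_maps (top_of_set (cball 0 1)) (subtopology M (P ` cball 0 1)) P Q"
    using cell_parametrization_homeomorphic homeomorphic_map_maps by blast
  have "continuous_map (subtopology M (P ` cball 0 1)) (top_of_set (cball 0 1)) Q"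
    using Q by (simp add: homeomorphic_maps_def)
  then have "continuous_map (subtopology M (P ` cball 0 1)) (top_of_set (cball 0 1)) (inv_into (cball 0 1) P)"
  proof (rule continuous_map_eq)
    fix x assume "x \<in> topspace (subtopology M (P ` cball 0 1))"
    then obtain z where "z \<in> cball 0 1" "x = P z" by auto
    moreover have "Q (P z) = z" if "z \<in> cball 0 1"
      using Q that by (auto simp: homeomorphic_maps_def)
    ultimately show "Q x = inv_into (cball 0 1) P x"
      using param unfolding cell_parametrization_def by simp
  qed
  then show ?thesis by (simp add: cell_parametrization_closure)
qed

text \<open>The inverse parametrization turns \<open>u\<close> into an injection between Euclidean
  spaces, whose image is open by \<open>inv\<close>, an instance of invariance of domain. Openness
  is claimed relative to \<open>e\<close> only, since a cell of lower dimension need not be open in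
  \<open>M\<close>.\<close>

lemma cell_parametrization_openin_image:
  fixes V :: "'c::t2_space set"
  assumes u: "continuous_map (top_of_set V) M u" "inj_on u V" "u ` V \<subseteq> e" and V: "open V"
    and inv: "\<And>f :: 'c \<Rightarrow> 'b. continuous_on V f \<Longrightarrow> inj_on f V \<Longrightarrow> open (f ` V)"
  shows "\<exists>U. openin M U \<and> U \<inter> e = u ` V"
proof -
  define f where "f = inv_into (cball 0 1) P \<circ> u"
  have e: "e = P ` ball 0 1" using param by (simp add: cell_parametrization_def)
  have P: "inj_on P (cball 0 1)" using param by (simp add: cell_parametrization_def)
  have eP: "e \<subseteq> P ` cball 0 1" unfolding e using ball_subset_cball by blast
  have "continuous_map (top_of_set V) (subtopology M (M closure_of e)) u"
    using u eP by (auto simp: continuous_map_in_subtopology cell_parametrization_closure)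
  then have "continuous_map (top_of_set V) (top_of_set (cball 0 1)) f"
    unfolding f_def using cell_parametrization_inverse_continuous continuous_map_compose by blast
  then have "continuous_on V f"
    by (simp add: continuous_map_in_subtopology)
  moreover have "inj_on f V"
    unfolding f_def using u eP by (intro comp_inj_on) (auto intro: inj_on_inv_into inj_on_subset)
  ultimately have op: "open (f ` V)" by (rule inv)
  have fP: "P (f x) = u x" if "x \<in> V" for x
    unfolding f_def using that u eP by (auto intro!: f_inv_into_f)
  have fV: "f ` V \<subseteq> ball 0 1"
  proof
    fix y assume "y \<in> f ` V"
    then obtain x where x: "x \<in> V" "y = f x" by auto
    then obtain z where z: "z \<in> ball 0 1" "u x = P z" using u e by blast
    then have "f x = z"
      unfolding f_def using P ball_subset_cball by (auto simp: inv_into_f_f)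
    then show "y \<in> ball 0 1" using x z by simp
  qed
  have "openin (top_of_set (cball 0 1)) (f ` V)"
    using op fV ball_subset_cball by (intro open_subset) auto
  then have "openin (subtopology M (P ` cball 0 1)) (P ` f ` V)"
    using homeomorphic_map_openness[OF cell_parametrization_homeomorphic, of "f ` V"] fV ball_subset_cball
    by (metis openin_subset topspace_euclidean_subtopology)
  moreover have "P ` f ` V = u ` V" using fP by force
  ultimately obtain U where "openin M U" "u ` V = U \<inter> P ` cball 0 1"
    by (auto simp: openin_subtopology)
  then show ?thesis using u eP by (intro exI[of _ U]) auto
qed

end

section \<open>Invariance of domain on a surface\<close>

text \<open>Locally, \<open>h\<close> followed by the inverse of a chart is a continuous injection
  of an open subset of the plane into the plane.\<close>

lemma locally_planar_openin_image:
  fixes h :: "complex \<Rightarrow> 'a"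
  assumes plan: "locally_planar M" and S: "open S"
    and h: "continuous_map (top_of_set S) M h" "inj_on h S"
  shows "openin M (h ` S)"
proof -
  have "\<exists>N. openin M N \<and> h z \<in> N \<and> N \<subseteq> h ` S" if z: "z \<in> S" for z
  proof -
    have hz: "h z \<in> topspace M" using h z unfolding continuous_map_def by auto
    obtain U and \<psi> :: "complex \<Rightarrow> 'a" where U: "openin M U" "h z \<in> U"
      and \<psi>: "homeomorphic_map euclidean (subtopology M U) \<psi>"
      using locally_planarE[OF plan hz] by blast
    obtain \<theta> where \<theta>: "homeomorphic_maps euclidean (subtopology M U) \<psi> \<theta>"
      using \<psi> homeomorphic_map_maps by blast
    have UM: "U \<subseteq> topspace M" using U openin_subset by blast
    define T where "T = {w \<in> S. h w \<in> U}"
    have "openin (top_of_set S) {w \<in> topspace (top_of_set S). h w \<in> U}"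
      using h U by (intro openin_continuous_map_preimage) auto
    then have "open T" using S by (simp add: T_def openin_open_eq)
    have "continuous_map (top_of_set T) (subtopology M U) h"
      using h continuous_map_from_subtopology_mono[of euclidean S M h T]
      by (auto simp: continuous_map_in_subtopology T_def)
    moreover have "continuous_map (subtopology M U) euclidean \<theta>"
      using \<theta> by (simp add: homeomorphic_maps_def)
    ultimately have "continuous_map (top_of_set T) euclidean (\<theta> \<circ> h)"
      by (rule continuous_map_compose)
    then have "continuous_on T (\<theta> \<circ> h)" by simp
    moreover have inv: "\<psi> (\<theta> x) = x" if "x \<in> U" for x
      using \<theta> that UM by (auto simp: homeomorphic_maps_def)
    have "inj_on (\<theta> \<circ> h) T"
    proof (rule inj_onI)
      fix a b assume "a \<in> T" "b \<in> T" "(\<theta> \<circ> h) a = (\<theta> \<circ> h) b"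
      then have "h a = h b" using inv unfolding T_def by (metis comp_apply mem_Collect_eq)
      then show "a = b" using h \<open>a \<in> T\<close> \<open>b \<in> T\<close> by (auto simp: T_def inj_on_def)
    qed
    ultimately have "open ((\<theta> \<circ> h) ` T)"
      using \<open>open T\<close> by (intro invariance_of_domain)
    then have "openin M (\<psi> ` (\<theta> \<circ> h) ` T)"
      using homeomorphic_map_openin_image[OF \<psi> U(1)] by blast
    moreover have "\<psi> ` (\<theta> \<circ> h) ` T = h ` T"
      using inv by (force simp: T_def image_iff)
    ultimately show ?thesis
      using z U by (intro exI[of _ "h ` T"]) (auto simp: T_def)
  qed
  then show ?thesis
    by (subst openin_subopen) blast
qed

section \<open>Local structure of a decomposition\<close>

text \<open>Cells are sorted by dimension and parametrized by typed balls, which separates the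
  combinatorics from coordinates in \<open>Euclidean_space\<close>. Boundaries are only assumed to
  lie in the union of the lower cells; that closures are unions of cells is proved in
  \<open>frontier\<close>.\<close>

locale regular_surface =
  fixes M :: "'a topology" and C0 C1 C2 :: "'a set set"
  assumes compact: "compact_space M" and Hausdorff: "Hausdorff_space M"
    and planar: "locally_planar M"
    and fin: "finite C0" "finite C1" "finite C2"
    and disj: "disjoint (C0 \<union> C1 \<union> C2)" "C0 \<inter> C1 = {}" "C0 \<inter> C2 = {}" "C1 \<inter> C2 = {}"
    and cover: "\<Union>(C0 \<union> C1 \<union> C2) = topspace M"
    and vertex: "v \<in> C0 \<Longrightarrow> \<exists>x. v = {x}"
    and edge: "e \<in> C1 \<Longrightarrow> \<exists>P :: real \<Rightarrow> 'a. cell_parametrization M P e \<and> P ` sphere 0 1 \<subseteq> \<Union>C0"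
    and face: "f \<in> C2 \<Longrightarrow>
      \<exists>P :: complex \<Rightarrow> 'a. cell_parametrization M P f \<and> P ` sphere 0 1 \<subseteq> \<Union>(C0 \<union> C1)"
begin

lemma edgeE:
  assumes "e \<in> C1"
  obtains P :: "real \<Rightarrow> 'a" where "cell_parametrization M P e" "P ` sphere 0 1 \<subseteq> \<Union>C0"
  using edge[OF assms] by blast

lemma faceE:
  assumes "f \<in> C2"
  obtains P :: "complex \<Rightarrow> 'a" where "cell_parametrization M P f" "P ` sphere 0 1 \<subseteq> \<Union>(C0 \<union> C1)"
  using face[OF assms] by blast

lemma cell_nonempty: "a \<in> C0 \<union> C1 \<union> C2 \<Longrightarrow> a \<noteq> {}"
  by (elim UnE) (use vertex edgeE faceE cell_parametrization_nonempty[OF Hausdorff] in \<open>metis insert_not_empty\<close>)+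

lemma cell_subset: "a \<in> C0 \<union> C1 \<union> C2 \<Longrightarrow> a \<subseteq> topspace M"
  using cover by blast

lemma cell_eqI: "a \<in> C0 \<union> C1 \<union> C2 \<Longrightarrow> b \<in> C0 \<union> C1 \<union> C2 \<Longrightarrow> x \<in> a \<Longrightarrow> x \<in> b \<Longrightarrow> a = b"
  using disj(1) by (meson disjnt_iff pairwiseD disjnt_def IntI empty_iff)

lemma cell_disjoint: "a \<in> C0 \<union> C1 \<union> C2 \<Longrightarrow> b \<in> C0 \<union> C1 \<union> C2 \<Longrightarrow> a \<noteq> b \<Longrightarrow> a \<inter> b = {}"
  using cell_eqI by blast

lemma closure_vertex: "v \<in> C0 \<Longrightarrow> M closure_of v = v"
  using vertex[of v] cell_subset[of v] Hausdorff
  by (metis UnI1 closure_of_eq closedin_Hausdorff_singleton insert_subset)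

lemma closure_superset: "a \<in> C0 \<union> C1 \<union> C2 \<Longrightarrow> a \<subseteq> M closure_of a"
  by (simp add: cell_subset closure_of_subset)

lemma closure_edge: "e \<in> C1 \<Longrightarrow> M closure_of e \<subseteq> e \<union> \<Union>C0"
  using edgeE[of e] cell_parametrization_closure_eq[OF Hausdorff] by (metis Un_mono order_refl)

lemma closure_face: "f \<in> C2 \<Longrightarrow> M closure_of f \<subseteq> f \<union> \<Union>(C0 \<union> C1)"
  using faceE[of f] cell_parametrization_closure_eq[OF Hausdorff] by (metis Un_mono order_refl)

text \<open>The unit sphere in \<open>real\<close> consists of -1 and 1. Injectivity on the closed
  ball sends them to different vertices, so there are no loops.\<close>

lemma edge_ends:
  assumes e: "e \<in> C1"
  obtains v w where "v \<in> C0" "w \<in> C0" "v \<noteq> w" "{u \<in> C0. u \<subseteq> M closure_of e} = {v, w}"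
    "M closure_of e = e \<union> v \<union> w"
proof -
  obtain P :: "real \<Rightarrow> 'a" where P: "cell_parametrization M P e" "P ` sphere 0 1 \<subseteq> \<Union>C0"
    by (rule edgeE[OF e])
  have sph: "sphere (0::real) 1 = {-1, 1}" by (auto simp: dist_real_def)
  have "P (-1) \<noteq> P 1"
    using P(1) inj_onD[of P "cball 0 1" "-1" 1] unfolding cell_parametrization_def by auto
  obtain v w where vw: "v \<in> C0" "P (-1) \<in> v" "w \<in> C0" "P 1 \<in> w"
    using P(2) sph by auto
  then have vw': "v = {P (-1)}" "w = {P 1}" using vertex by blast+
  have cl: "M closure_of e = e \<union> v \<union> w"
    using cell_parametrization_closure_eq[OF Hausdorff P(1)] sph vw' by auto
  moreover have "u = v \<or> u = w" if u: "u \<in> C0" "u \<subseteq> M closure_of e" for u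
  proof -
    obtain x where "x \<in> u" using cell_nonempty u by blast
    then have "x \<in> e \<or> x \<in> v \<or> x \<in> w" using u cl by blast
    then show ?thesis
      using cell_eqI[of u _ x] \<open>x \<in> u\<close> u vw e disj by blast
  qed
  ultimately show ?thesis
    using that[of v w] vw vw' \<open>P (-1) \<noteq> P 1\<close> by blast
qed

lemma closedin_Un_vertices: "V \<subseteq> C0 \<Longrightarrow> closedin M (\<Union>V)"
proof -
  assume V: "V \<subseteq> C0"
  have "closedin M v" if "v \<in> V" for v
    using closure_vertex[of v] closedin_closure_of[of M v] that V by (metis subsetD)
  then show ?thesis using V fin(1) finite_subset by (intro closedin_Union) auto
qed

text \<open>In other words, \<open>e\<close> is open in the 1-skeleton: what remains is the union of
  the vertices and the closures of the finitely many other edges.\<close>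

lemma closedin_skeleton_minus:
  assumes "e \<in> C1" shows "closedin M (\<Union>(C0 \<union> C1) - e)"
proof -
  have "\<Union>(C0 \<union> C1) - e = \<Union>C0 \<union> (\<Union>a\<in>C1 - {e}. M closure_of a)"
  proof (intro Set.set_eqI iffI)
    fix x assume x: "x \<in> \<Union>(C0 \<union> C1) - e"
    then show "x \<in> \<Union>C0 \<union> (\<Union>a\<in>C1 - {e}. M closure_of a)"
      using closure_superset by fastforce
  next
    fix x assume x: "x \<in> \<Union>C0 \<union> (\<Union>a\<in>C1 - {e}. M closure_of a)"
    then obtain b where "b \<in> C0 \<union> C1" "b \<noteq> e" "x \<in> b"
      using closure_edge disj(2) assms by blast
    then show "x \<in> \<Union>(C0 \<union> C1) - e"
      using cell_eqI[of b e x] assms by blast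
  qed
  moreover have "closedin M (\<Union>C0 \<union> (\<Union>a\<in>C1 - {e}. M closure_of a))"
    using fin by (intro closedin_Un closedin_Un_vertices closedin_Union) auto
  ultimately show ?thesis by simp
qed

lemma closedin_skeleton: "closedin M (\<Union>(C0 \<union> C1))"
proof -
  have "\<Union>(C0 \<union> C1) = \<Union>C0 \<union> (\<Union>a\<in>C1. M closure_of a)"
    using closure_edge closure_superset by blast
  moreover have "closedin M (\<Union>C0 \<union> (\<Union>a\<in>C1. M closure_of a))"
    using fin by (intro closedin_Un closedin_Un_vertices closedin_Union) auto
  ultimately show ?thesis by simp
qed

section \<open>Edges on the boundary circle of a face\<close>

lemma continuous_map_cis_parametrization:
  fixes P :: "complex \<Rightarrow> 'a"
  assumes "cell_parametrization M P f"
  shows "continuous_map euclidean M (\<lambda>t. P (cis t))"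
proof -
  have "continuous_map euclidean (top_of_set (cball 0 1)) cis"
    by (auto simp: continuous_map_in_subtopology intro!: continuous_intros)
  then have "continuous_map euclidean M (P \<circ> cis)"
    using assms unfolding cell_parametrization_def by (intro continuous_map_compose[of _ _ cis _ P]) auto
  then show ?thesis by (simp add: o_def)
qed

lemma circle_openin_edge:
  fixes P :: "complex \<Rightarrow> 'a"
  assumes P: "cell_parametrization M P f" "P ` sphere 0 1 \<subseteq> \<Union>(C0 \<union> C1)" and e: "e \<in> C1"
  shows "open {t. P (cis t) \<in> e}"
proof -
  have "openin M (topspace M - (\<Union>(C0 \<union> C1) - e))"
    using closedin_skeleton_minus[OF e] by blast
  then have "openin euclidean {t \<in> topspace euclidean. P (cis t) \<in> topspace M - (\<Union>(C0 \<union> C1) - e)}"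
    by (rule openin_continuous_map_preimage[OF continuous_map_cis_parametrization[OF P(1)]])
  moreover have "P (cis t) \<in> topspace M - (\<Union>(C0 \<union> C1) - e) \<longleftrightarrow> P (cis t) \<in> e" for t
  proof -
    have "P (cis t) \<in> \<Union>(C0 \<union> C1)" using P(2) by (auto simp: image_subset_iff)
    then show ?thesis using cell_subset by fastforce
  qed
  ultimately show ?thesis by simp
qed

lemma inj_on_cis_interval: "inj_on cis {a<..<a + 2 * pi}"
proof (rule inj_onI)
  fix s t assume st: "s \<in> {a<..<a + 2 * pi}" "t \<in> {a<..<a + 2 * pi}" "cis s = cis t"
  then have "cis (s - t) = 1" by (simp add: cis_divide[symmetric])
  then obtain n :: int where n: "s - t = 2 * pi * n"
    using complex_eq_iff[of "cis (s - t)" 1] cos_one_2pi_int[of "s - t"] by (auto simp: mult.commute)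
  have "\<bar>2 * pi * n\<bar> < 2 * pi" using st n by auto
  then have "\<bar>real_of_int n\<bar> < 1" by (simp add: abs_mult)
  then have "n = 0" by linarith
  then show "s = t" using n by simp
qed

text \<open>Invariance of domain in dimension one. Within a parameter interval of length
  \<open>2 * pi\<close> the circle is traversed injectively, so it sweeps out a relatively open part
  of the edge.\<close>

lemma arc_openin_edge:
  fixes P :: "complex \<Rightarrow> 'a"
  assumes P: "cell_parametrization M P f" and e: "e \<in> C1"
    and V: "open V" "V \<subseteq> {a<..<a + 2 * pi}" "\<And>t. t \<in> V \<Longrightarrow> P (cis t) \<in> e"
  shows "\<exists>U. openin M U \<and> U \<inter> e = (\<lambda>t. P (cis t)) ` V"
proof -
  obtain Q :: "real \<Rightarrow> 'a" where Q: "cell_parametrization M Q e" "Q ` sphere 0 1 \<subseteq> \<Union>C0"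
    by (rule edgeE[OF e])
  show ?thesis
  proof (rule cell_parametrization_openin_image[OF Hausdorff Q(1)])
    show "continuous_map (top_of_set V) M (\<lambda>t. P (cis t))"
      by (rule continuous_map_from_subtopology[OF continuous_map_cis_parametrization[OF P]])
    show "inj_on (\<lambda>t. P (cis t)) V"
    proof (rule inj_onI)
      fix s t assume st: "s \<in> V" "t \<in> V" "P (cis s) = P (cis t)"
      then have "cis s = cis t"
        using P unfolding cell_parametrization_def by (auto dest: inj_onD)
      then show "s = t" using inj_on_cis_interval[of a] st V by (auto dest: inj_onD)
    qed
  qed (use V invariance_of_domain[where 'a = real] in auto)
qed

text \<open>The part of \<open>e\<close> on the circle is closed because the circle is compact, and
  open in \<open>e\<close> because the circle runs through \<open>e\<close> along arcs that are open
  in it. Since \<open>e\<close> is connected, this part is all of \<open>e\<close>.\<close>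

lemma edge_in_circle:
  fixes P :: "complex \<Rightarrow> 'a"
  assumes P: "cell_parametrization M P f" "P ` sphere 0 1 \<subseteq> \<Union>(C0 \<union> C1)"
    and e: "e \<in> C1" and x: "x \<in> e" "x \<in> P ` sphere 0 1"
  shows "e \<subseteq> P ` sphere 0 1"
proof
  fix y assume y: "y \<in> e"
  have conn: "connectedin M e"
    using edgeE[OF e] cell_parametrization_connectedin(1)[OF Hausdorff] by metis
  have cl: "closedin M (P ` sphere 0 1)"
    by (rule cell_parametrization_image_closedin[OF Hausdorff P(1)]) auto
  have "(x \<in> P ` sphere 0 1) = (y \<in> P ` sphere 0 1)"
  proof (rule locally_constant_on_connectedin[OF conn, where k = "\<lambda>x. x \<in> P ` sphere 0 1"])
    fix z assume z: "z \<in> e"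
    show "\<exists>U. openin M U \<and> z \<in> U \<and> (\<forall>y\<in>U \<inter> e. (y \<in> P ` sphere 0 1) = (z \<in> P ` sphere 0 1))"
    proof (cases "z \<in> P ` sphere 0 1")
      case False
      then show ?thesis
        using z e cell_subset cl by (intro exI[of _ "topspace M - P ` sphere 0 1"]) auto
    next
      case True
      then obtain w where "w \<in> sphere 0 1" "z = P w" by auto
      then have "w = cis (Arg w)" using rcis_cmod_Arg[of w] by (simp add: rcis_def)
      then have "z = P (cis (Arg w))" using \<open>z = P w\<close> by metis
      then obtain t where t: "z = P (cis t)" by blast
      define V where "V = {t. P (cis t) \<in> e} \<inter> {t - pi<..<t - pi + 2 * pi}"
      have "open V" using circle_openin_edge[OF P e] unfolding V_def by (intro open_Int) auto
      moreover have "V \<subseteq> {t - pi<..<t - pi + 2 * pi}" "\<And>s. s \<in> V \<Longrightarrow> P (cis s) \<in> e"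
        unfolding V_def by (rule Int_lower2) simp
      ultimately obtain U where U: "openin M U" "U \<inter> e = (\<lambda>t. P (cis t)) ` V"
        using arc_openin_edge[OF P(1) e] by metis
      moreover have "z \<in> (\<lambda>t. P (cis t)) ` V"
        using t z pi_gt_zero by (intro image_eqI[of _ _ t]) (simp_all add: V_def)
      moreover have "(\<lambda>t. P (cis t)) ` V \<subseteq> P ` sphere 0 1" by auto
      ultimately have "openin M U" "z \<in> U" "\<And>y. y \<in> U \<inter> e \<Longrightarrow> y \<in> P ` sphere 0 1" by blast+
      then show ?thesis using True by blast
    qed
  qed (use x y in auto)
  then show "y \<in> P ` sphere 0 1" using x by blast
qed

text \<open>Vertices are points, so the only real case is an edge that meets the closure of a face:
  it meets the boundary circle and therefore lies on it.\<close>

lemma frontier: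
  assumes a: "a \<in> C0 \<union> C1 \<union> C2" and b: "b \<in> C0 \<union> C1 \<union> C2" and x: "x \<in> a" "x \<in> M closure_of b"
  shows "a \<subseteq> M closure_of b"
proof (cases "a = b")
  case True
  then show ?thesis using closure_superset a by blast
next
  case False
  then have xb: "x \<notin> b" using cell_eqI a b x by blast
  consider "b \<in> C0" | "b \<in> C1" | "b \<in> C2" using b by blast
  then show ?thesis
  proof cases
    case 1
    then show ?thesis using closure_vertex xb x by auto
  next
    case 2
    then obtain v where "v \<in> C0" "x \<in> v" using closure_edge x xb by blast
    then have "a = v" using cell_eqI a x by blast
    then show ?thesis using vertex \<open>v \<in> C0\<close> x by blast
  next
    case 3
    obtain P :: "complex \<Rightarrow> 'a" where P: "cell_parametrization M P b" "P ` sphere 0 1 \<subseteq> \<Union>(C0 \<union> C1)"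
      by (rule faceE[OF 3])
    have cl: "M closure_of b = b \<union> P ` sphere 0 1"
      by (rule cell_parametrization_closure_eq[OF Hausdorff P(1)])
    then have xP: "x \<in> P ` sphere 0 1" using x xb by blast
    then obtain c where "c \<in> C0 \<union> C1" "x \<in> c" using P by blast
    then have "a = c" using cell_eqI a x by blast
    then consider "a \<in> C0" | "a \<in> C1" using \<open>c \<in> C0 \<union> C1\<close> by blast
    then show ?thesis
    proof cases
      case 1
      then show ?thesis using vertex x by blast
    next
      case 2
      then show ?thesis using edge_in_circle[OF P _ x(1) xP] cl by blast
    qed
  qed
qed

text \<open>
  Glue the discs of \<open>f1\<close> and \<open>f2\<close> along \<open>e\<close>, the second one turned inside out by inversion in the
  unit circle. By invariance of domain this covers a neighbourhood of \<open>e\<close> in \<open>M\<close>, which leaves no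
  room for \<open>f3\<close>.
\<close>

lemma at_most_two_faces:
  assumes e: "e \<in> C1" and f: "f1 \<in> C2" "f2 \<in> C2" "f3 \<in> C2" "f1 \<noteq> f2" "f1 \<noteq> f3" "f2 \<noteq> f3"
    and ef: "e \<subseteq> M closure_of f1" "e \<subseteq> M closure_of f2" "e \<subseteq> M closure_of f3"
  shows False
proof -
  obtain P1 :: "complex \<Rightarrow> 'a" where P1: "cell_parametrization M P1 f1" "P1 ` sphere 0 1 \<subseteq> \<Union>(C0 \<union> C1)"
    by (rule faceE[OF f(1)])
  obtain P2 :: "complex \<Rightarrow> 'a" where P2: "cell_parametrization M P2 f2" "P2 ` sphere 0 1 \<subseteq> \<Union>(C0 \<union> C1)"
    by (rule faceE[OF f(2)])
  have ne: "e \<noteq> f1" "e \<noteq> f2" "e \<noteq> f3" using e f disj by blast+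
  have disj': "e \<inter> f1 = {}" "e \<inter> f2 = {}" "f1 \<inter> f2 = {}" "f1 \<inter> f3 = {}" "f2 \<inter> f3 = {}" "e \<inter> f3 = {}"
    by (intro cell_disjoint; use e f ne in blast)+
  have e1: "e \<subseteq> P1 ` sphere 0 1" and e2: "e \<subseteq> P2 ` sphere 0 1"
    using ef(1,2) disj'(1,2) unfolding cell_parametrization_closure_eq[OF Hausdorff P1(1)]
      cell_parametrization_closure_eq[OF Hausdorff P2(1)] by auto
  have inj1: "inj_on P1 (cball 0 1)" and inj2: "inj_on P2 (cball 0 1)"
    using P1 P2 by (auto simp: cell_parametrization_def)
  have img1: "P1 z \<in> f1" if "norm z < 1" for z using P1 that by (auto simp: cell_parametrization_def)
  have img2: "P2 z \<in> f2" if "norm z < 1" for z using P2 that by (auto simp: cell_parametrization_def)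
  define Q where "Q = inv_into (cball 0 1) P2"
  have Qe: "norm (Q y) = 1 \<and> P2 (Q y) = y" if y: "y \<in> e" for y
  proof -
    obtain z where z: "z \<in> sphere 0 1" "y = P2 z" using e2 y by blast
    then have "Q y = z" unfolding Q_def using inj2 by (auto intro: inv_into_f_f)
    then show ?thesis using z by simp
  qed
  \<comment> \<open>The rays from the origin through the arc of \<open>e\<close>. The part inside
    the unit circle serves \<open>f1\<close>, the part outside serves \<open>f2\<close>.\<close>
  define A where "A = {z. z \<noteq> 0 \<and> P1 (sgn z) \<in> e}"
  have sgnA: "norm (sgn z) = 1" if "z \<in> A" for z using that by (simp add: A_def norm_sgn)
  have contP1: "continuous_map (top_of_set (cball 0 1)) M P1" and contP2: "continuous_map (top_of_set (cball 0 1)) M P2"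
    using P1 P2 by (auto simp: cell_parametrization_def)
  have csgn: "continuous_on (- {0}) (sgn :: complex \<Rightarrow> complex)"
    by (intro continuous_intros) auto
  have cP1sgn: "continuous_map (top_of_set (- {0})) M (\<lambda>z. P1 (sgn z))"
  proof -
    have "continuous_map (top_of_set (- {0})) (top_of_set (cball 0 1)) (sgn :: complex \<Rightarrow> complex)"
      using csgn by (auto simp: continuous_map_in_subtopology norm_sgn)
    from continuous_map_compose[OF this contP1] show ?thesis by (simp add: o_def)
  qed
  have openA: "open A"
  proof -
    have "openin M (topspace M - (\<Union>(C0 \<union> C1) - e))"
      using closedin_skeleton_minus[OF e] by blast
    then have "openin (top_of_set (- {0})) {z \<in> topspace (top_of_set (- {0})). P1 (sgn z) \<in> topspace M - (\<Union>(C0 \<union> C1) - e)}"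
      by (rule openin_continuous_map_preimage[OF cP1sgn])
    moreover have "P1 (sgn z) \<in> topspace M - (\<Union>(C0 \<union> C1) - e) \<longleftrightarrow> P1 (sgn z) \<in> e" if "z \<noteq> 0" for z
    proof -
      have "P1 (sgn z) \<in> \<Union>(C0 \<union> C1)" using P1(2) that by (auto simp: image_subset_iff norm_sgn)
      then show ?thesis using cell_subset e by blast
    qed
    then have "{z \<in> topspace (top_of_set (- {0})). P1 (sgn z) \<in> topspace M - (\<Union>(C0 \<union> C1) - e)} = A"
      unfolding A_def by auto
    ultimately have "openin (top_of_set (- {0})) A" by simp
    then show ?thesis by (simp add: openin_open_eq open_Compl)
  qed
  \<comment> \<open>\<open>Q\<close> after \<open>P1\<close> identifies the two boundary arcs over
    \<open>e\<close>; division by the norm inverts the outside of the unit circle into the disc of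
    \<open>f2\<close>.\<close>
  define R where "R = (\<lambda>z. Q (P1 (sgn z)) / of_real (norm z))"
  have normR: "norm (R z) = 1 / norm z" if "z \<in> A" for z
    using Qe that by (simp add: R_def A_def norm_divide)
  define h where "h = (\<lambda>z. if norm z \<le> 1 then P1 z else P2 (R z))"
  have onunit: "P2 (R z) = P1 z" if "z \<in> A" "norm z = 1" for z
    using Qe that by (simp add: R_def A_def sgn_div_norm)
  have conth: "continuous_map (top_of_set A) M h"
    unfolding h_def
  proof (rule continuous_map_cases_le)
    show "continuous_map (top_of_set A) euclideanreal norm" "continuous_map (top_of_set A) euclideanreal (\<lambda>x. 1)"
      by (auto intro: continuous_intros)
    show "continuous_map (subtopology (top_of_set A) {z \<in> topspace (top_of_set A). norm z \<le> 1}) M P1"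
    proof -
      have eq: "subtopology (top_of_set A) {z \<in> topspace (top_of_set A). norm z \<le> 1} = top_of_set {z\<in>A. norm z \<le> 1}"
        by (auto simp: subtopology_subtopology intro: arg_cong)
      show ?thesis
        unfolding eq using contP1 by (rule continuous_map_from_subtopology_mono) auto
    qed
    show "continuous_map (subtopology (top_of_set A) {z \<in> topspace (top_of_set A). 1 \<le> norm z}) M (\<lambda>z. P2 (R z))"
    proof -
      have eq: "subtopology (top_of_set A) {z \<in> topspace (top_of_set A). 1 \<le> norm z} = top_of_set {z\<in>A. 1 \<le> norm z}"
        by (auto simp: subtopology_subtopology intro: arg_cong)
      have "continuous_map (top_of_set {z\<in>A. 1 \<le> norm z}) (subtopology M (M closure_of f2)) (\<lambda>z. P1 (sgn z))"
        using continuous_map_from_subtopology_mono[OF cP1sgn, of "{z\<in>A. 1 \<le> norm z}"] ef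
        by (auto simp: continuous_map_in_subtopology A_def)
      from continuous_map_compose[OF this cell_parametrization_inverse_continuous[OF Hausdorff P2(1)]]
      have "continuous_on {z\<in>A. 1 \<le> norm z} (\<lambda>z. Q (P1 (sgn z)))"
        by (simp add: Q_def o_def continuous_map_in_subtopology)
      then have "continuous_on {z\<in>A. 1 \<le> norm z} R"
        unfolding R_def by (intro continuous_intros) (auto simp: A_def)
      then have "continuous_map (top_of_set {z\<in>A. 1 \<le> norm z}) (top_of_set (cball 0 1)) R"
        using normR by (auto simp: continuous_map_in_subtopology divide_le_eq_1)
      from continuous_map_compose[OF this contP2] show ?thesis unfolding eq by (simp add: o_def)
    qed
    show "P1 x = P2 (R x)" if "x \<in> topspace (top_of_set A)" "norm x = 1" for x
      using onunit that by simp
  qed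
  have himg: "(norm z < 1 \<longrightarrow> h z \<in> f1) \<and> (norm z = 1 \<longrightarrow> h z \<in> e) \<and> (norm z > 1 \<longrightarrow> h z \<in> f2)" if "z \<in> A" for z
    using that img1[of z] img2[of "R z"] normR[of z]
    by (auto simp: h_def A_def sgn_div_norm divide_less_eq_1)
  have injh: "inj_on h A"
  proof (rule inj_onI)
    fix y z assume yz: "y \<in> A" "z \<in> A" "h y = h z"
    have cases: "(norm y \<le> 1 \<and> norm z \<le> 1) \<or> (norm y > 1 \<and> norm z > 1)"
      using himg[OF yz(1)] himg[OF yz(2)] yz(3) disj' by (smt (verit) IntI empty_iff)
    show "y = z"
    proof (cases "norm y \<le> 1")
      case True
      then have "norm z \<le> 1" using cases by linarith
      then show ?thesis using True yz inj1 by (auto simp: h_def dest: inj_onD)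
    next
      case False
      then have *: "norm y > 1" "norm z > 1" using cases by linarith+
      then have "P2 (R y) = P2 (R z)" using yz by (simp add: h_def)
      moreover have "R y \<in> cball 0 1" "R z \<in> cball 0 1"
        using normR yz * by (auto simp: divide_le_eq_1)
      ultimately have Req: "R y = R z" using inj2 by (auto dest: inj_onD)
      then have nn: "norm y = norm z" using normR yz * by (metis div_by_1 divide_divide_eq_right mult_1)
      then have "Q (P1 (sgn y)) = Q (P1 (sgn z))" using Req * unfolding R_def by auto
      then have "P1 (sgn y) = P1 (sgn z)" using Qe yz unfolding A_def by (metis mem_Collect_eq)
      then have "sgn y = sgn z" using inj1 sgnA yz by (auto dest!: inj_onD)
      moreover have "y \<noteq> 0" "z \<noteq> 0" using * by auto
      then have "y = norm y *\<^sub>R sgn y" "z = norm z *\<^sub>R sgn z"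
        by (simp_all add: sgn_div_norm)
      ultimately show ?thesis using nn by metis
    qed
  qed
  have opA: "openin M (h ` A)"
    using locally_planar_openin_image[OF planar openA conth injh] .
  obtain x where x: "x \<in> e" using cell_nonempty e by blast
  have xA: "x \<in> h ` A"
  proof -
    obtain z where z: "z \<in> sphere 0 1" "x = P1 z" using e1 x by blast
    then have "z \<in> A" "h z = x" using x by (auto simp: A_def h_def sgn_div_norm)
    then show ?thesis by blast
  qed
  \<comment> \<open>The image of \<open>A\<close> is a neighbourhood of \<open>x\<close> consisting
    of points of \<open>f1\<close>, \<open>e\<close> and \<open>f2\<close>, whereas \<open>x\<close>
    adheres to \<open>f3\<close>.\<close>
  have "x \<in> M closure_of f3" using ef(3) x by blast
  then have "h ` A \<inter> f3 \<noteq> {}"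
    using opA xA unfolding in_closure_of by blast
  moreover have "h ` A \<subseteq> f1 \<union> e \<union> f2" using himg by force
  ultimately show False using disj' by blast
qed

end

section \<open>Vertices and edges around a face\<close>

context regular_surface
begin

lemma edge_connectedin:
  assumes "e \<in> C1" shows "connectedin M e" "connectedin M (M closure_of e)"
proof -
  obtain P :: "real \<Rightarrow> 'a" where "cell_parametrization M P e" by (rule edgeE[OF assms])
  then show "connectedin M e" "connectedin M (M closure_of e)"
    using cell_parametrization_connectedin[OF Hausdorff] by blast+
qed

lemma sphere_eq_cis_image: "sphere (0 :: complex) 1 = cis ` {a..<a + 2 * pi}"
proof (intro Set.set_eqI iffI)
  fix w :: complex assume "w \<in> sphere 0 1"
  then have w: "w = cis (Arg w)" using rcis_cmod_Arg[of w] by (simp add: rcis_def)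
  define n where "n = \<lfloor>(Arg w - a) / (2 * pi)\<rfloor>"
  define t where "t = Arg w - 2 * pi * n"
  have "real_of_int n \<le> (Arg w - a) / (2 * pi)" "(Arg w - a) / (2 * pi) < real_of_int n + 1"
    unfolding n_def by linarith+
  then have "2 * pi * n \<le> Arg w - a" "Arg w - a < 2 * pi * (n + 1)"
    by (auto simp: field_simps)
  then have "t \<in> {a..<a + 2 * pi}" unfolding t_def by (auto simp: algebra_simps)
  moreover have "cis t = cis (Arg w)"
    unfolding t_def by (simp add: cis_divide[symmetric] cis_multiple_2pi)
  ultimately show "w \<in> cis ` {a..<a + 2 * pi}" using w by (metis imageI)
qed auto

lemma edge_not_closedin:
  assumes "e \<in> C1" shows "M closure_of e \<noteq> e"
proof
  assume eq: "M closure_of e = e"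
  obtain v w where "v \<in> C0" "w \<in> C0" "M closure_of e = e \<union> v \<union> w"
    by (rule edge_ends[OF assms])
  then have "v \<subseteq> e" "v \<noteq> e" using eq assms disj(2) by blast+
  then show False
    using cell_disjoint[of v e] cell_nonempty[of v] \<open>v \<in> C0\<close> assms by blast
qed

text \<open>On a circle without vertices the edges would cut a connected set into disjoint
  relatively open pieces. A single edge would then fill the circle and be closed, but an edge misses
  its end vertices.\<close>

lemma circle_has_vertex:
  fixes P :: "complex \<Rightarrow> 'a"
  assumes P: "cell_parametrization M P f" "P ` sphere 0 1 \<subseteq> \<Union>(C0 \<union> C1)"
  obtains a where "P (cis a) \<in> \<Union>C0"
proof (rule ccontr)
  assume no: "\<not> thesis"
  have none: "x \<notin> \<Union>C0" if "x \<in> P ` sphere 0 1" for x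
    using no that \<open>\<And>a. P (cis a) \<in> \<Union>C0 \<Longrightarrow> thesis\<close> unfolding sphere_eq_cis_image[of 0] by blast
  have in_edge: "\<exists>b\<in>C1. x \<in> b" if "x \<in> P ` sphere 0 1" for x
  proof -
    have "x \<in> \<Union>(C0 \<union> C1)" using that P(2) by (rule rev_subsetD)
    then show ?thesis using none[OF that] by blast
  qed
  have "P (cis 0) \<in> P ` sphere 0 1" by auto
  from in_edge[OF this] obtain e where e: "e \<in> C1" "P (cis 0) \<in> e" by (rule bexE)
  have conn: "connectedin M (P ` sphere 0 1)"
  proof -
    have "connectedin M ((\<lambda>t. P (cis t)) ` UNIV)"
      by (rule connectedin_continuous_map_image[OF continuous_map_cis_parametrization[OF P(1)]]) simp
    moreover have "(\<lambda>t. P (cis t)) ` UNIV = P ` sphere 0 1"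
    proof
      show "(\<lambda>t. P (cis t)) ` UNIV \<subseteq> P ` sphere 0 1"
        by (intro image_subsetI imageI) simp
      show "P ` sphere 0 1 \<subseteq> (\<lambda>t. P (cis t)) ` UNIV"
        unfolding sphere_eq_cis_image[of 0] by blast
    qed
    ultimately show ?thesis by simp
  qed
  have "P ` sphere 0 1 \<subseteq> e"
  proof
    fix y assume y: "y \<in> P ` sphere 0 1"
    have "(P (cis 0) \<in> e) = (y \<in> e)"
    proof (rule locally_constant_on_connectedin[OF conn, where k = "\<lambda>x. x \<in> e"])
      fix x assume x: "x \<in> P ` sphere 0 1"
      from in_edge[OF this] obtain b where b: "b \<in> C1" "x \<in> b" by (rule bexE)
      have "openin M (topspace M - (\<Union>(C0 \<union> C1) - b))"
        using closedin_skeleton_minus[OF b(1)] by blast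
      moreover have "x \<in> topspace M - (\<Union>(C0 \<union> C1) - b)" using b cell_subset by blast
      moreover have "(z \<in> e) = (x \<in> e)"
        if "z \<in> (topspace M - (\<Union>(C0 \<union> C1) - b)) \<inter> P ` sphere 0 1" for z
      proof -
        have "z \<in> b" using that P by blast
        then show ?thesis using b e cell_eqI[of b e] by blast
      qed
      ultimately show "\<exists>U. openin M U \<and> x \<in> U \<and> (\<forall>y\<in>U \<inter> P ` sphere 0 1. (y \<in> e) = (x \<in> e))"
        by blast
    qed (use y in auto)
    then show "y \<in> e" using e by simp
  qed
  moreover have "e \<subseteq> P ` sphere 0 1"
    by (rule edge_in_circle[OF P e]) auto
  ultimately have "e = P ` sphere 0 1" by blast
  then have "closedin M e"
    using cell_parametrization_image_closedin[OF Hausdorff P(1), of "sphere 0 1"] by auto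
  then show False using edge_not_closedin[OF e(1)] closure_of_closedin by blast
qed

text \<open>Starting at a vertex keeps \<open>e\<close> from running across the base point, so its
  parameter set \<open>T\<close> is open within one period. A gap in \<open>T\<close> would
  disconnect \<open>e\<close>; hence \<open>T\<close> is an interval, and its end points are sent to
  the end vertices.\<close>

lemma edge_is_arc:
  fixes P :: "complex \<Rightarrow> 'a"
  assumes P: "cell_parametrization M P f" "P ` sphere 0 1 \<subseteq> \<Union>(C0 \<union> C1)"
    and a: "P (cis a) \<in> \<Union>C0" and e: "e \<in> C1" "e \<subseteq> P ` sphere 0 1"
  obtains s r where "a \<le> s" "s < r" "r \<le> a + 2 * pi"
    "{t \<in> {a..a + 2 * pi}. P (cis t) \<in> e} = {s<..<r}"
    "P (cis s) \<noteq> P (cis r)" "{v \<in> C0. v \<subseteq> M closure_of e} = {{P (cis s)}, {P (cis r)}}"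
proof -
  define T where "T = {t \<in> {a..a + 2 * pi}. P (cis t) \<in> e}"
  have ve: "x \<notin> e" if "x \<in> \<Union>C0" for x
    using that e(1) cell_disjoint disj(2) by blast
  have per: "cis (a + 2 * pi) = cis a" by (simp add: cis_mult[symmetric])
  have "P (cis a) \<notin> e" "P (cis (a + 2 * pi)) \<notin> e" using ve[OF a] per by simp_all
  then have inT: "t \<in> T \<longleftrightarrow> t \<in> {a<..<a + 2 * pi} \<and> P (cis t) \<in> e" for t
    unfolding T_def by (cases "t = a"; cases "t = a + 2 * pi") auto
  have T_Int: "T = {t. P (cis t) \<in> e} \<inter> {a<..<a + 2 * pi}"
    by (rule Set.set_eqI) (simp only: inT Int_iff mem_Collect_eq conj_commute)
  have opT: "open T"
    unfolding T_Int by (intro open_Int circle_openin_edge[OF P e(1)] open_greaterThanLessThan)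
  have conn: "connectedin M e"
    by (rule edge_connectedin[OF e(1)])
  have between: "y \<in> T" if xyz: "x \<in> T" "z \<in> T" "x < y" "y < z" for x y z
  proof (rule ccontr)
    assume yT: "y \<notin> T"
    have arc: "\<exists>U. openin M U \<and> U \<inter> e = (\<lambda>t. P (cis t)) ` (T \<inter> S)" if S: "open S" for S
    proof (rule arc_openin_edge[OF P(1) e(1)])
      show "open (T \<inter> S)" by (rule open_Int[OF opT S])
      show "T \<inter> S \<subseteq> {a<..<a + 2 * pi}" unfolding T_Int by blast
      show "P (cis t) \<in> e" if "t \<in> T \<inter> S" for t using that unfolding T_def by blast
    qed
    from arc[OF open_lessThan[of y]]
    obtain U where U: "openin M U" "U \<inter> e = (\<lambda>t. P (cis t)) ` (T \<inter> {..<y})"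
      by (elim exE conjE)
    from arc[OF open_greaterThan[of y]]
    obtain W where W: "openin M W" "W \<inter> e = (\<lambda>t. P (cis t)) ` (T \<inter> {y<..})"
      by (elim exE conjE)
    have "e \<subseteq> U \<union> W"
    proof
      fix q assume "q \<in> e"
      then obtain t where t: "t \<in> {a..<a + 2 * pi}" "q = P (cis t)"
        using e(2) unfolding sphere_eq_cis_image[of a] by blast
      then have "t \<in> T" using \<open>q \<in> e\<close> by (auto simp: T_def)
      then have "t < y \<or> t > y" using yT by (metis linorder_neqE_linordered_idom)
      then have "q \<in> (\<lambda>t. P (cis t)) ` (T \<inter> {..<y}) \<union> (\<lambda>t. P (cis t)) ` (T \<inter> {y<..})"
        using t \<open>t \<in> T\<close> by auto
      then show "q \<in> U \<union> W" unfolding U(2)[symmetric] W(2)[symmetric] by blast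
    qed
    moreover have "U \<inter> W \<inter> e = {}"
    proof -
      have "inj_on (\<lambda>t. P (cis t)) T"
      proof (rule inj_onI)
        fix s t assume st: "s \<in> T" "t \<in> T" "P (cis s) = P (cis t)"
        then have "cis s = cis t"
          using P(1) unfolding cell_parametrization_def by (auto dest: inj_onD)
        then show "s = t" using inj_on_cis_interval[of a] st inT by (auto dest: inj_onD)
      qed
      then have "(\<lambda>t. P (cis t)) ` (T \<inter> {..<y}) \<inter> (\<lambda>t. P (cis t)) ` (T \<inter> {y<..}) = {}"
        by (subst inj_on_image_Int[symmetric, of _ T]) auto
      then have "(U \<inter> e) \<inter> (W \<inter> e) = {}" unfolding U(2) W(2) .
      then show ?thesis by blast
    qed
    moreover have "P (cis x) \<in> U \<inter> e" "P (cis z) \<in> W \<inter> e"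
      unfolding U(2) W(2) using xyz by auto
    ultimately show False
      using conn U(1) W(1) unfolding connectedin by blast
  qed
  have neT: "T \<noteq> {}"
  proof -
    obtain q where "q \<in> e" using cell_nonempty[of e] e by blast
    then obtain t where "t \<in> {a..<a + 2 * pi}" "q = P (cis t)"
      using e(2) unfolding sphere_eq_cis_image[of a] by blast
    then have "t \<in> T" using \<open>q \<in> e\<close> by (simp add: T_def)
    then show ?thesis by blast
  qed
  have bdd: "bdd_below T" "bdd_above T"
    by (auto simp: T_def intro: bdd_belowI[of _ a] bdd_aboveI[of _ "a + 2 * pi"])
  define s where "s = Inf T"
  define r where "r = Sup T"
  have T_eq: "T = {s<..<r}"
  proof (intro Set.set_eqI iffI)
    fix t assume t: "t \<in> T"
    then obtain d where d: "d > 0" "ball t d \<subseteq> T" using opT open_contains_ball by blast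
    then have "t - d / 2 \<in> T" "t + d / 2 \<in> T" by (auto simp: subset_iff dist_real_def)
    then have "s \<le> t - d / 2" "t + d / 2 \<le> r"
      unfolding s_def r_def using bdd by (auto intro: cInf_lower cSup_upper)
    then show "t \<in> {s<..<r}" using d by auto
  next
    fix t assume "t \<in> {s<..<r}"
    then have "Inf T < t" "t < Sup T" by (auto simp: s_def r_def)
    then obtain x z where "x \<in> T" "x < t" "z \<in> T" "t < z"
      using cInf_less_iff[OF neT bdd(1)] less_cSup_iff[OF neT bdd(2)] by blast
    then show "t \<in> T" using between by blast
  qed
  then have sr: "s < r" using neT by auto
  have bnd: "a \<le> s" "r \<le> a + 2 * pi"
    unfolding s_def r_def by (rule cInf_greatest[OF neT], simp add: T_def)
                             (rule cSup_least[OF neT], simp add: T_def)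
  have cl: "P (cis t) \<in> \<Union>C0 \<inter> M closure_of e" if t: "t = s \<or> t = r" for t
  proof -
    have "(\<lambda>t. P (cis t)) ` (euclidean closure_of T) \<subseteq> M closure_of ((\<lambda>t. P (cis t)) ` T)"
      by (rule continuous_map_image_closure_subset[OF continuous_map_cis_parametrization[OF P(1)]])
    moreover have "t \<in> euclidean closure_of T"
      using t sr by (auto simp: T_eq)
    moreover have "M closure_of ((\<lambda>t. P (cis t)) ` T) \<subseteq> M closure_of e"
      by (rule closure_of_mono) (auto simp: T_def)
    ultimately have "P (cis t) \<in> M closure_of e" by blast
    moreover have "t \<notin> T" using t by (auto simp: T_eq)
    then have "P (cis t) \<notin> e" using t bnd sr by (auto simp: T_def)
    ultimately show ?thesis using closure_edge[OF e(1)] by blast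
  qed
  obtain v w where vw: "v \<in> C0" "w \<in> C0" "v \<noteq> w" "{u \<in> C0. u \<subseteq> M closure_of e} = {v, w}"
      "M closure_of e = e \<union> v \<union> w"
    by (rule edge_ends[OF e(1)])
  have sing: "{P (cis t)} \<in> {v, w}" if t: "t = s \<or> t = r" for t
  proof -
    obtain b where b: "b \<in> C0" "P (cis t) \<in> b" using cl[OF t] by blast
    then have b': "b = {P (cis t)}" using vertex by blast
    have "{P (cis t)} \<subseteq> M closure_of e" using cl[OF t] by simp
    then have "{P (cis t)} \<in> {u \<in> C0. u \<subseteq> M closure_of e}" using b(1) b' by simp
    then show ?thesis unfolding vw(4) .
  qed
  \<comment> \<open>Equal images would force \<open>T\<close> to be the full open period. The circle
    would then be \<open>e\<close> with one more point, which leaves no room for two distinct end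
    vertices.\<close>
  have ne: "P (cis s) \<noteq> P (cis r)"
  proof
    assume eq: "P (cis s) = P (cis r)"
    have cis: "cis s = cis r"
      using eq P(1) unfolding cell_parametrization_def by (auto dest: inj_onD)
    have "s = a \<and> r = a + 2 * pi"
    proof (rule ccontr)
      assume "\<not> (s = a \<and> r = a + 2 * pi)"
      then have "r < s + 2 * pi" using bnd sr by auto
      define c where "c = (r - 2 * pi + s) / 2"
      have "s \<in> {c<..<c + 2 * pi}" "r \<in> {c<..<c + 2 * pi}"
        using \<open>r < s + 2 * pi\<close> sr by (auto simp: c_def field_simps)
      then have "s = r" using inj_on_cis_interval[of c] cis by (auto dest: inj_onD)
      then show False using sr by simp
    qed
    then have T_full: "T = {a<..<a + 2 * pi}" and "s = a" unfolding T_eq by simp_all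
    have sub: "P ` sphere 0 1 \<subseteq> e \<union> {P (cis s)}"
    proof
      fix q assume "q \<in> P ` sphere 0 1"
      then obtain t where t: "t \<in> {a..<a + 2 * pi}" "q = P (cis t)"
        unfolding sphere_eq_cis_image[of a] by blast
      show "q \<in> e \<union> {P (cis s)}"
      proof (cases "t = a")
        case False
        then have "t \<in> T" using t(1) unfolding T_full by simp
        then show ?thesis using t(2) unfolding T_def by blast
      qed (simp add: t(2) \<open>s = a\<close>)
    qed
    have "M closure_of e \<subseteq> P ` sphere 0 1"
      using e(2) cell_parametrization_image_closedin[OF Hausdorff P(1), of "sphere 0 1"]
      by (intro closure_of_minimal) auto
    then have "e \<union> v \<union> w \<subseteq> e \<union> {P (cis s)}" using sub unfolding vw(5) by (rule subset_trans)
    moreover have "v \<inter> e = {}" "w \<inter> e = {}" using vw(1,2) ve by blast+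
    ultimately have "v \<subseteq> {P (cis s)}" "w \<subseteq> {P (cis s)}" by blast+
    then show False using vw(1-3) vertex[of v] vertex[of w] by auto
  qed
  have "{v, w} = {{P (cis s)}, {P (cis r)}}"
    using sing[of s] sing[of r] ne by auto
  then show ?thesis
    using that[of s r] bnd sr T_eq ne vw(4) unfolding T_def by simp
qed

section \<open>Potentials of a set of edges around a cell\<close>

definition boundary_edges :: "'a set \<Rightarrow> 'a set set" where
  "boundary_edges f = {e \<in> C1. e \<subseteq> M closure_of f}"

definition ends_of :: "'a set \<Rightarrow> 'a set set" where
  "ends_of e = {v \<in> C0. v \<subseteq> M closure_of e}"

text \<open>A 0-cochain modulo two whose coboundary agrees with \<open>c\<close> on the boundary
  edges of \<open>f\<close>. It makes sense for cells of every dimension: a vertex has no boundary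
  edges, and an edge has itself as its only one.\<close>

definition potential :: "'a set set \<Rightarrow> 'a set \<Rightarrow> ('a set \<Rightarrow> bool) \<Rightarrow> bool" where
  "potential c f p \<longleftrightarrow>
     (\<forall>e\<in>boundary_edges f. \<forall>v\<in>ends_of e. \<forall>w\<in>ends_of e. v \<noteq> w \<longrightarrow> (p v \<noteq> p w) = (e \<in> c))"

text \<open>
  Walk around the boundary circle from a vertex and count modulo two the edges of \<open>c\<close> that have been
  passed; evenness makes the count consistent after a full turn.
\<close>

lemma face_potential:
  assumes f: "f \<in> C2" and ev: "even (card (c \<inter> boundary_edges f))"
  shows "\<exists>p. potential c f p"
proof -
  obtain P :: "complex \<Rightarrow> 'a" where P: "cell_parametrization M P f" "P ` sphere 0 1 \<subseteq> \<Union>(C0 \<union> C1)"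
    by (rule faceE[OF f])
  obtain a where a: "P (cis a) \<in> \<Union>C0"
    by (rule circle_has_vertex[OF P])
  have per: "cis (a + 2 * pi) = cis a" by (simp add: cis_mult[symmetric])
  have be: "e \<in> C1 \<and> e \<subseteq> P ` sphere 0 1" if "e \<in> boundary_edges f" for e
  proof -
    have "e \<inter> f = {}" using that f disj(4) cell_disjoint[of e f] unfolding boundary_edges_def by blast
    then show ?thesis
      using that cell_parametrization_closure_eq[OF Hausdorff P(1)] unfolding boundary_edges_def by blast
  qed
  define T where "T = (\<lambda>e. {t \<in> {a..a + 2 * pi}. P (cis t) \<in> e})"
  \<comment> \<open>Edges of \<open>c\<close> that have been passed completely at time
    \<open>t\<close>; the walk starts at the vertex with parameter \<open>a\<close>.\<close>
  define B where "B = (\<lambda>t. {e \<in> c \<inter> boundary_edges f. T e \<subseteq> {a..t}})"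
  define q where "q = (\<lambda>t. odd (card (B t)))"
  have arc: "\<exists>s r. a \<le> s \<and> s < r \<and> r \<le> a + 2 * pi \<and> T e = {s<..<r} \<and> ends_of e = {{P (cis s)}, {P (cis r)}}"
    if e: "e \<in> boundary_edges f" for e
  proof -
    obtain s r where "a \<le> s" "s < r" "r \<le> a + 2 * pi"
      "{t \<in> {a..a + 2 * pi}. P (cis t) \<in> e} = {s<..<r}"
      "P (cis s) \<noteq> P (cis r)" "{v \<in> C0. v \<subseteq> M closure_of e} = {{P (cis s)}, {P (cis r)}}"
      by (rule edge_is_arc[OF P a conjunct1[OF be[OF e]] conjunct2[OF be[OF e]]])
    then show ?thesis unfolding T_def ends_of_def by (intro exI[of _ s] exI[of _ r]) simp
  qed
  have fin_be: "finite (boundary_edges f)" unfolding boundary_edges_def using fin by simp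
  have step: "q r = (q s \<noteq> (e \<in> c))"
    if e: "e \<in> boundary_edges f" and sr: "a \<le> s" "s < r" "T e = {s<..<r}" for e s r
  proof -
    have Br: "B r = B s \<union> (if e \<in> c then {e} else {})"
    proof (intro Set.set_eqI iffI)
      fix b assume b: "b \<in> B r"
      show "b \<in> B s \<union> (if e \<in> c then {e} else {})"
      proof (cases "b = e")
        case True
        then show ?thesis using b by (auto simp: B_def)
      next
        case False
        have bb: "b \<in> boundary_edges f" "T b \<subseteq> {a..r}" using b by (auto simp: B_def)
        have disjT: "T b \<inter> T e = {}"
        proof -
          have "b \<inter> e = {}" using False be[OF bb(1)] be[OF e] by (intro cell_disjoint) auto
          then show ?thesis by (auto simp: T_def)
        qed
        obtain s' r' where b': "s' < r'" "T b = {s'<..<r'}" using arc[OF bb(1)] by blast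
        \<comment> \<open>Distinct edges occupy disjoint parameter intervals, so an interval that
          ends by \<open>r\<close> and is not that of \<open>e\<close> ends by \<open>s\<close>
          already.\<close>
        have "r' \<le> s"
        proof (rule ccontr)
          assume "\<not> r' \<le> s"
          then have m: "max s s' < min r r'" if "s' < r" using that b' sr by auto
          have "(s' + r') / 2 \<in> T b" using b' by (auto simp: field_simps)
          then have "s' < r" using bb(2) b'(1) by (auto simp: field_simps)
          obtain m where "max s s' < m" "m < min r r'" using m[OF \<open>s' < r\<close>] dense by blast
          then have "m \<in> T b \<inter> T e" using b' sr by auto
          then show False using disjT by blast
        qed
        then have "T b \<subseteq> {a..s}" using b'(2) bb(2) by (auto simp: subset_iff)
        then show ?thesis using b by (auto simp: B_def)
      qed
    next
      fix b assume "b \<in> B s \<union> (if e \<in> c then {e} else {})"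
      then show "b \<in> B r"
        using sr e by (auto simp: B_def split: if_splits)
    qed
    have "(s + r) / 2 \<in> T e" using sr by (auto simp: field_simps)
    then have "\<not> T e \<subseteq> {a..s}" using sr(2) by (auto simp: subset_iff field_simps)
    then have "e \<notin> B s" by (auto simp: B_def)
    moreover have "finite (B s)" unfolding B_def using fin_be by simp
    ultimately show ?thesis unfolding q_def Br by auto
  qed
  have q_ends: "q (a + 2 * pi) = q a"
  proof -
    have "B (a + 2 * pi) = c \<inter> boundary_edges f" by (auto simp: B_def T_def)
    moreover have "B a = {}"
    proof -
      have "\<not> T e \<subseteq> {a..a}" if e: "e \<in> boundary_edges f" for e
      proof -
        obtain s r where sr: "a \<le> s" "s < r" "T e = {s<..<r}" using arc[OF e] by blast
        have "(s + r) / 2 \<in> T e" using sr by (auto simp: field_simps)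
        moreover have "(s + r) / 2 \<noteq> a" using sr by (auto simp: field_simps)
        ultimately show ?thesis by auto
      qed
      then show ?thesis by (auto simp: B_def)
    qed
    ultimately show ?thesis using ev by (simp add: q_def)
  qed
  \<comment> \<open>The first vertex has the two parameters \<open>a\<close> and
    \<open>a + 2 * pi\<close>. The choice between them does no harm, as the count has the same
    parity at both.\<close>
  define p where "p = (\<lambda>v. q (SOME t. t \<in> {a..a + 2 * pi} \<and> P (cis t) \<in> v))"
  have p: "p {P (cis t)} = q t" if t: "t \<in> {a..a + 2 * pi}" for t
  proof -
    define t' where "t' = (SOME t'. t' \<in> {a..a + 2 * pi} \<and> P (cis t') \<in> {P (cis t)})"
    have "t' \<in> {a..a + 2 * pi} \<and> P (cis t') \<in> {P (cis t)}"
      unfolding t'_def by (rule someI[of _ t]) (use t in auto)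
    then have t': "t' \<in> {a..a + 2 * pi}" "cis t' = cis t"
      using P(1) unfolding cell_parametrization_def by (auto dest: inj_onD)
    have "q t' = q t"
    proof (cases "t' = t")
      case False
      have "\<bar>t' - t\<bar> = 2 * pi"
      proof (rule ccontr)
        assume "\<bar>t' - t\<bar> \<noteq> 2 * pi"
        then have lt: "\<bar>t' - t\<bar> < 2 * pi" using t t' by auto
        define b where "b = (t + t') / 2 - pi"
        have "t \<in> {b<..<b + 2 * pi}" "t' \<in> {b<..<b + 2 * pi}"
          using lt by (auto simp: b_def field_simps abs_if split: if_splits)
        then show False using inj_on_cis_interval[of b] t'(2) False by (auto dest: inj_onD)
      qed
      then have "(t = a \<and> t' = a + 2 * pi) \<or> (t' = a \<and> t = a + 2 * pi)"
        using t t'(1) by (auto simp: abs_if split: if_splits)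
      then show ?thesis using q_ends by auto
    qed auto
    then show ?thesis by (simp add: p_def t'_def)
  qed
  have "potential c f p"
    unfolding potential_def
  proof (intro ballI impI)
    fix e v w assume e: "e \<in> boundary_edges f" and vw: "v \<in> ends_of e" "w \<in> ends_of e" "v \<noteq> w"
    obtain s r where sr: "a \<le> s" "s < r" "r \<le> a + 2 * pi" "T e = {s<..<r}" "ends_of e = {{P (cis s)}, {P (cis r)}}"
      using arc[OF e] by blast
    have "p {P (cis r)} = (p {P (cis s)} \<noteq> (e \<in> c))"
      using step[OF e sr(1,2,4)] p[of s] p[of r] sr(1,2,3) by simp
    moreover have "(v = {P (cis s)} \<and> w = {P (cis r)}) \<or> (w = {P (cis s)} \<and> v = {P (cis r)})"
      using vw sr(5) by auto
    ultimately show "(p v \<noteq> p w) = (e \<in> c)" by auto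
  qed
  then show ?thesis by blast
qed

end

section \<open>Parallel transport of cellular cocycles\<close>

context regular_surface
begin

lemma boundary_edges_vertex: "v \<in> C0 \<Longrightarrow> boundary_edges v = {}"
proof (rule equals0I)
  fix e assume v: "v \<in> C0" and "e \<in> boundary_edges v"
  then have e: "e \<in> C1" "e \<subseteq> v" using closure_vertex by (auto simp: boundary_edges_def)
  have "e \<noteq> v" using e(1) v disj(2) by blast
  then have "e \<inter> v = {}" using e v by (intro cell_disjoint) auto
  then show False using e cell_nonempty[of e] by blast
qed

lemma boundary_edges_edge:
  assumes "e \<in> C1" shows "boundary_edges e = {e}"
proof (intro Set.set_eqI iffI)
  fix b assume "b \<in> boundary_edges e"
  then have b: "b \<in> C1" "b \<subseteq> e \<union> \<Union>C0" using closure_edge[OF assms] by (auto simp: boundary_edges_def)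
  obtain x where x: "x \<in> b" using cell_nonempty b by blast
  have "x \<notin> \<Union>C0" using x b(1) disj(2) cell_disjoint[of b] by blast
  then have "x \<in> e" using x b by blast
  then show "b \<in> {e}" using cell_eqI[of b e x] x b assms by blast
next
  fix b assume "b \<in> {e}"
  then show "b \<in> boundary_edges e" using closure_superset assms by (auto simp: boundary_edges_def)
qed

lemma ends_of_edge:
  assumes "e \<in> C1"
  obtains v w where "v \<in> C0" "w \<in> C0" "v \<noteq> w" "ends_of e = {v, w}"
    "M closure_of e = e \<union> v \<union> w"
  using edge_ends[OF assms] unfolding ends_of_def by metis

text \<open>Makes the choice of base vertices possible. For a face it rests on the fact that edges
  alone cannot fill the boundary circle.\<close>

lemma cell_has_vertex:
  assumes b: "b \<in> C0 \<union> C1 \<union> C2" obtains v where "v \<in> C0" "v \<subseteq> M closure_of b"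
proof -
  consider "b \<in> C0" | "b \<in> C1" | "b \<in> C2" using b by blast
  then show ?thesis
  proof cases
    case 1
    then show ?thesis using that closure_superset b by blast
  next
    case 2
    then show ?thesis by (rule edge_ends) (use that in blast)
  next
    case 3
    obtain P :: "complex \<Rightarrow> 'a" where P: "cell_parametrization M P b" "P ` sphere 0 1 \<subseteq> \<Union>(C0 \<union> C1)"
      by (rule faceE[OF 3])
    obtain a where a: "P (cis a) \<in> \<Union>C0"
      by (rule circle_has_vertex[OF P])
    then obtain v where v: "v \<in> C0" "P (cis a) \<in> v" by blast
    moreover have "P (cis a) \<in> M closure_of b"
      unfolding cell_parametrization_closure[OF Hausdorff P(1)] by simp
    ultimately have "v \<subseteq> M closure_of b" using frontier[of v b] b by blast
    then show ?thesis using that v by blast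
  qed
qed

section \<open>Base vertices and open stars\<close>

definition cell_of :: "'a \<Rightarrow> 'a set" where
  "cell_of x = (THE b. b \<in> C0 \<union> C1 \<union> C2 \<and> x \<in> b)"

lemma cell_of_eq: "b \<in> C0 \<union> C1 \<union> C2 \<Longrightarrow> x \<in> b \<Longrightarrow> cell_of x = b"
  unfolding cell_of_def by (rule the_equality) (use cell_eqI in blast)+

lemma cell_of: "x \<in> topspace M \<Longrightarrow> cell_of x \<in> C0 \<union> C1 \<union> C2 \<and> x \<in> cell_of x"
  using cell_of_eq cover by (metis UnionE)

definition base_vertex :: "'a \<Rightarrow> 'a set" where
  "base_vertex x = (SOME v. v \<in> C0 \<and> v \<subseteq> M closure_of (cell_of x))"

lemma base_vertex: "x \<in> topspace M \<Longrightarrow> base_vertex x \<in> C0 \<and> base_vertex x \<subseteq> M closure_of (cell_of x)"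
  unfolding base_vertex_def by (rule someI_ex) (meson cell_of cell_has_vertex)

text \<open>The complement of the finitely many cell closures that miss \<open>x\<close> is the open
  star of its cell.\<close>

lemma star_neighbourhood:
  assumes "x \<in> topspace M"
  obtains U where "openin M U" "x \<in> U" "\<And>y. y \<in> U \<Longrightarrow> x \<in> M closure_of (cell_of y)"
proof
  define U where "U = topspace M - (\<Union>b\<in>{b \<in> C0 \<union> C1 \<union> C2. x \<notin> M closure_of b}. M closure_of b)"
  show "openin M U"
    unfolding U_def using fin by (intro openin_diff openin_topspace closedin_Union) auto
  show "x \<in> U" using assms by (auto simp: U_def)
  fix y assume "y \<in> U"
  then show "x \<in> M closure_of (cell_of y)"
    using cell_of[of y] closure_superset[of "cell_of y"] unfolding U_def by blast
qed

lemma cell_order_trans: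
  "a \<subseteq> M closure_of b \<Longrightarrow> b \<subseteq> M closure_of c \<Longrightarrow> a \<subseteq> M closure_of c"
  using closure_of_mono[of b "M closure_of c" M] by (metis closure_of_closure_of order_trans)

text \<open>Despite the name, these are the cellular 1-cocycles modulo two: cochains that vanish on
  the boundary of every face. They are cycles from the point of view of the dual
  decomposition.\<close>

definition cycle_space :: "'a set set set" where
  "cycle_space = {c. c \<subseteq> C1 \<and> (\<forall>f\<in>C2. even (card (c \<inter> boundary_edges f)))}"

lemma cell_potential:
  assumes c: "c \<in> cycle_space" and b: "b \<in> C0 \<union> C1 \<union> C2"
  shows "\<exists>p. potential c b p"
proof -
  consider "b \<in> C0" | "b \<in> C1" | "b \<in> C2" using b by blast
  then show ?thesis
  proof cases
    case 1
    then show ?thesis by (simp add: potential_def boundary_edges_vertex)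
  next
    case 2
    obtain v w where vw: "v \<noteq> w" "ends_of b = {v, w}" by (rule ends_of_edge[OF 2])
    have "potential c b (\<lambda>u. u = v \<and> b \<in> c)"
      unfolding potential_def boundary_edges_edge[OF 2] using vw by auto
    then show ?thesis by blast
  next
    case 3
    then show ?thesis using face_potential c unfolding cycle_space_def by blast
  qed
qed

definition chosen_potential :: "'a set set \<Rightarrow> 'a set \<Rightarrow> 'a set \<Rightarrow> bool" where
  "chosen_potential c b = (SOME p. potential c b p)"

lemma chosen_potential: "c \<in> cycle_space \<Longrightarrow> b \<in> C0 \<union> C1 \<union> C2 \<Longrightarrow> potential c b (chosen_potential c b)"
  unfolding chosen_potential_def using cell_potential by (rule someI_ex)

lemma face_in_closure:
  assumes a: "a \<in> C2" and b: "b \<in> C0 \<union> C1 \<union> C2" and ab: "a \<subseteq> M closure_of b" shows "a = b"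
proof -
  obtain x where x: "x \<in> a" using cell_nonempty[of a] a by blast
  have "M closure_of b \<subseteq> b \<union> \<Union>(C0 \<union> C1)"
    using b closure_vertex[of b] closure_edge[of b] closure_face[of b] by blast
  then obtain d where d: "d \<in> C0 \<union> C1 \<union> {b}" "x \<in> d" using ab x by blast
  then have "a = d" using cell_eqI[of a d x] a b x by blast
  then show ?thesis using d(1) a disj by blast
qed

text \<open>For an edge \<open>a\<close> both differences of distinct vertices record whether
  \<open>a\<close> belongs to \<open>c\<close>, because \<open>a\<close> is also a boundary edge of
  \<open>b\<close>; for a vertex or a face nothing has to be compared. Thus the potential of
  \<open>b\<close> restricts to that of \<open>a\<close> up to a constant.\<close>

lemma chosen_potential_mono:
  assumes c: "c \<in> cycle_space" and ab: "a \<in> C0 \<union> C1 \<union> C2" "b \<in> C0 \<union> C1 \<union> C2" "a \<subseteq> M closure_of b"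
    and vw: "v \<in> C0" "v \<subseteq> M closure_of a" "w \<in> C0" "w \<subseteq> M closure_of a"
  shows "(chosen_potential c a v \<noteq> chosen_potential c a w) = (chosen_potential c b v \<noteq> chosen_potential c b w)"
proof -
  consider "a \<in> C0" | "a \<in> C1" | "a \<in> C2" using ab by blast
  then show ?thesis
  proof cases
    case 1
    have "v = a" "w = a"
      using vw closure_vertex[OF 1] vertex[of v] vertex[of w] vertex[OF 1] by auto
    then show ?thesis by simp
  next
    case 2
    have "v \<in> ends_of a" "w \<in> ends_of a" using vw by (auto simp: ends_of_def)
    moreover have "a \<in> boundary_edges a" "a \<in> boundary_edges b"
      using boundary_edges_edge[OF 2] 2 ab by (auto simp: boundary_edges_def)
    ultimately show ?thesis
      using chosen_potential[OF c ab(1)] chosen_potential[OF c ab(2)] unfolding potential_def by (cases "v = w") auto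
  next
    case 3
    then show ?thesis using face_in_closure[OF _ ab(2,3)] by simp
  qed
qed

text \<open>
  This is meaningful only if \<open>x\<close> lies in the closure of the cell of \<open>y\<close>, which holds for all \<open>y\<close> near
  \<open>x\<close>.
\<close>

definition transport :: "'a set set \<Rightarrow> 'a \<Rightarrow> 'a \<Rightarrow> bool" where
  "transport c x y = (chosen_potential c (cell_of y) (base_vertex x) \<noteq> chosen_potential c (cell_of y) (base_vertex y))"

text \<open>On the open star of \<open>x\<close>, the function \<open>transport c x\<close> is
  itself a primitive. For \<open>y\<close> in the star and \<open>z\<close> near \<open>y\<close>
  the cells of \<open>x\<close>, \<open>y\<close> and \<open>z\<close> are increasing, so all
  differences can be computed with the potential of the cell of \<open>z\<close>, where they
  telescope.\<close>

lemma cocycle_transport: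
  assumes c: "c \<in> cycle_space" shows "cocycle M (transport c)"
  unfolding cocycle_def
proof
  fix x assume x: "x \<in> topspace M"
  obtain U where U: "openin M U" "x \<in> U" "\<And>y. y \<in> U \<Longrightarrow> x \<in> M closure_of (cell_of y)"
    using star_neighbourhood[OF x] by metis
  have "primitive_on M (transport c) U (transport c x)"
    unfolding primitive_on_def
  proof
    fix y assume y: "y \<in> U"
    have yM: "y \<in> topspace M" using y U openin_subset by blast
    obtain V where V: "openin M V" "y \<in> V" "\<And>z. z \<in> V \<Longrightarrow> y \<in> M closure_of (cell_of z)"
      using star_neighbourhood[OF yM] by metis
    have "(transport c x y \<noteq> transport c x z) = transport c y z" if z: "z \<in> V \<inter> U" for z
    proof -
      have zM: "z \<in> topspace M" using z U openin_subset by blast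
      have "cell_of x \<subseteq> M closure_of (cell_of y)"
        using frontier[of "cell_of x" "cell_of y" x] cell_of[OF x] cell_of[OF yM] U(3)[OF y] by blast
      moreover have yz: "cell_of y \<subseteq> M closure_of (cell_of z)"
        using frontier[of "cell_of y" "cell_of z" y] cell_of[OF yM] cell_of[OF zM] V(3)[of z] z by blast
      ultimately have "base_vertex x \<subseteq> M closure_of (cell_of y)"
        using base_vertex[OF x] cell_order_trans by blast
      then have "(chosen_potential c (cell_of y) (base_vertex x) \<noteq> chosen_potential c (cell_of y) (base_vertex y)) =
          (chosen_potential c (cell_of z) (base_vertex x) \<noteq> chosen_potential c (cell_of z) (base_vertex y))"
        using base_vertex[OF x] base_vertex[OF yM] cell_of[OF yM] cell_of[OF zM] yz c by (intro chosen_potential_mono) auto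
      then show ?thesis unfolding transport_def by auto
    qed
    then show "\<exists>V. openin M V \<and> y \<in> V \<and> (\<forall>z\<in>V \<inter> U. (transport c x y \<noteq> transport c x z) = transport c y z)"
      using V by blast
  qed
  then show "\<exists>U g. openin M U \<and> x \<in> U \<and> primitive_on M (transport c) U g"
    using U by blast
qed

text \<open>Along the closed edge, \<open>g\<close> and the sum of the two potentials of
  \<open>e\<close>, taken at base vertices, have the same increments and hence differ by the
  constant \<open>k\<close>. Between the two ends these potentials change exactly if
  \<open>e\<close> belongs to \<open>c\<close> and to \<open>c'\<close>, respectively.\<close>

lemma trivial_transport_coboundary:
  assumes c: "c \<in> cycle_space" "c' \<in> cycle_space"
    and g: "primitive_on M (\<lambda>x y. transport c x y \<noteq> transport c' x y) (topspace M) g"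
    and e: "e \<in> C1" and vw: "{v} \<in> ends_of e" "{w} \<in> ends_of e" "v \<noteq> w"
  shows "((e \<in> c) \<noteq> (e \<in> c')) = (g v \<noteq> g w)"
proof -
  define k where "k = (\<lambda>y. g y \<noteq> (chosen_potential c e (base_vertex y) \<noteq> chosen_potential c' e (base_vertex y)))"
  have vw': "{v} \<in> C0" "{w} \<in> C0" "v \<in> M closure_of e" "w \<in> M closure_of e"
    using vw by (auto simp: ends_of_def)
  have cl: "x \<in> topspace M" "cell_of x = e \<or> cell_of x = {x} \<and> {x} \<in> C0" "base_vertex x \<in> ends_of e"
    if x: "x \<in> M closure_of e" for x
  proof -
    show xM: "x \<in> topspace M" using x by (simp add: in_closure_of)
    have "x \<in> e \<or> (\<exists>u\<in>C0. x \<in> u)" using x closure_edge[OF e] by blast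
    then show *: "cell_of x = e \<or> cell_of x = {x} \<and> {x} \<in> C0"
    proof
      assume "x \<in> e" then show ?thesis using cell_of_eq[of e x] e by blast
    next
      assume "\<exists>u\<in>C0. x \<in> u"
      then have "{x} \<in> C0" using vertex by blast
      then show ?thesis using cell_of_eq[of "{x}" x] by blast
    qed
    have "cell_of x \<subseteq> M closure_of e" using * x closure_superset[of e] e by auto
    then show "base_vertex x \<in> ends_of e"
      using base_vertex[OF xM] cell_order_trans unfolding ends_of_def by blast
  qed
  have "k v = k w"
  proof (rule locally_constant_on_connectedin[OF edge_connectedin(2)[OF e], where k = k])
    fix x assume x: "x \<in> M closure_of e"
    note xM = cl(1)[OF x]
    obtain U where U: "openin M U" "x \<in> U"
        "\<And>y. y \<in> U \<Longrightarrow> y \<in> topspace M \<Longrightarrow> (g x \<noteq> g y) = (transport c x y \<noteq> transport c' x y)"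
      using primitive_onE[OF g xM] by blast
    obtain V where V: "openin M V" "x \<in> V" "\<And>y. y \<in> V \<Longrightarrow> x \<in> M closure_of (cell_of y)"
      using star_neighbourhood[OF xM] by metis
    have "k y = k x" if y: "y \<in> (U \<inter> V) \<inter> M closure_of e" for y
    proof (cases "y = x")
      case False
      \<comment> \<open>A vertex \<open>y\<close> other than \<open>x\<close> is closed and cannot
        have \<open>x\<close> in its closure. So the potential that governs the transport from
        \<open>x\<close> to \<open>y\<close> is that of \<open>e\<close>.\<close>
      have "cell_of y = e"
      proof (rule ccontr)
        assume "cell_of y \<noteq> e"
        then have "cell_of y = {y}" "{y} \<in> C0" using cl(2)[of y] y by auto
        then have "x \<in> {y}" using V(3)[of y] y closure_vertex[of "{y}"] by simp
        then show False using False by simp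
      qed
      moreover have "(g x \<noteq> g y) = (transport c x y \<noteq> transport c' x y)"
        using U(3)[of y] y cl(1)[of y] by blast
      ultimately show ?thesis unfolding k_def transport_def by auto
    qed simp
    then show "\<exists>U. openin M U \<and> x \<in> U \<and> (\<forall>y\<in>U \<inter> M closure_of e. k y = k x)"
      using U V by (intro exI[of _ "U \<inter> V"]) blast
  qed (use vw' in auto)
  moreover have "base_vertex u = {u}" if u: "{u} \<in> C0" for u
  proof -
    have uM: "u \<in> topspace M" using cell_subset[of "{u}"] u by blast
    have "cell_of u = {u}" using cell_of_eq[of "{u}" u] u by blast
    then have "base_vertex u \<subseteq> {u}" "base_vertex u \<in> C0" using base_vertex[OF uM] closure_vertex[OF u] by auto
    then show ?thesis using vertex[of "base_vertex u"] by auto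
  qed
  moreover have "(chosen_potential c e {v} \<noteq> chosen_potential c e {w}) = (e \<in> c)" "(chosen_potential c' e {v} \<noteq> chosen_potential c' e {w}) = (e \<in> c')"
  proof -
    have "e \<in> C0 \<union> C1 \<union> C2" "e \<in> boundary_edges e" "{v} \<noteq> {w}"
      using e boundary_edges_edge[OF e] vw(3) by auto
    then show "(chosen_potential c e {v} \<noteq> chosen_potential c e {w}) = (e \<in> c)" "(chosen_potential c' e {v} \<noteq> chosen_potential c' e {w}) = (e \<in> c')"
      using chosen_potential[OF c(1), of e] chosen_potential[OF c(2), of e] vw(1,2) unfolding potential_def by simp_all
  qed
  ultimately show ?thesis using vw' unfolding k_def by auto
qed

end

section \<open>Counting cells\<close>

lemma sum_card_swap:
  assumes "finite A" "finite B"
  shows "(\<Sum>a\<in>A. card {b \<in> B. R a b}) = (\<Sum>b\<in>B. card {a \<in> A. R a b})"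
proof -
  have "(\<Sum>a\<in>A. card {b \<in> B. R a b}) = (\<Sum>a\<in>A. \<Sum>b\<in>B. if R a b then 1 else 0)"
    using assms by (simp add: sum.If_cases Int_def conj_commute)
  also have "\<dots> = (\<Sum>b\<in>B. \<Sum>a\<in>A. if R a b then 1 else 0)"
    by (rule sum.swap)
  also have "\<dots> = (\<Sum>b\<in>B. card {a \<in> A. R a b})"
    using assms by (simp add: sum.If_cases Int_def conj_commute)
  finally show ?thesis .
qed

text \<open>Symmetric difference is addition of cochains modulo two, and evaluation on the set
  \<open>E\<close> is additive.\<close>

lemma even_card_sym_diff_Int:
  assumes "finite A" "finite B"
  shows "even (card ((A - B \<union> (B - A)) \<inter> E)) \<longleftrightarrow> (even (card (A \<inter> E)) \<longleftrightarrow> even (card (B \<inter> E)))"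
proof -
  have A: "card (A \<inter> E) = card ((A - B) \<inter> E) + card (A \<inter> B \<inter> E)"
    using assms by (subst card_Un_disjoint[symmetric]) (auto intro: arg_cong[where f = card])
  have B: "card (B \<inter> E) = card ((B - A) \<inter> E) + card (A \<inter> B \<inter> E)"
    using assms by (subst card_Un_disjoint[symmetric]) (auto intro: arg_cong[where f = card])
  have "card ((A - B \<union> (B - A)) \<inter> E) = card ((A - B) \<inter> E) + card ((B - A) \<inter> E)"
    using assms by (subst card_Un_disjoint[symmetric]) (auto intro: arg_cong[where f = card])
  then show ?thesis unfolding A B by auto
qed

context regular_surface
begin

text \<open>
  A set \<open>c\<close> of edges is recovered from its parities \<open>s c\<close> on the faces, the class \<open>d c\<close> of the cocycle
  \<open>z c\<close> by which it differs from the representative of \<open>s c\<close>, and a set \<open>\<gamma> c\<close> of vertices whose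
  coboundary is the difference of \<open>z c\<close> from the representative of \<open>d c\<close>.
\<close>

lemma card_edges_le:
  fixes P :: "'p set"
  assumes P: "finite P" and D: "\<And>\<phi>. D \<phi> \<subseteq> P"
    and triv: "\<And>\<phi> \<phi>'. cocycle M \<phi> \<Longrightarrow> cocycle M \<phi>' \<Longrightarrow> D \<phi> = D \<phi>' \<Longrightarrow>
       \<exists>g. primitive_on M (\<lambda>x y. \<phi> x y \<noteq> \<phi>' x y) (topspace M) g"
  shows "card C1 \<le> card C0 + card C2 + card P"
proof -
  define s where "s = (\<lambda>c. {f \<in> C2. odd (card (c \<inter> boundary_edges f))})"
  define r where "r = (\<lambda>t. SOME c. c \<subseteq> C1 \<and> s c = t)"
  \<comment> \<open>The sum modulo two of \<open>c\<close> and the representative with the same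
    parities on all faces; the parities cancel, so it is a cocycle.\<close>
  define z where "z = (\<lambda>c. (c - r (s c)) \<union> (r (s c) - c))"
  have r: "r (s c) \<subseteq> C1 \<and> s (r (s c)) = s c" if "c \<subseteq> C1" for c
    unfolding r_def by (rule someI[of _ c]) (use that in simp)
  have z: "z c \<in> cycle_space" if c: "c \<subseteq> C1" for c
  proof -
    have "even (card (z c \<inter> boundary_edges f))" if f: "f \<in> C2" for f
    proof -
      have "finite c" "finite (r (s c))" using c r[OF c] fin(2) finite_subset by blast+
      moreover have "f \<in> s (r (s c)) \<longleftrightarrow> f \<in> s c" using r[OF c] by simp
      then have "even (card (c \<inter> boundary_edges f)) \<longleftrightarrow> even (card (r (s c) \<inter> boundary_edges f))"
        using f by (simp add: s_def)
      ultimately show ?thesis unfolding z_def by (simp add: even_card_sym_diff_Int)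
    qed
    moreover have "z c \<subseteq> C1" using c r[OF c] unfolding z_def by blast
    ultimately show ?thesis by (simp add: cycle_space_def)
  qed
  define d where "d = (\<lambda>c. D (transport (z c)))"
  define r' where "r' = (\<lambda>t. SOME c. c \<in> cycle_space \<and> D (transport c) = t)"
  have r': "r' (d c) \<in> cycle_space \<and> D (transport (r' (d c))) = d c" if "c \<subseteq> C1" for c
    unfolding r'_def by (rule someI[of _ "z c"]) (use z[OF that] in \<open>simp add: d_def\<close>)
  have "\<exists>\<gamma>. \<gamma> \<subseteq> C0 \<and> (\<forall>e\<in>C1. (e \<in> z c) = ((e \<in> r' (d c)) \<noteq> (\<exists>v\<in>ends_of e. \<exists>w\<in>ends_of e. v \<in> \<gamma> \<and> w \<notin> \<gamma>)))"
    if c: "c \<subseteq> C1" for c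
  proof -
    obtain g where g: "primitive_on M (\<lambda>x y. transport (z c) x y \<noteq> transport (r' (d c)) x y) (topspace M) g"
      using triv[OF cocycle_transport[OF z[OF c]] cocycle_transport[OF conjunct1[OF r'[OF c]]]] r'[OF c]
      unfolding d_def by metis
    \<comment> \<open>The vertices at which the primitive is true. The existential condition below
      says that \<open>e\<close> leaves this set, that is, lies in its coboundary.\<close>
    define \<gamma> where "\<gamma> = {v \<in> C0. g (the_elem v)}"
    have "(e \<in> z c) = ((e \<in> r' (d c)) \<noteq> (\<exists>v\<in>ends_of e. \<exists>w\<in>ends_of e. v \<in> \<gamma> \<and> w \<notin> \<gamma>))"
      if e: "e \<in> C1" for e
    proof -
      obtain v w where vw: "v \<in> C0" "w \<in> C0" "v \<noteq> w" "ends_of e = {v, w}"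
        by (rule ends_of_edge[OF e])
      obtain x where x: "v = {x}" using vertex[OF vw(1)] by (rule exE)
      obtain y where y: "w = {y}" using vertex[OF vw(2)] by (rule exE)
      note xy = x y
      have "((e \<in> z c) \<noteq> (e \<in> r' (d c))) = (g x \<noteq> g y)"
        by (rule trivial_transport_coboundary[OF z[OF c] conjunct1[OF r'[OF c]] g e])
           (use vw xy in auto)
      moreover have "(\<exists>v\<in>ends_of e. \<exists>w\<in>ends_of e. v \<in> \<gamma> \<and> w \<notin> \<gamma>) \<longleftrightarrow> g x \<noteq> g y"
        unfolding vw(4) \<gamma>_def using vw(1,2) xy by auto
      ultimately show ?thesis by blast
    qed
    moreover have "\<gamma> \<subseteq> C0" by (auto simp: \<gamma>_def)
    ultimately show ?thesis by blast
  qed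
  then obtain \<gamma> where \<gamma>: "\<And>c. c \<subseteq> C1 \<Longrightarrow> \<gamma> c \<subseteq> C0"
    "\<And>c e. c \<subseteq> C1 \<Longrightarrow> e \<in> C1 \<Longrightarrow> (e \<in> z c) = ((e \<in> r' (d c)) \<noteq> (\<exists>v\<in>ends_of e. \<exists>w\<in>ends_of e. v \<in> \<gamma> c \<and> w \<notin> \<gamma> c))"
    by metis
  define F where "F = (\<lambda>c. (s c, d c, \<gamma> c))"
  have "inj_on F (Pow C1)"
  proof (rule inj_onI)
    fix c c' assume c: "c \<in> Pow C1" "c' \<in> Pow C1" and "F c = F c'"
    then have eq: "s c = s c'" "d c = d c'" "\<gamma> c = \<gamma> c'" by (auto simp: F_def)
    have "e \<in> z c \<longleftrightarrow> e \<in> z c'" if "e \<in> C1" for e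
      using \<gamma>(2)[of c e] \<gamma>(2)[of c' e] c that eq by simp
    then have "e \<in> c \<longleftrightarrow> e \<in> c'" if "e \<in> C1" for e
      using that eq(1) unfolding z_def by auto
    then show "c = c'" using c by blast
  qed
  moreover have "F ` Pow C1 \<subseteq> Pow C2 \<times> Pow P \<times> Pow C0"
    using D \<gamma>(1) unfolding F_def s_def d_def by auto
  moreover have "finite (Pow C2 \<times> Pow P \<times> Pow C0)" using fin P by simp
  ultimately have "card (Pow C1) \<le> card (Pow C2 \<times> Pow P \<times> Pow C0)"
    by (metis card_inj_on_le)
  then have "2 ^ card C1 \<le> (2::nat) ^ (card C2 + card P + card C0)"
    using fin P by (simp add: card_cartesian_product card_Pow power_add mult.assoc)
  then show ?thesis by (simp add: power_le_imp_le_exp)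
qed

lemma card_faces_of_edge:
  assumes "e \<in> C1" shows "card {f \<in> C2. e \<subseteq> M closure_of f} \<le> 2"
proof (rule ccontr)
  assume "\<not> ?thesis"
  then have "3 \<le> card {f \<in> C2. e \<subseteq> M closure_of f}" by simp
  then obtain S where S: "S \<subseteq> {f \<in> C2. e \<subseteq> M closure_of f}" "card S = 3"
    by (meson obtain_subset_with_card_n)
  from S(2) obtain f g h where fgh: "S = {f, g, h}" "f \<noteq> g" "g \<noteq> h" "f \<noteq> h"
    unfolding card_3_iff by (elim exE conjE)
  have "f \<in> C2" "g \<in> C2" "h \<in> C2" "e \<subseteq> M closure_of f" "e \<subseteq> M closure_of g" "e \<subseteq> M closure_of h"
    using S(1) unfolding fgh(1) by simp_all
  then show False using at_most_two_faces[OF assms, of f g h] fgh by simp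
qed

text \<open>Double counting gives \<open>7 V \<le> 2 E\<close> and \<open>3 F \<le> 2 E\<close>.
  Then \<open>21 E \<le> 6 E + 14 E + 21 K\<close>, so \<open>E \<le> 21 K\<close>,
  \<open>V \<le> 6 K\<close> and \<open>F \<le> 14 K\<close>; the constant is 41 = 21 + 6 +
  14.\<close>

lemma card_cells_le:
  assumes poly: "\<And>f. f \<in> C2 \<Longrightarrow> 3 \<le> card (boundary_edges f)"
    and deg: "\<And>v. v \<in> C0 \<Longrightarrow> 7 \<le> card {e \<in> C1. v \<in> ends_of e}"
    and K: "card C1 \<le> card C0 + card C2 + K"
  shows "card C0 + card C1 + card C2 \<le> 41 * K"
proof -
  have "(\<Sum>v\<in>C0. 7) \<le> (\<Sum>v\<in>C0. card {e \<in> C1. v \<in> ends_of e})"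
    by (rule sum_mono) (rule deg)
  also have "\<dots> = (\<Sum>e\<in>C1. card {v \<in> C0. v \<in> ends_of e})"
    using fin by (intro sum_card_swap)
  also have "\<dots> = (\<Sum>e\<in>C1. 2)"
  proof (rule sum.cong[OF refl])
    fix e assume e: "e \<in> C1"
    obtain v w where vw: "v \<in> C0" "w \<in> C0" "v \<noteq> w" "ends_of e = {v, w}"
      by (rule ends_of_edge[OF e])
    then have "{v \<in> C0. v \<in> ends_of e} = {v, w}" by auto
    then show "card {v \<in> C0. v \<in> ends_of e} = 2" using vw(3) by simp
  qed
  finally have V: "7 * card C0 \<le> 2 * card C1" by simp
  have "(\<Sum>f\<in>C2. 3) \<le> (\<Sum>f\<in>C2. card {e \<in> C1. e \<subseteq> M closure_of f})"
    by (rule sum_mono) (use poly in \<open>simp add: boundary_edges_def\<close>)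
  also have "\<dots> = (\<Sum>e\<in>C1. card {f \<in> C2. e \<subseteq> M closure_of f})"
    using fin by (intro sum_card_swap)
  also have "\<dots> \<le> (\<Sum>e\<in>C1. 2)"
    by (rule sum_mono) (rule card_faces_of_edge)
  finally have "3 * card C2 \<le> 2 * card C1" by simp
  then show ?thesis using V K by linarith
qed

end

section \<open>Extension of isomorphisms of incidence relations\<close>

text \<open>Alexander's trick: the cone over the boundary map. It preserves norms, which gives
  continuity at the origin, and its inverse is the cone over the inverse of
  \<open>\<psi>\<close>.\<close>

lemma radial_extension:
  fixes \<psi> :: "'b::euclidean_space \<Rightarrow> 'b"
  assumes cont: "continuous_on (sphere 0 1) \<psi>" and bij: "bij_betw \<psi> (sphere 0 1) (sphere 0 1)"
  obtains k where "continuous_on (cball 0 1) k" "bij_betw k (ball 0 1) (ball 0 1)"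
    "\<And>x. x \<in> sphere 0 1 \<Longrightarrow> k x = \<psi> x" "\<And>x. x \<in> cball 0 1 \<Longrightarrow> k x \<in> cball 0 1"
proof -
  define k where "k = (\<lambda>x. norm x *\<^sub>R \<psi> (sgn x))"
  define \<psi>' where "\<psi>' = inv_into (sphere 0 1) \<psi>"
  define k' where "k' = (\<lambda>x. norm x *\<^sub>R \<psi>' (sgn x))"
  have \<psi>: "norm (\<psi> u) = 1" if "norm u = 1" for u
    using bij_betwE[OF bij] that by auto
  have bij': "bij_betw \<psi>' (sphere 0 1) (sphere 0 1)"
    unfolding \<psi>'_def using bij by (rule bij_betw_inv_into)
  have \<psi>': "norm (\<psi>' u) = 1" if "norm u = 1" for u
    using bij_betwE[OF bij'] that by auto
  have inv: "\<psi>' (\<psi> u) = u" "\<psi> (\<psi>' u) = u" if "norm u = 1" for u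
    using bij that unfolding \<psi>'_def by (auto simp: bij_betw_inv_into_left bij_betw_inv_into_right)
  have norm_k: "norm (k x) = norm x" for x
    using \<psi>[of "sgn x"] by (cases "x = 0") (auto simp: k_def norm_sgn)
  have norm_k': "norm (k' x) = norm x" for x
    using \<psi>'[of "sgn x"] by (cases "x = 0") (auto simp: k'_def norm_sgn)
  have sgn_k: "sgn (k x) = \<psi> (sgn x)" if "x \<noteq> 0" for x
  proof -
    have "sgn (k x) = k x /\<^sub>R norm x" by (simp add: sgn_div_norm norm_k)
    then show ?thesis using that by (simp add: k_def)
  qed
  have sgn_k': "sgn (k' x) = \<psi>' (sgn x)" if "x \<noteq> 0" for x
  proof -
    have "sgn (k' x) = k' x /\<^sub>R norm x" by (simp add: sgn_div_norm norm_k')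
    then show ?thesis using that by (simp add: k'_def)
  qed
  have sgn_eq: "norm x *\<^sub>R sgn x = x" for x :: 'b
    by (cases "x = 0") (simp_all add: sgn_div_norm)
  have k'k: "k' (k x) = x" for x
  proof (cases "x = 0")
    case False
    have "k' (k x) = norm (k x) *\<^sub>R \<psi>' (sgn (k x))" by (simp add: k'_def)
    also have "\<dots> = norm x *\<^sub>R sgn x" using False by (simp add: norm_k sgn_k inv norm_sgn)
    finally show ?thesis by (simp add: sgn_eq)
  qed (simp add: k_def k'_def)
  have kk': "k (k' x) = x" for x
  proof (cases "x = 0")
    case False
    have "k (k' x) = norm (k' x) *\<^sub>R \<psi> (sgn (k' x))" by (simp add: k_def)
    also have "\<dots> = norm x *\<^sub>R sgn x" using False by (simp add: norm_k' sgn_k' inv norm_sgn)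
    finally show ?thesis by (simp add: sgn_eq)
  qed (simp add: k_def k'_def)
  have bk: "bij_betw k (ball 0 1) (ball 0 1)"
    by (rule bij_betwI[where g = k']) (auto simp: norm_k norm_k' k'k kk')
  have k\<psi>: "k x = \<psi> x" if "x \<in> sphere 0 1" for x
    using that by (simp add: k_def sgn_div_norm)
  have kc: "k x \<in> cball 0 1" if "x \<in> cball 0 1" for x
    using that by (simp add: norm_k)
  have "continuous_on (- {0}) (\<lambda>x::'b. norm x *\<^sub>R \<psi> (sgn x))"
  proof -
    have "continuous_on (- {0}) (sgn :: 'b \<Rightarrow> 'b)" by (intro continuous_intros) auto
    then have "continuous_on (- {0}) (\<lambda>x. \<psi> (sgn x))"
      by (rule continuous_on_compose2[OF cont]) (auto simp: norm_sgn split: if_splits)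
    then show ?thesis by (intro continuous_intros)
  qed
  then have off0: "continuous_on (- {0}) k" by (simp add: k_def)
  have "isCont k x" for x
  proof (cases "x = 0")
    case False
    then show ?thesis
      using off0 by (simp add: continuous_on_eq_continuous_at open_Compl)
  next
    case True
    have "(k \<longlongrightarrow> 0) (at 0)"
      by (rule tendsto_norm_zero_cancel) (simp add: norm_k tendsto_norm_zero)
    then show ?thesis using True by (simp add: isCont_def k_def)
  qed
  then have "continuous_on (cball 0 1) k"
    by (simp add: continuous_at_imp_continuous_on)
  then show ?thesis using that bk k\<psi> kc by blast
qed

lemma bij_betw_UN:
  assumes "\<And>a b. a \<in> A \<Longrightarrow> b \<in> A \<Longrightarrow> a \<noteq> b \<Longrightarrow> \<beta> a \<inter> \<beta> b = {}"
    and "\<And>a. a \<in> A \<Longrightarrow> bij_betw h a (\<beta> a)"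
  shows "bij_betw h (\<Union>A) (\<Union>(\<beta> ` A))"
  using bij_betw_UNION_disjoint[of \<beta> A h "\<lambda>a. a"] assms by (simp add: disjoint_family_on_def)

text \<open>The parametrizations turn \<open>h\<close> on the boundary into a self-map of the unit
  sphere, to which the radial extension applies.\<close>

lemma extend_over_cell:
  fixes P Q :: "'b::euclidean_space \<Rightarrow> 'a"
  assumes haus: "Hausdorff_space M"
    and P: "cell_parametrization M P e" and Q: "cell_parametrization M Q e'"
    and h: "continuous_map (subtopology M X) M h" and X: "P ` sphere 0 1 \<subseteq> X"
    and bij: "bij_betw h (P ` sphere 0 1) (Q ` sphere 0 1)"
  obtains H where "continuous_map (subtopology M (M closure_of e)) M H"
    "\<And>x. x \<in> P ` sphere 0 1 \<Longrightarrow> H x = h x" "bij_betw H e e'"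
proof -
  have sph: "sphere (0::'b) 1 \<subseteq> cball 0 1" and ball: "ball (0::'b) 1 \<subseteq> cball 0 1" by auto
  have injP: "inj_on P (cball 0 1)" and injQ: "inj_on Q (cball 0 1)"
    using P Q by (auto simp: cell_parametrization_def)
  have contP: "continuous_map (top_of_set (cball 0 1)) M P" and contQ: "continuous_map (top_of_set (cball 0 1)) M Q"
    using P Q by (auto simp: cell_parametrization_def)
  define Q' where "Q' = inv_into (cball 0 1) Q"
  define P' where "P' = inv_into (cball 0 1) P"
  define \<psi> where "\<psi> = Q' \<circ> (h \<circ> P)"
  have bP: "bij_betw P (sphere 0 1) (P ` sphere 0 1)"
    using injP sph by (meson inj_on_imp_bij_betw inj_on_subset)
  have bQ: "bij_betw Q (sphere 0 1) (Q ` sphere 0 1)"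
    using injQ sph by (meson inj_on_imp_bij_betw inj_on_subset)
  have Q'Q: "Q' (Q x) = x" if "x \<in> cball 0 1" for x
    unfolding Q'_def using injQ that by (rule inv_into_f_f)
  have P'P: "P' (P x) = x" if "x \<in> cball 0 1" for x
    unfolding P'_def using injP that by (rule inv_into_f_f)
  have bQ': "bij_betw Q' (Q ` sphere 0 1) (sphere 0 1)"
    by (rule bij_betwI[where g = Q]) (use Q'Q sph in auto)
  have bij\<psi>: "bij_betw \<psi> (sphere 0 1) (sphere 0 1)"
    unfolding \<psi>_def by (intro bij_betw_trans[OF _ bQ'] bij_betw_trans[OF bP bij])
  have contpsi: "continuous_on (sphere 0 1) \<psi>"
  proof -
    have "continuous_map (top_of_set (sphere 0 1)) (subtopology M X) P"
      using continuous_map_from_subtopology_mono[OF contP sph] X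
      by (auto simp: continuous_map_in_subtopology)
    from continuous_map_compose[OF this h]
    have "continuous_map (top_of_set (sphere 0 1)) M (h \<circ> P)" .
    moreover have "(h \<circ> P) x \<in> M closure_of e'" if "x \<in> sphere 0 1" for x
    proof -
      have "(h \<circ> P) x \<in> Q ` sphere 0 1" using bij_betwE[OF bij] that by auto
      then show ?thesis using cell_parametrization_closure_eq[OF haus Q] by blast
    qed
    ultimately have "continuous_map (top_of_set (sphere 0 1)) (subtopology M (M closure_of e')) (h \<circ> P)"
      by (simp add: continuous_map_in_subtopology image_subset_iff)
    from continuous_map_compose[OF this cell_parametrization_inverse_continuous[OF haus Q]]
    show ?thesis unfolding \<psi>_def Q'_def by (simp add: continuous_map_in_subtopology)
  qed
  obtain k where k: "continuous_on (cball 0 1) k" "bij_betw k (ball 0 1) (ball 0 1)"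
    "\<And>x. x \<in> sphere 0 1 \<Longrightarrow> k x = \<psi> x" "\<And>x. x \<in> cball 0 1 \<Longrightarrow> k x \<in> cball 0 1"
    using radial_extension[OF contpsi bij\<psi>] by blast
  define H where "H = Q \<circ> (k \<circ> P')"
  have eP: "e = P ` ball 0 1" and eQ: "e' = Q ` ball 0 1"
    using P Q by (auto simp: cell_parametrization_def)
  show ?thesis
  proof
    have "continuous_map (top_of_set (cball 0 1)) (top_of_set (cball 0 1)) k"
      using k(1,4) by (auto simp: continuous_map_in_subtopology)
    then show "continuous_map (subtopology M (M closure_of e)) M H"
      unfolding H_def P'_def
      by (intro continuous_map_compose[OF _ contQ]
          continuous_map_compose[OF cell_parametrization_inverse_continuous[OF haus P]])
    show "H x = h x" if x: "x \<in> P ` sphere 0 1" for x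
    proof -
      obtain u where u: "u \<in> sphere 0 1" "x = P u" using x by blast
      have "h x \<in> Q ` sphere 0 1" using bij_betwE[OF bij] x by blast
      then obtain w where w: "w \<in> sphere 0 1" "h x = Q w" by blast
      have "H x = Q (\<psi> u)" using u sph by (simp add: H_def P'P k(3))
      also have "\<dots> = Q (Q' (h x))" using u by (simp add: \<psi>_def)
      also have "\<dots> = h x" using w sph by (simp add: Q'Q)
      finally show ?thesis .
    qed
    have "bij_betw P' e (ball 0 1)"
      unfolding eP by (rule bij_betwI[where g = P]) (use P'P ball in auto)
    moreover have "bij_betw Q (ball 0 1) e'"
      unfolding eQ using injQ ball by (meson inj_on_imp_bij_betw inj_on_subset)
    ultimately show "bij_betw H e e'"
      unfolding H_def using k(2) by (blast intro: bij_betw_trans)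
  qed
qed

text \<open>Closures of different cells meet only inside \<open>X\<close>, so \<open>h\<close> and
  the extensions over the single cells agree on overlaps and can be pasted along a finite closed
  cover.\<close>

lemma extend_over_cells:
  fixes P Q :: "'a set \<Rightarrow> 'b::euclidean_space \<Rightarrow> 'a"
  assumes haus: "Hausdorff_space M" and X: "closedin M X" and S: "finite S" "disjoint S"
    and h: "continuous_map (subtopology M X) M h"
    and P: "\<And>a. a \<in> S \<Longrightarrow> cell_parametrization M (P a) a"
    and sub: "\<And>a. a \<in> S \<Longrightarrow> P a ` sphere 0 1 \<subseteq> X" and aX: "\<And>a. a \<in> S \<Longrightarrow> a \<inter> X = {}"
    and Q: "\<And>a. a \<in> S \<Longrightarrow> cell_parametrization M (Q a) (\<beta> a)"
    and bij: "\<And>a. a \<in> S \<Longrightarrow> bij_betw h (P a ` sphere 0 1) (Q a ` sphere 0 1)"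
  obtains H where "continuous_map (subtopology M (X \<union> \<Union>S)) M H"
    "\<And>x. x \<in> X \<Longrightarrow> H x = h x" "\<And>a. a \<in> S \<Longrightarrow> bij_betw H a (\<beta> a)"
proof -
  have "\<exists>H. continuous_map (subtopology M (M closure_of a)) M H \<and>
    (\<forall>x \<in> P a ` sphere 0 1. H x = h x) \<and> bij_betw H a (\<beta> a)" if a: "a \<in> S" for a
    using extend_over_cell[OF haus P[OF a] Q[OF a] h sub[OF a] bij[OF a]] by metis
  then obtain G where G: "\<And>a. a \<in> S \<Longrightarrow> continuous_map (subtopology M (M closure_of a)) M (G a)"
    "\<And>a x. a \<in> S \<Longrightarrow> x \<in> P a ` sphere 0 1 \<Longrightarrow> G a x = h x" "\<And>a. a \<in> S \<Longrightarrow> bij_betw (G a) a (\<beta> a)"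
    by metis
  have cl: "M closure_of a = a \<union> P a ` sphere 0 1" if "a \<in> S" for a
    by (rule cell_parametrization_closure_eq[OF haus P[OF that]])
  have clsub: "M closure_of a \<subseteq> X \<union> \<Union>S" if "a \<in> S" for a
    using cl[OF that] sub[OF that] that by blast
  have dis: "a = b" if "a \<in> S" "b \<in> S" "x \<in> a" "x \<in> b" for a b x
    using S(2) that by (meson disjnt_iff pairwiseD disjnt_def IntI empty_iff)
  \<comment> \<open>\<open>None\<close> indexes the closed set \<open>X\<close> where the map is
    already given, \<open>Some a\<close> the closed cell of \<open>a\<close>.\<close>
  define T where "T = (\<lambda>i. case i of None \<Rightarrow> X | Some a \<Rightarrow> M closure_of a)"
  define F where "F = (\<lambda>i. case i of None \<Rightarrow> h | Some a \<Rightarrow> G a)"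
  define H where "H = (\<lambda>x. if x \<in> X then h x else G (THE a. a \<in> S \<and> x \<in> a) x)"
  have HX: "H x = h x" if "x \<in> X" for x using that by (simp add: H_def)
  have Ha: "H x = G a x" if a: "a \<in> S" "x \<in> a" for a x
  proof -
    have "(THE a. a \<in> S \<and> x \<in> a) = a" by (rule the_equality) (use a dis in blast)+
    moreover have "x \<notin> X" using aX a by blast
    ultimately show ?thesis by (simp add: H_def)
  qed
  have Gh: "G a x = h x" if "a \<in> S" "x \<in> M closure_of a" "x \<in> X" for a x
    using G(2) cl aX that by blast
  have F_eq: "F i x = H x" if i: "i \<in> insert None (Some ` S)" and x: "x \<in> T i" for i x
  proof (cases i)
    case None
    then show ?thesis using x HX by (simp add: F_def T_def)
  next
    case (Some a)
    then have a: "a \<in> S" "x \<in> M closure_of a" using i x by (auto simp: T_def)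
    have "G a x = H x"
    proof (cases "x \<in> X")
      case True
      then show ?thesis using Gh[OF a] HX by simp
    next
      case False
      then have "x \<in> a" using a(2) cl[OF a(1)] sub[OF a(1)] by blast
      then show ?thesis using Ha a(1) by simp
    qed
    then show ?thesis using Some by (simp add: F_def)
  qed
  show ?thesis
  proof
    show "continuous_map (subtopology M (X \<union> \<Union>S)) M H"
    proof (rule pasting_lemma_closed[where I = "insert None (Some ` S)" and T = T and f = F])
      show "finite (insert None (Some ` S))" using S by simp
      fix i assume i: "i \<in> insert None (Some ` S)"
      have Ti: "T i \<subseteq> X \<union> \<Union>S"
      proof (cases i)
        case (Some a)
        then have "a \<in> S" using i by auto
        then show ?thesis using clsub[of a] Some by (simp add: T_def)
      qed (simp add: T_def)
      have "closedin M (T i)" using i X by (auto simp: T_def)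
      then show "closedin (subtopology M (X \<union> \<Union>S)) (T i)"
        using Ti by (rule closedin_subset_topspace)
      have "subtopology (subtopology M (X \<union> \<Union>S)) (T i) = subtopology M (T i)"
        using Ti by (simp add: subtopology_subtopology inf.absorb2)
      then show "continuous_map (subtopology (subtopology M (X \<union> \<Union>S)) (T i)) M (F i)"
        using i h G(1) by (auto simp: T_def F_def)
    next
      fix i j x assume "i \<in> insert None (Some ` S)" "j \<in> insert None (Some ` S)"
        "x \<in> topspace (subtopology M (X \<union> \<Union>S)) \<inter> T i \<inter> T j"
      then show "F i x = F j x"
        using F_eq[of i x] F_eq[of j x] by simp
    next
      fix x assume x: "x \<in> topspace (subtopology M (X \<union> \<Union>S))"
      show "\<exists>j. j \<in> insert None (Some ` S) \<and> x \<in> T j \<and> H x = F j x"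
      proof (cases "x \<in> X")
        case True
        then show ?thesis using HX by (intro exI[of _ None]) (simp add: T_def F_def)
      next
        case False
        then obtain a where a: "a \<in> S" "x \<in> a" using x by auto
        then show ?thesis
          using Ha[OF a] cl[OF a(1)] by (intro exI[of _ "Some a"]) (simp add: T_def F_def)
      qed
    qed
    show "H x = h x" if "x \<in> X" for x by (rule HX[OF that])
    show "bij_betw H a (\<beta> a)" if "a \<in> S" for a
      using G(3)[OF that] bij_betw_cong[of a H "G a"] Ha[OF that] by blast
  qed
qed

section \<open>Isomorphic incidence relations\<close>

locale surface_isomorphism = A: regular_surface M C0 C1 C2 + B: regular_surface M D0 D1 D2
  for M :: "'a topology" and C0 C1 C2 D0 D1 D2 +
  fixes \<beta> :: "'a set \<Rightarrow> 'a set"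
  assumes bij: "bij_betw \<beta> C0 D0" "bij_betw \<beta> C1 D1" "bij_betw \<beta> C2 D2"
    and incidence: "a \<in> C0 \<union> C1 \<union> C2 \<Longrightarrow> b \<in> C0 \<union> C1 \<union> C2 \<Longrightarrow>
       a \<subseteq> M closure_of b \<longleftrightarrow> \<beta> a \<subseteq> M closure_of \<beta> b"
begin

lemma bij_cells: "bij_betw \<beta> (C0 \<union> C1 \<union> C2) (D0 \<union> D1 \<union> D2)"
  using bij A.disj B.disj by (intro bij_betw_combine) auto

lemma image_cell: "a \<in> C0 \<union> C1 \<union> C2 \<Longrightarrow> \<beta> a \<in> D0 \<union> D1 \<union> D2"
  using bij_betwE[OF bij_cells] by blast

lemma image_disjoint:
  assumes "a \<in> C0 \<union> C1 \<union> C2" "b \<in> C0 \<union> C1 \<union> C2" "a \<noteq> b" shows "\<beta> a \<inter> \<beta> b = {}"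
proof -
  have "\<beta> a \<noteq> \<beta> b" using assms bij_cells by (auto simp: bij_betw_def dest: inj_onD)
  then show ?thesis using assms image_cell by (intro B.cell_disjoint) auto
qed

text \<open>Boundaries are disjoint unions of cells on both sides by \<open>frontier\<close>, and
  preservation of incidence makes \<open>\<beta>\<close> match these cells. This is the boundary
  condition that the extension over \<open>b\<close> requires.\<close>

lemma bij_betw_boundary:
  assumes b: "b \<in> C0 \<union> C1 \<union> C2"
    and h: "\<And>a. a \<in> C0 \<union> C1 \<union> C2 \<Longrightarrow> a \<subseteq> M closure_of b \<Longrightarrow> a \<noteq> b \<Longrightarrow> bij_betw h a (\<beta> a)"
  shows "bij_betw h (M closure_of b - b) (M closure_of (\<beta> b) - \<beta> b)"
proof -
  define F where "F = {a \<in> C0 \<union> C1 \<union> C2. a \<subseteq> M closure_of b \<and> a \<noteq> b}"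
  have 1: "M closure_of b - b = \<Union>F"
  proof (intro Set.set_eqI iffI)
    fix x assume x: "x \<in> M closure_of b - b"
    then have xM: "x \<in> topspace M" by (simp add: in_closure_of)
    then obtain a where a: "a \<in> C0 \<union> C1 \<union> C2" "x \<in> a" using A.cell_of by blast
    then have "a \<subseteq> M closure_of b" using A.frontier[of a b x] b x by blast
    then show "x \<in> \<Union>F" using a x unfolding F_def by blast
  next
    fix x assume "x \<in> \<Union>F"
    then obtain a where a: "a \<in> C0 \<union> C1 \<union> C2" "a \<subseteq> M closure_of b" "a \<noteq> b" "x \<in> a"
      unfolding F_def by blast
    then have "x \<notin> b" using A.cell_disjoint[of a b] b by blast
    then show "x \<in> M closure_of b - b" using a by blast
  qed
  have 2: "M closure_of (\<beta> b) - \<beta> b = \<Union>(\<beta> ` F)"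
  proof (intro Set.set_eqI iffI)
    fix x assume x: "x \<in> M closure_of (\<beta> b) - \<beta> b"
    then have xM: "x \<in> topspace M" by (simp add: in_closure_of)
    then obtain d where d: "d \<in> D0 \<union> D1 \<union> D2" "x \<in> d" using B.cell_of by blast
    then obtain a where a: "a \<in> C0 \<union> C1 \<union> C2" "d = \<beta> a"
      using bij_cells by (metis bij_betw_imp_surj_on imageE)
    have "\<beta> a \<subseteq> M closure_of \<beta> b" using B.frontier[of d "\<beta> b" x] d image_cell[OF b] x a by blast
    then have "a \<subseteq> M closure_of b" using incidence a b by blast
    moreover have "a \<noteq> b" using x d a by blast
    ultimately show "x \<in> \<Union>(\<beta> ` F)" using a d unfolding F_def by blast
  next
    fix x assume "x \<in> \<Union>(\<beta> ` F)"
    then obtain a where a: "a \<in> C0 \<union> C1 \<union> C2" "a \<subseteq> M closure_of b" "a \<noteq> b" "x \<in> \<beta> a"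
      unfolding F_def by blast
    then have "x \<notin> \<beta> b" using image_disjoint[of a b] b by blast
    moreover have "\<beta> a \<subseteq> M closure_of (\<beta> b)" using incidence[OF a(1) b] a by blast
    ultimately show "x \<in> M closure_of (\<beta> b) - \<beta> b" using a by blast
  qed
  show ?thesis
    unfolding 1 2
  proof (rule bij_betw_UN)
    fix a c assume "a \<in> F" "c \<in> F" "a \<noteq> c"
    then show "\<beta> a \<inter> \<beta> c = {}" by (intro image_disjoint) (auto simp: F_def)
  next
    fix a assume "a \<in> F"
    then show "bij_betw h a (\<beta> a)" by (intro h) (auto simp: F_def)
  qed
qed

lemma parametrization_boundary:
  assumes "Hausdorff_space M" "cell_parametrization M P e"
  shows "P ` sphere 0 1 = M closure_of e - e"
  using cell_parametrization_closure_eq[OF assms] cell_parametrization_boundary[OF assms] by blast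

text \<open>The extensions stay injective because cells are mapped bijectively onto cells with
  disjoint images; compactness then supplies continuity of the inverse.\<close>

theorem homeomorphism_exists:
  obtains h where "homeomorphic_map M M h" "\<And>a. a \<in> C0 \<union> C1 \<union> C2 \<Longrightarrow> h ` a = \<beta> a"
proof -
  note haus = A.Hausdorff
  have cell0: "a \<in> C0" if a: "a \<in> C0 \<union> C1 \<union> C2" "a \<subseteq> \<Union>C0" for a
  proof -
    obtain x where "x \<in> a" using A.cell_nonempty[OF a(1)] by blast
    then obtain v where "v \<in> C0" "x \<in> v" using a(2) by blast
    then show ?thesis using A.cell_eqI[of a v x] a(1) \<open>x \<in> a\<close> by blast
  qed
  have cell1: "a \<in> C0 \<union> C1" if a: "a \<in> C0 \<union> C1 \<union> C2" "a \<subseteq> \<Union>(C0 \<union> C1)" for a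
  proof -
    obtain x where "x \<in> a" using A.cell_nonempty[OF a(1)] by blast
    then obtain v where "v \<in> C0 \<union> C1" "x \<in> v" using a(2) by blast
    then show ?thesis using A.cell_eqI[of a v x] a(1) \<open>x \<in> a\<close> by blast
  qed
  define h0 where "h0 = (\<lambda>x. the_elem (\<beta> (A.cell_of x)))"
  have h0: "bij_betw h0 v (\<beta> v)" if v: "v \<in> C0" for v
  proof -
    obtain x where x: "v = {x}" using A.vertex[OF v] by (rule exE)
    have "\<beta> v \<in> D0" using bij_betwE[OF bij(1)] v by blast
    then obtain y where y: "\<beta> v = {y}" using B.vertex by blast
    have "A.cell_of x = v" using A.cell_of_eq[of v x] v x by blast
    then show ?thesis unfolding x bij_betw_def using y x by (simp add: h0_def)
  qed
  have fin0: "finite (\<Union>C0)" using A.fin(1) A.vertex by (metis finite.emptyI finite.insertI finite_Union)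
  have sub0: "\<Union>C0 \<subseteq> topspace M" using A.cell_subset by blast
  \<comment> \<open>The vertices form a finite subset of a Hausdorff space, which is
    discrete.\<close>
  have cont0: "continuous_map (subtopology M (\<Union>C0)) M h0"
  proof -
    have "subtopology M (\<Union>C0) = discrete_topology (topspace M \<inter> \<Union>C0)"
      using haus Hausdorff_imp_t1_space fin0 subtopology_eq_discrete_topology_gen_finite by blast
    moreover have "h0 x \<in> topspace M" if x: "x \<in> \<Union>C0" for x
    proof -
      obtain v where v: "v \<in> C0" "x \<in> v" using x by blast
      then have "h0 x \<in> \<beta> v" using bij_betwE[OF h0] by blast
      then show ?thesis using B.cell_subset[OF image_cell[of v]] v by blast
    qed
    ultimately show ?thesis by auto
  qed
  obtain P1 :: "'a set \<Rightarrow> real \<Rightarrow> 'a" where P1: "\<And>e. e \<in> C1 \<Longrightarrow> cell_parametrization M (P1 e) e"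
      "\<And>e. e \<in> C1 \<Longrightarrow> P1 e ` sphere 0 1 \<subseteq> \<Union>C0"
    using A.edge by metis
  have "\<exists>Q :: real \<Rightarrow> 'a. cell_parametrization M Q (\<beta> e)" if "e \<in> C1" for e
    using B.edge bij_betwE[OF bij(2)] that by blast
  then obtain Q1 :: "'a set \<Rightarrow> real \<Rightarrow> 'a" where Q1: "\<And>e. e \<in> C1 \<Longrightarrow> cell_parametrization M (Q1 e) (\<beta> e)"
    by metis
  obtain h1 where h1: "continuous_map (subtopology M (\<Union>C0 \<union> \<Union>C1)) M h1"
    "\<And>x. x \<in> \<Union>C0 \<Longrightarrow> h1 x = h0 x" "\<And>a. a \<in> C1 \<Longrightarrow> bij_betw h1 a (\<beta> a)"
  proof (rule extend_over_cells[OF haus A.closedin_Un_vertices[OF order_refl] A.fin(2) _ cont0 P1 _ Q1])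
    show "disjoint C1" using A.disj(1) by (rule pairwise_subset) auto
    show "a \<inter> \<Union>C0 = {}" if "a \<in> C1" for a
      using A.cell_disjoint[of a] A.disj(2) that by blast
    show "bij_betw h0 (P1 a ` sphere 0 1) (Q1 a ` sphere 0 1)" if a: "a \<in> C1" for a
      unfolding parametrization_boundary[OF haus P1(1)[OF a]] parametrization_boundary[OF haus Q1[OF a]]
    proof (rule bij_betw_boundary)
      fix b assume b: "b \<in> C0 \<union> C1 \<union> C2" "b \<subseteq> M closure_of a" "b \<noteq> a"
      have "b \<inter> a = {}" using A.cell_disjoint[of b a] b a by blast
      then have "b \<subseteq> \<Union>C0" using b A.closure_edge[OF a] by blast
      then show "bij_betw h0 b (\<beta> b)" using cell0[OF b(1)] h0 by blast
    qed (use a in blast)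
  qed (use P1 in blast)+
  have h1': "bij_betw h1 a (\<beta> a)" if a: "a \<in> C0 \<union> C1" for a
  proof (cases "a \<in> C1")
    case False
    then have a0: "a \<in> C0" using a by blast
    then have "\<And>x. x \<in> a \<Longrightarrow> h1 x = h0 x" using h1(2) by blast
    then show ?thesis using h0[OF a0] bij_betw_cong by blast
  qed (use h1(3) in blast)
  have Un01: "\<Union>C0 \<union> \<Union>C1 = \<Union>(C0 \<union> C1)" by blast
  have cont1: "continuous_map (subtopology M (\<Union>(C0 \<union> C1))) M h1" using h1(1) unfolding Un01 .
  obtain P2 :: "'a set \<Rightarrow> complex \<Rightarrow> 'a" where P2: "\<And>e. e \<in> C2 \<Longrightarrow> cell_parametrization M (P2 e) e"
      "\<And>e. e \<in> C2 \<Longrightarrow> P2 e ` sphere 0 1 \<subseteq> \<Union>(C0 \<union> C1)"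
    using A.face by metis
  have "\<exists>Q :: complex \<Rightarrow> 'a. cell_parametrization M Q (\<beta> e)" if "e \<in> C2" for e
    using B.face bij_betwE[OF bij(3)] that by blast
  then obtain Q2 :: "'a set \<Rightarrow> complex \<Rightarrow> 'a" where Q2: "\<And>e. e \<in> C2 \<Longrightarrow> cell_parametrization M (Q2 e) (\<beta> e)"
    by metis
  obtain h where h: "continuous_map (subtopology M (\<Union>(C0 \<union> C1) \<union> \<Union>C2)) M h"
    "\<And>x. x \<in> \<Union>(C0 \<union> C1) \<Longrightarrow> h x = h1 x" "\<And>a. a \<in> C2 \<Longrightarrow> bij_betw h a (\<beta> a)"
  proof (rule extend_over_cells[OF haus A.closedin_skeleton A.fin(3) _ cont1 P2 _ Q2])
    show "disjoint C2" using A.disj(1) by (rule pairwise_subset) auto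
    show "a \<inter> \<Union>(C0 \<union> C1) = {}" if "a \<in> C2" for a
      using A.cell_disjoint[of a] A.disj(3,4) that by blast
    show "bij_betw h1 (P2 a ` sphere 0 1) (Q2 a ` sphere 0 1)" if a: "a \<in> C2" for a
      unfolding parametrization_boundary[OF haus P2(1)[OF a]] parametrization_boundary[OF haus Q2[OF a]]
    proof (rule bij_betw_boundary)
      fix b assume b: "b \<in> C0 \<union> C1 \<union> C2" "b \<subseteq> M closure_of a" "b \<noteq> a"
      have "b \<inter> a = {}" using A.cell_disjoint[of b a] b a by blast
      then have "b \<subseteq> \<Union>(C0 \<union> C1)" using b A.closure_face[OF a] by blast
      then show "bij_betw h1 b (\<beta> b)" using cell1[OF b(1)] h1' by blast
    qed (use a in blast)
  qed (use P2 in blast)+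
  have h': "bij_betw h a (\<beta> a)" if a: "a \<in> C0 \<union> C1 \<union> C2" for a
  proof (cases "a \<in> C2")
    case False
    then have a1: "a \<in> C0 \<union> C1" using a by blast
    then have "\<And>x. x \<in> a \<Longrightarrow> h x = h1 x" using h(2) by blast
    then show ?thesis using h1'[OF a1] bij_betw_cong by blast
  qed (use h(3) in blast)
  have "\<Union>(C0 \<union> C1) \<union> \<Union>C2 = topspace M" using A.cover by blast
  then have cont: "continuous_map M M h" using h(1) by simp
  have "bij_betw h (\<Union>(C0 \<union> C1 \<union> C2)) (\<Union>(\<beta> ` (C0 \<union> C1 \<union> C2)))"
    using image_disjoint h' by (rule bij_betw_UN)
  moreover have "\<beta> ` (C0 \<union> C1 \<union> C2) = D0 \<union> D1 \<union> D2"
    using bij_cells by (simp add: bij_betw_def)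
  ultimately have bijM: "bij_betw h (topspace M) (topspace M)"
    unfolding A.cover by (simp only: B.cover)
  have "homeomorphic_map M M h"
    using cont bijM A.compact haus by (intro continuous_imp_homeomorphic_map) (auto simp: bij_betw_def)
  then show ?thesis using that h' by (auto simp: bij_betw_def)
qed

end

section \<open>Regular cell decompositions of closed surfaces\<close>

lemma continuous_map_sum_squares:
  "continuous_map (Euclidean_space n) euclideanreal (\<lambda>x. \<Sum>i<n. (x i)\<^sup>2)"
  unfolding Euclidean_space_def
  by (intro continuous_intros continuous_map_from_subtopology continuous_map_product_projection) auto

lemma openin_open_unit_ball: "openin (Euclidean_space n) (open_unit_ball n)"
proof -
  have "openin (Euclidean_space n) {x \<in> topspace (Euclidean_space n). (\<Sum>i<n. (x i)\<^sup>2) \<in> {..<1}}"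
    by (rule openin_continuous_map_preimage[OF continuous_map_sum_squares]) auto
  then show ?thesis by (simp add: open_unit_ball_def)
qed

lemma zero_in_open_unit_ball: "(\<lambda>i. 0) \<in> open_unit_ball n"
  by (simp add: open_unit_ball_def topspace_Euclidean_space)

lemma topspace_open_unit_ball: "topspace (subtopology (Euclidean_space n) (open_unit_ball n)) = open_unit_ball n"
  by (auto simp: open_unit_ball_def)

text \<open>If \<open>m < n\<close>, the target lies in the hyperplane of
  \<open>Euclidean_space n\<close> where coordinate \<open>m\<close> vanishes, yet invariance of
  domain makes the image open there. The line \<open>L\<close> through a point of the image varies
  coordinate \<open>m\<close> and meets the image in that point only.\<close>

lemma Euclidean_space_injective_imp_le:
  assumes U: "openin (Euclidean_space n) U" "U \<noteq> {}"
    and f: "continuous_map (subtopology (Euclidean_space n) U) (Euclidean_space m) f" "inj_on f U"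
  shows "n \<le> m"
proof (rule ccontr)
  assume "\<not> n \<le> m"
  then have "m < n" by simp
  then have sub: "topspace (Euclidean_space m) \<subseteq> topspace (Euclidean_space n)" by simp
  have Utop: "U \<subseteq> topspace (Euclidean_space n)" using U openin_subset by blast
  have fm: "f x \<in> topspace (Euclidean_space m)" if "x \<in> U" for x
    using f(1) that Utop unfolding continuous_map_def by auto
  have "continuous_map (subtopology (Euclidean_space n) U) (Euclidean_space n) f"
    using f(1) subsetD[OF sub fm] unfolding cm_Euclidean_space_iff_continuous_on by auto
  then have op: "openin (Euclidean_space n) (f ` U)"
    using U f by (intro invariance_of_domain_Euclidean_space)
  obtain x where x: "x \<in> f ` U" using U by blast
  then have xm: "x \<in> topspace (Euclidean_space m)" using fm by blast
  define L where "L = (\<lambda>t (i::nat). if i < n then (if i = m then t else x i) else 0)"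
  have "continuous_map euclideanreal (Euclidean_space n) L"
    unfolding L_def continuous_map_componentwise_Euclidean_space by auto
  then have "openin euclideanreal {t \<in> topspace euclideanreal. L t \<in> f ` U}"
    using op by (rule openin_continuous_map_preimage)
  moreover have "{t \<in> topspace euclideanreal. L t \<in> f ` U} = {0}"
  proof (intro Set.set_eqI iffI)
    fix t assume "t \<in> {t \<in> topspace euclideanreal. L t \<in> f ` U}"
    then obtain u where "u \<in> U" "L t = f u" by blast
    then have "L t \<in> topspace (Euclidean_space m)" using fm[of u] by simp
    then have "L t m = 0" by (simp add: topspace_Euclidean_space)
    then show "t \<in> {0}" using \<open>m < n\<close> by (simp add: L_def)
  next
    fix t :: real assume "t \<in> {0}"
    moreover have "L 0 = x"
    proof
      fix i show "L 0 i = x i"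
        using xm \<open>m < n\<close> by (cases "i < m") (simp_all add: L_def topspace_Euclidean_space)
    qed
    ultimately show "t \<in> {t \<in> topspace euclideanreal. L t \<in> f ` U}" using x by simp
  qed
  ultimately show False by (simp add: not_open_singleton)
qed

lemma open_unit_ball_homeomorphic_imp_le:
  assumes "subtopology (Euclidean_space n) (open_unit_ball n) homeomorphic_space
           subtopology (Euclidean_space m) (open_unit_ball m)"
  shows "n \<le> m"
proof -
  obtain f where f: "homeomorphic_map (subtopology (Euclidean_space n) (open_unit_ball n))
      (subtopology (Euclidean_space m) (open_unit_ball m)) f"
    using assms homeomorphic_space by blast
  show ?thesis
  proof (rule Euclidean_space_injective_imp_le[OF openin_open_unit_ball])
    show "open_unit_ball n \<noteq> {}" using zero_in_open_unit_ball by blast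
    show "continuous_map (subtopology (Euclidean_space n) (open_unit_ball n)) (Euclidean_space m) f"
      using homeomorphic_imp_continuous_map[OF f] continuous_map_into_fulltopology by blast
    show "inj_on f (open_unit_ball n)"
      using homeomorphic_imp_injective_map[OF f] unfolding topspace_open_unit_ball .
  qed
qed

lemma cells_homeomorphic:
  assumes "e \<in> cells M C n"
  shows "subtopology (Euclidean_space n) (open_unit_ball n) homeomorphic_space subtopology M e"
proof -
  have "subtopology M e homeomorphic_space subtopology (Euclidean_space n) (open_unit_ball n)"
    using assms by (simp add: cells_def)
  then show ?thesis by (rule homeomorphic_space_sym[THEN iffD1])
qed

lemma cells_dimension_unique:
  assumes "e \<in> cells M C n" "e \<in> cells M C m" shows "n = m"
proof -
  have n: "subtopology M e homeomorphic_space subtopology (Euclidean_space n) (open_unit_ball n)"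
    and m: "subtopology M e homeomorphic_space subtopology (Euclidean_space m) (open_unit_ball m)"
    using assms by (simp_all add: cells_def)
  show ?thesis
    using open_unit_ball_homeomorphic_imp_le[OF homeomorphic_space_trans[OF homeomorphic_space_sym[THEN iffD1, OF n] m]]
      open_unit_ball_homeomorphic_imp_le[OF homeomorphic_space_trans[OF homeomorphic_space_sym[THEN iffD1, OF m] n]]
    by simp
qed

text \<open>Near the image of the centre of the ball the cell lies in a chart, which gives a
  continuous injection of a nonempty open subset of \<open>Euclidean_space n\<close> into
  \<open>Euclidean_space 2\<close>.\<close>

lemma cells_dimension_le_2:
  assumes M: "closed_surface M" and e: "e \<in> cells M C n" "e \<subseteq> topspace M"
  shows "n \<le> 2"
proof -
  let ?B = "subtopology (Euclidean_space n) (open_unit_ball n)"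
  have "?B homeomorphic_space subtopology M e"
    by (rule cells_homeomorphic[OF e(1)])
  then obtain f where f: "homeomorphic_map ?B (subtopology M e) f"
    using homeomorphic_space by blast
  have cf: "continuous_map ?B M f"
    using homeomorphic_imp_continuous_map[OF f] continuous_map_into_fulltopology by blast
  have injf: "inj_on f (open_unit_ball n)"
    using homeomorphic_imp_injective_map[OF f] unfolding topspace_open_unit_ball .
  have "f (\<lambda>i. 0) \<in> topspace M"
    using cf zero_in_open_unit_ball[of n] continuous_map_image_subset_topspace[OF cf]
    unfolding topspace_open_unit_ball by blast
  then obtain U where U: "openin M U" "f (\<lambda>i. 0) \<in> U" "subtopology M U homeomorphic_space Euclidean_space 2"
    using M unfolding closed_surface_def by blast
  then obtain g where g: "homeomorphic_map (subtopology M U) (Euclidean_space 2) g"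
    using homeomorphic_space by blast
  define W where "W = {x \<in> open_unit_ball n. f x \<in> U}"
  have UM: "U \<subseteq> topspace M" using U openin_subset by blast
  have "openin ?B W"
    using openin_continuous_map_preimage[OF cf U(1)] unfolding topspace_open_unit_ball W_def .
  then have W: "openin (Euclidean_space n) W"
    using openin_open_unit_ball openin_trans_full by blast
  have "continuous_map (subtopology (Euclidean_space n) W) (subtopology M U) f"
    using continuous_map_from_subtopology_mono[OF cf, of W]
    by (auto simp: W_def continuous_map_in_subtopology)
  then have "continuous_map (subtopology (Euclidean_space n) W) (Euclidean_space 2) (g \<circ> f)"
    using homeomorphic_imp_continuous_map[OF g] by (rule continuous_map_compose)
  moreover have "inj_on (g \<circ> f) W"
  proof (rule comp_inj_on)
    show "inj_on f W" using injf by (rule inj_on_subset) (auto simp: W_def)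
    have "inj_on g U"
      using homeomorphic_imp_injective_map[OF g] UM by (simp add: inf.absorb2)
    then show "inj_on g (f ` W)" by (rule inj_on_subset) (auto simp: W_def)
  qed
  moreover have "W \<noteq> {}" using U zero_in_open_unit_ball by (auto simp: W_def)
  ultimately show ?thesis using W Euclidean_space_injective_imp_le by blast
qed

lemma characteristic_map_imp_cells:
  "e \<in> C \<Longrightarrow> characteristic_map M C n e f \<Longrightarrow> e \<in> cells M C n"
  unfolding cells_def characteristic_map_def using homeomorphic_map_imp_homeomorphic_space homeomorphic_space_sym by blast

section \<open>Real and complex coordinates for edges and faces\<close>

definition coords_real :: "real \<Rightarrow> nat \<Rightarrow> real" where
  "coords_real t i = (if i < 1 then t else 0)"

definition coords_complex :: "complex \<Rightarrow> nat \<Rightarrow> real" where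
  "coords_complex z i = (if i < 2 then if i = 0 then Re z else Im z else 0)"

lemma continuous_map_coords_real: "continuous_map euclidean (Euclidean_space 1) coords_real"
proof -
  have "continuous_map euclidean (Euclidean_space 1) (\<lambda>x i. if i < 1 then x else 0)"
    using continuous_map_componentwise_Euclidean_space[of euclideanreal 1 "\<lambda>x i. x"] by simp
  then show ?thesis unfolding coords_real_def[abs_def] .
qed

lemma continuous_map_coords_complex: "continuous_map euclidean (Euclidean_space 2) coords_complex"
proof -
  have "continuous_map euclidean euclideanreal (\<lambda>z. if i = 0 then Re z else Im z)" for i :: nat
    by (cases "i = 0") (auto intro!: continuous_intros)
  then have "continuous_map euclidean (Euclidean_space 2) (\<lambda>z i. if i < 2 then if i = 0 then Re z else Im z else 0)"
    using continuous_map_componentwise_Euclidean_space[of euclidean 2 "\<lambda>z i. if i = 0 then Re z else Im z"] by blast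
  then show ?thesis unfolding coords_complex_def[abs_def] .
qed

lemma bij_coords_real: "bij_betw coords_real UNIV (topspace (Euclidean_space 1))"
  by (rule bij_betwI[where g = "\<lambda>x. x 0"]) (auto simp: coords_real_def topspace_Euclidean_space fun_eq_iff)

lemma bij_coords_complex: "bij_betw coords_complex UNIV (topspace (Euclidean_space 2))"
proof (rule bij_betwI[where g = "\<lambda>x. Complex (x 0) (x 1)"])
  show "coords_complex (Complex (x 0) (x 1)) = x" if "x \<in> topspace (Euclidean_space 2)" for x
  proof
    fix i show "coords_complex (Complex (x 0) (x 1)) i = x i"
      using that by (cases "i = 0"; cases "i = 1") (auto simp: coords_complex_def topspace_Euclidean_space)
  qed
qed (auto simp: coords_complex_def topspace_Euclidean_space complex_eq_iff)

lemma sum_squares_coords_real: "(\<Sum>i<1. (coords_real t i)\<^sup>2) = (norm t)\<^sup>2"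
  by (simp add: coords_real_def)

lemma sum_squares_coords_complex: "(\<Sum>i<2. (coords_complex z i)\<^sup>2) = (norm z)\<^sup>2"
proof -
  have "{..<2::nat} = {0, 1}" by auto
  then show ?thesis by (simp add: coords_complex_def cmod_power2)
qed

lemma homeomorphic_maps_coords_complex:
  "homeomorphic_maps euclidean (Euclidean_space 2) coords_complex (\<lambda>x. Complex (x 0) (x 1))"
  unfolding homeomorphic_maps_def
proof (intro conjI ballI)
  show "continuous_map euclidean (Euclidean_space 2) coords_complex" by (rule continuous_map_coords_complex)
  have "continuous_map (Euclidean_space 2) euclideanreal (\<lambda>x. x i)" for i
    unfolding Euclidean_space_def by (intro continuous_map_from_subtopology continuous_map_product_projection) simp
  then have "continuous_map (Euclidean_space 2) euclidean (\<lambda>x. complex_of_real (x 0) + \<i> * complex_of_real (x 1))"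
    unfolding continuous_map_Euclidean_space_iff by (intro continuous_intros) auto
  then show "continuous_map (Euclidean_space 2) euclidean (\<lambda>x. Complex (x 0) (x 1))"
    by (simp add: Complex_eq)
  show "coords_complex (Complex (x 0) (x 1)) = x" if "x \<in> topspace (Euclidean_space 2)" for x
  proof
    fix i show "coords_complex (Complex (x 0) (x 1)) i = x i"
      using that by (cases "i = 0"; cases "i = 1") (auto simp: coords_complex_def topspace_Euclidean_space)
  qed
qed (simp add: coords_complex_def)

lemma closed_surface_locally_planar:
  assumes "closed_surface M" shows "locally_planar M"
  unfolding locally_planar_def
proof
  fix x assume "x \<in> topspace M"
  then obtain U where U: "openin M U" "x \<in> U" "subtopology M U homeomorphic_space Euclidean_space 2"
    using assms unfolding closed_surface_def by blast
  have "(euclidean :: complex topology) homeomorphic_space Euclidean_space 2"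
    using homeomorphic_maps_coords_complex homeomorphic_space_def by blast
  then have "(euclidean :: complex topology) homeomorphic_space subtopology M U"
    using U(3) homeomorphic_space_sym homeomorphic_space_trans by blast
  then show "\<exists>U \<psi>. openin M U \<and> x \<in> U \<and> homeomorphic_map (euclidean :: complex topology) (subtopology M U) \<psi>"
    using U homeomorphic_space by blast
qed

text \<open>\<open>J\<close> matches the squared norm with the sum of squares, so it carries both
  balls and the sphere onto their coordinate versions; \<open>J_image\<close> treats all three by
  means of a predicate on the squared norm.\<close>

lemma characteristic_map_parametrization:
  fixes J :: "'b::euclidean_space \<Rightarrow> nat \<Rightarrow> real"
  assumes J: "continuous_map euclidean (Euclidean_space n) J" "bij_betw J UNIV (topspace (Euclidean_space n))"
    and sq: "\<And>x. (\<Sum>i<n. (J x i)\<^sup>2) = (norm x)\<^sup>2"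
    and f: "characteristic_map M C n e f" "inj_on f (closed_unit_ball n)" and e: "e \<subseteq> topspace M"
  shows "cell_parametrization M (f \<circ> J) e" "(f \<circ> J) ` sphere 0 1 \<subseteq> (\<Union>m<n. \<Union>(cells M C m))"
proof -
  have J_image: "J ` {x. Q ((norm x)\<^sup>2)} = {y \<in> topspace (Euclidean_space n). Q (\<Sum>i<n. (y i)\<^sup>2)}" for Q
  proof (intro Set.set_eqI iffI)
    fix y assume "y \<in> J ` {x. Q ((norm x)\<^sup>2)}"
    then obtain x where x: "Q ((norm x)\<^sup>2)" "y = J x" by blast
    then show "y \<in> {y \<in> topspace (Euclidean_space n). Q (\<Sum>i<n. (y i)\<^sup>2)}"
      using bij_betwE[OF J(2)] by (simp add: sq)
  next
    fix y assume y: "y \<in> {y \<in> topspace (Euclidean_space n). Q (\<Sum>i<n. (y i)\<^sup>2)}"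
    then obtain x where "y = J x" using bij_betw_imp_surj_on[OF J(2)] by blast
    then show "y \<in> J ` {x. Q ((norm x)\<^sup>2)}" using y by (simp add: sq)
  qed
  have le: "(norm x)\<^sup>2 \<le> 1 \<longleftrightarrow> norm x \<le> 1" "(norm x)\<^sup>2 < 1 \<longleftrightarrow> norm x < 1" "(norm x)\<^sup>2 = 1 \<longleftrightarrow> norm x = 1" for x :: 'b
    using abs_square_le_1[of "norm x"] abs_square_less_1[of "norm x"] by (auto simp: power2_eq_1_iff)
  have cb: "J ` cball 0 1 = closed_unit_ball n"
    using J_image[of "\<lambda>s. s \<le> 1"] by (simp add: closed_unit_ball_def le cball_def)
  have ob: "J ` ball 0 1 = open_unit_ball n"
    using J_image[of "\<lambda>s. s < 1"] by (simp add: open_unit_ball_def le ball_def)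
  have sp: "J ` sphere 0 1 = unit_sphere n"
    using J_image[of "\<lambda>s. s = 1"] by (simp add: unit_sphere_def le sphere_def)
  have "continuous_map (top_of_set (cball 0 1)) (subtopology (Euclidean_space n) (closed_unit_ball n)) J"
    using continuous_map_from_subtopology[OF J(1), of "cball 0 1"] cb
    by (auto simp: continuous_map_in_subtopology)
  then have "continuous_map (top_of_set (cball 0 1)) M (f \<circ> J)"
    using f(1) unfolding characteristic_map_def by (blast intro: continuous_map_compose)
  moreover have "inj_on (f \<circ> J) (cball 0 1)"
    using J(2) f(2) cb by (intro comp_inj_on) (auto simp: bij_betw_def intro: inj_on_subset)
  moreover have "f ` open_unit_ball n = e"
    using f(1) homeomorphic_imp_surjective_map e
    unfolding characteristic_map_def by (metis inf.absorb2 topspace_open_unit_ball topspace_subtopology)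
  then have "(f \<circ> J) ` ball 0 1 = e" by (simp only: image_comp[symmetric] ob)
  ultimately show "cell_parametrization M (f \<circ> J) e" by (simp add: cell_parametrization_def)
  show "(f \<circ> J) ` sphere 0 1 \<subseteq> (\<Union>m<n. \<Union>(cells M C m))"
    using f(1) unfolding image_comp[symmetric] sp characteristic_map_def by blast
qed

lemma cells_0_singleton:
  assumes "v \<in> cells M C 0" "v \<subseteq> topspace M" shows "\<exists>x. v = {x}"
proof -
  have "subtopology (Euclidean_space 0) (open_unit_ball 0) homeomorphic_space subtopology M v"
    by (rule cells_homeomorphic[OF assms(1)])
  then obtain f where f: "homeomorphic_map (subtopology (Euclidean_space 0) (open_unit_ball 0)) (subtopology M v) f"
    using homeomorphic_space by blast
  have "f ` open_unit_ball 0 = v"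
    using homeomorphic_imp_surjective_map[OF f] assms(2)
    unfolding topspace_open_unit_ball by (simp only: topspace_subtopology inf.absorb2)
  moreover have "open_unit_ball 0 = {\<lambda>i. 0}"
    by (auto simp: open_unit_ball_def topspace_Euclidean_space)
  ultimately show ?thesis by auto
qed

context
  fixes M :: "'a topology" and C :: "'a set set"
  assumes M: "closed_surface M" and C: "regular_cell_decomposition M C"
begin

text \<open>Regularity only provides an injective characteristic map in some dimension; invariance
  of dimension identifies it with \<open>n\<close>.\<close>

lemma cell_characteristic_map:
  assumes "e \<in> cells M C n"
  obtains f where "characteristic_map M C n e f" "inj_on f (closed_unit_ball n)"
proof -
  have "e \<in> C" using assms by (simp add: cells_def)
  then obtain m f where f: "characteristic_map M C m e f" "inj_on f (closed_unit_ball m)"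
    using C unfolding regular_cell_decomposition_def by blast
  then have "m = n"
    using cells_dimension_unique[OF characteristic_map_imp_cells[OF \<open>e \<in> C\<close> f(1)] assms] by simp
  then show ?thesis using that f by blast
qed

lemma decomposition_cells: "cells M C 0 \<union> cells M C 1 \<union> cells M C 2 = C"
proof
  show "C \<subseteq> cells M C 0 \<union> cells M C 1 \<union> cells M C 2"
  proof
    fix e assume e: "e \<in> C"
    then obtain n f where f: "characteristic_map M C n e f"
      using C unfolding regular_cell_decomposition_def by blast
    then have en: "e \<in> cells M C n" using characteristic_map_imp_cells e by blast
    have "e \<subseteq> topspace M"
      using C e unfolding regular_cell_decomposition_def cell_decomposition_def by blast
    then have "n \<le> 2" using cells_dimension_le_2[OF M en] by blast
    then have "n = 0 \<or> n = 1 \<or> n = 2" by auto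
    then show "e \<in> cells M C 0 \<union> cells M C 1 \<union> cells M C 2" using en by auto
  qed
qed (auto simp: cells_def)

lemma regular_surface_cells: "regular_surface M (cells M C 0) (cells M C 1) (cells M C 2)"
proof
  have dec: "finite C" "disjoint C" "\<Union>C = topspace M"
    using C unfolding regular_cell_decomposition_def cell_decomposition_def by auto
  have sub: "e \<subseteq> topspace M" if "e \<in> cells M C n" for e n
    using that dec(3) by (auto simp: cells_def)
  show "compact_space M" "Hausdorff_space M" using M by (auto simp: closed_surface_def)
  show "locally_planar M" by (rule closed_surface_locally_planar[OF M])
  show "finite (cells M C 0)" "finite (cells M C 1)" "finite (cells M C 2)"
    using dec(1) by (auto simp: cells_def)
  show "disjoint (cells M C 0 \<union> cells M C 1 \<union> cells M C 2)"
    "\<Union>(cells M C 0 \<union> cells M C 1 \<union> cells M C 2) = topspace M"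
    unfolding decomposition_cells using dec by auto
  show "cells M C 0 \<inter> cells M C 1 = {}" "cells M C 0 \<inter> cells M C 2 = {}" "cells M C 1 \<inter> cells M C 2 = {}"
    using cells_dimension_unique by fastforce+
  show "\<exists>x. v = {x}" if "v \<in> cells M C 0" for v
    using cells_0_singleton[OF that sub[OF that]] .
  show "\<exists>P :: real \<Rightarrow> 'a. cell_parametrization M P e \<and> P ` sphere 0 1 \<subseteq> \<Union>(cells M C 0)"
    if e: "e \<in> cells M C 1" for e
  proof -
    obtain f where f: "characteristic_map M C 1 e f" "inj_on f (closed_unit_ball 1)"
      by (rule cell_characteristic_map[OF e])
    have "(\<Union>m<1. \<Union>(cells M C m)) = \<Union>(cells M C 0)" by auto
    then show ?thesis
      using characteristic_map_parametrization[OF continuous_map_coords_real bij_coords_real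
        sum_squares_coords_real f sub[OF e]] by metis
  qed
  show "\<exists>P :: complex \<Rightarrow> 'a. cell_parametrization M P e \<and> P ` sphere 0 1 \<subseteq> \<Union>(cells M C 0 \<union> cells M C 1)"
    if e: "e \<in> cells M C 2" for e
  proof -
    obtain f where f: "characteristic_map M C 2 e f" "inj_on f (closed_unit_ball 2)"
      by (rule cell_characteristic_map[OF e])
    have "(\<Union>m<2. \<Union>(cells M C m)) = \<Union>(cells M C 0 \<union> cells M C 1)"
      by (auto simp: numeral_2_eq_2 lessThan_Suc)
    then show ?thesis
      using characteristic_map_parametrization[OF continuous_map_coords_complex bij_coords_complex
        sum_squares_coords_complex f sub[OF e]] by metis
  qed
qed

lemma card_decomposition_le:
  fixes P :: "'p set"
  assumes poly: "polygonal_faces M C" and deg: "min_degree (one_skeleton M C) \<ge> 7"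
    and P: "finite P" "\<And>\<phi>. D \<phi> \<subseteq> P"
    and triv: "\<And>\<phi> \<phi>'. cocycle M \<phi> \<Longrightarrow> cocycle M \<phi>' \<Longrightarrow> D \<phi> = D \<phi>' \<Longrightarrow>
       \<exists>g. primitive_on M (\<lambda>x y. \<phi> x y \<noteq> \<phi>' x y) (topspace M) g"
  shows "card C \<le> 41 * card P"
proof -
  interpret regular_surface M "cells M C 0" "cells M C 1" "cells M C 2"
    by (rule regular_surface_cells)
  have "card (cells M C 0) + card (cells M C 1) + card (cells M C 2) \<le> 41 * card P"
  proof (rule card_cells_le)
    show "3 \<le> card (boundary_edges f)" if "f \<in> cells M C 2" for f
      using poly that unfolding polygonal_faces_def boundary_edges_def by blast
    show "card (cells M C 1) \<le> card (cells M C 0) + card (cells M C 2) + card P"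
      by (rule card_edges_le[OF P triv])
    fix v assume v: "v \<in> cells M C 0"
    \<comment> \<open>The second summand of the degree counts loops. Edges have two distinct ends
      here, so every incident edge counts once.\<close>
    have no_loops: "{e \<in> cells M C 1. ends_of e = {v}} = {}"
    proof (rule equals0I)
      fix e assume "e \<in> {e \<in> cells M C 1. ends_of e = {v}}"
      then have e: "e \<in> cells M C 1" "ends_of e = {v}" by auto
      obtain x y where "x \<noteq> y" "ends_of e = {x, y}" by (rule ends_of_edge[OF e(1)])
      then show False using e(2) by auto
    qed
    have "Defs.degree (one_skeleton M C) v =
        card {e \<in> cells M C 1. v \<in> ends_of e} + card {e \<in> cells M C 1. ends_of e = {v}}"
      by (simp add: Defs.degree_def one_skeleton_def ends_of_def)
    then have "Defs.degree (one_skeleton M C) v = card {e \<in> cells M C 1. v \<in> ends_of e}"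
      unfolding no_loops by simp
    moreover have "min_degree (one_skeleton M C) \<le> Defs.degree (one_skeleton M C) v"
      unfolding min_degree_def using v fin(1) by (intro Min_le) (auto simp: one_skeleton_def)
    ultimately show "7 \<le> card {e \<in> cells M C 1. v \<in> ends_of e}" using deg by simp
  qed
  moreover have "card C \<le> card (cells M C 0) + card (cells M C 1) + card (cells M C 2)"
    using card_Un_le[of "cells M C 0 \<union> cells M C 1" "cells M C 2"] card_Un_le[of "cells M C 0" "cells M C 1"]
    unfolding decomposition_cells by linarith
  ultimately show ?thesis by linarith
qed

end

section \<open>Decompositions up to self-homeomorphism\<close>

lemma same_decomposition_Image_subset:
  assumes h: "homeomorphic_map M M h" "(\<lambda>e. h ` e) ` C = D"
  shows "same_decomposition M `` {D} \<subseteq> same_decomposition M `` {C}"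
proof
  fix X assume "X \<in> same_decomposition M `` {D}"
  then obtain k where k: "homeomorphic_map M M k" "(\<lambda>e. k ` e) ` D = X"
    by (auto simp: same_decomposition_def)
  have "homeomorphic_map M M (k \<circ> h)" using h(1) k(1) by (rule homeomorphic_map_compose)
  moreover have "(\<lambda>e. (k \<circ> h) ` e) ` C = X"
    unfolding k(2)[symmetric] h(2)[symmetric] by (simp add: image_image image_comp)
  ultimately show "X \<in> same_decomposition M `` {C}" unfolding same_decomposition_def by blast
qed

text \<open>One inclusion comes from \<open>h\<close>, the other from its inverse, which undoes
  \<open>h\<close> on cells because these lie in the space.\<close>

lemma same_decomposition_Image_eq:
  assumes h: "homeomorphic_map M M h" "(\<lambda>e. h ` e) ` C = D" and C: "\<Union>C \<subseteq> topspace M"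
  shows "same_decomposition M `` {C} = same_decomposition M `` {D}"
proof
  obtain g where g: "homeomorphic_maps M M h g" using h(1) homeomorphic_map_maps by blast
  have gh: "g ` h ` e = e" if "e \<in> C" for e
  proof -
    have "g (h x) = x" if "x \<in> e" for x
      using g C that \<open>e \<in> C\<close> unfolding homeomorphic_maps_def by blast
    then show ?thesis by (simp add: image_image)
  qed
  have "homeomorphic_map M M g" using g homeomorphic_maps_map by blast
  moreover have "(\<lambda>e. g ` e) ` D = C"
    unfolding h(2)[symmetric] image_image[of "\<lambda>e. g ` e"] using gh by simp
  ultimately show "same_decomposition M `` {C} \<subseteq> same_decomposition M `` {D}"
    by (rule same_decomposition_Image_subset)
  show "same_decomposition M `` {D} \<subseteq> same_decomposition M `` {C}"
    using h(1,2) by (rule same_decomposition_Image_subset)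
qed

text \<open>Cells are named by numbers through \<open>\<iota>\<close>, so that the types of all
  decompositions with boundedly many cells lie in one finite set. The value \<open>{}\<close> above
  dimension 2 keeps the function component within a finite set of functions.\<close>

definition incidence_type ::
    "'a topology \<Rightarrow> ('a set \<Rightarrow> nat) \<Rightarrow> 'a set set \<Rightarrow> (nat \<Rightarrow> nat set) \<times> (nat \<times> nat) set" where
  "incidence_type M \<iota> C = (\<lambda>n. if n \<le> 2 then \<iota> ` cells M C n else {},
     {(\<iota> a, \<iota> b) | a b. a \<in> C \<and> b \<in> C \<and> a \<subseteq> M closure_of b})"

text \<open>Letting cells with the same number correspond defines \<open>\<beta>\<close>. Equality
  of types makes it preserve dimension and incidence, so a self-homeomorphism of \<open>M\<close>
  realizes it.\<close>

lemma same_incidence_type: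
  assumes M: "closed_surface M" and C: "regular_cell_decomposition M C" and D: "regular_cell_decomposition M D"
    and i: "inj_on i C" and j: "inj_on j D" and eq: "incidence_type M i C = incidence_type M j D"
  shows "same_decomposition M `` {C} = same_decomposition M `` {D}"
proof -
  note decC = decomposition_cells[OF M C] and decD = decomposition_cells[OF M D]
  have img: "i ` cells M C n = j ` cells M D n" if "n \<le> 2" for n
  proof -
    have "fst (incidence_type M i C) n = fst (incidence_type M j D) n" using eq by simp
    then show ?thesis using that by (simp add: incidence_type_def)
  qed
  have imgs: "i ` C = j ` D"
  proof -
    have "i ` (cells M C 0 \<union> cells M C 1 \<union> cells M C 2) = j ` (cells M D 0 \<union> cells M D 1 \<union> cells M D 2)"
      using img[of 0] img[of 1] img[of 2] by (simp add: image_Un)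
    then show ?thesis unfolding decC decD .
  qed
  define \<beta> where "\<beta> = inv_into D j \<circ> i"
  have j\<beta>: "j (\<beta> a) = i a" "\<beta> a \<in> D" if "a \<in> C" for a
  proof -
    have "i a \<in> j ` D" using that unfolding imgs[symmetric] by simp
    then show "j (\<beta> a) = i a" "\<beta> a \<in> D"
      unfolding \<beta>_def by (simp_all add: f_inv_into_f inv_into_into)
  qed
  have bij: "bij_betw \<beta> (cells M C n) (cells M D n)" if n: "n \<le> 2" for n
  proof -
    have sub: "cells M C n \<subseteq> C" "cells M D n \<subseteq> D" by (auto simp: cells_def)
    have "inj_on \<beta> (cells M C n)"
    proof (rule inj_onI)
      fix a b assume ab: "a \<in> cells M C n" "b \<in> cells M C n" "\<beta> a = \<beta> b"
      then have "a \<in> C" "b \<in> C" using sub by blast+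
      then have "i a = i b" using j\<beta>(1)[of a] j\<beta>(1)[of b] ab(3) by simp
      then show "a = b" using \<open>a \<in> C\<close> \<open>b \<in> C\<close> by (rule inj_onD[OF i])
    qed
    moreover have "\<beta> ` cells M C n = cells M D n"
    proof -
      have "\<beta> ` cells M C n = inv_into D j ` j ` cells M D n"
        unfolding \<beta>_def image_comp[symmetric] img[OF n] ..
      then show ?thesis using inv_into_image_cancel[OF j sub(2)] by simp
    qed
    ultimately show ?thesis by (simp add: bij_betw_def)
  qed
  have inc: "a \<subseteq> M closure_of b \<longleftrightarrow> \<beta> a \<subseteq> M closure_of \<beta> b" if ab: "a \<in> C" "b \<in> C" for a b
  proof -
    have "a \<subseteq> M closure_of b \<longleftrightarrow> (i a, i b) \<in> snd (incidence_type M i C)"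
      using ab by (auto simp: incidence_type_def inj_on_eq_iff[OF i])
    also have "\<dots> \<longleftrightarrow> (j (\<beta> a), j (\<beta> b)) \<in> snd (incidence_type M j D)"
      using eq j\<beta> ab by simp
    also have "\<dots> \<longleftrightarrow> \<beta> a \<subseteq> M closure_of \<beta> b"
      using j\<beta>(2)[OF ab(1)] j\<beta>(2)[OF ab(2)] by (auto simp: incidence_type_def inj_on_eq_iff[OF j])
    finally show ?thesis .
  qed
  interpret A: regular_surface M "cells M C 0" "cells M C 1" "cells M C 2"
    by (rule regular_surface_cells[OF M C])
  interpret B: regular_surface M "cells M D 0" "cells M D 1" "cells M D 2"
    by (rule regular_surface_cells[OF M D])
  interpret surface_isomorphism M "cells M C 0" "cells M C 1" "cells M C 2"
    "cells M D 0" "cells M D 1" "cells M D 2" \<beta>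
  proof
    show "bij_betw \<beta> (cells M C 0) (cells M D 0)" "bij_betw \<beta> (cells M C 1) (cells M D 1)"
      "bij_betw \<beta> (cells M C 2) (cells M D 2)"
      by (rule bij, simp)+
    show "a \<subseteq> M closure_of b \<longleftrightarrow> \<beta> a \<subseteq> M closure_of \<beta> b"
      if "a \<in> cells M C 0 \<union> cells M C 1 \<union> cells M C 2" "b \<in> cells M C 0 \<union> cells M C 1 \<union> cells M C 2" for a b
      using that unfolding decC by (rule inc)
  qed
  obtain h where h: "homeomorphic_map M M h" "\<And>a. a \<in> C \<Longrightarrow> h ` a = \<beta> a"
    using homeomorphism_exists unfolding decC by blast
  have "\<beta> ` C = D"
    using bij_cells unfolding decC decD by (simp add: bij_betw_def)
  then have "(\<lambda>e. h ` e) ` C = D" using h(2) by simp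
  moreover have "\<Union>C \<subseteq> topspace M" using A.cover unfolding decC by simp
  ultimately show ?thesis using h(1) by (intro same_decomposition_Image_eq)
qed

lemma finite_image_factor:
  assumes "finite (t ` A)" "\<And>x y. x \<in> A \<Longrightarrow> y \<in> A \<Longrightarrow> t x = t y \<Longrightarrow> g x = g y"
  shows "finite (g ` A)"
proof -
  have "g ` A \<subseteq> (\<lambda>s. g (inv_into A t s)) ` t ` A"
  proof
    fix z assume "z \<in> g ` A"
    then obtain x where x: "x \<in> A" "z = g x" by blast
    then have "inv_into A t (t x) \<in> A" "t (inv_into A t (t x)) = t x"
      by (auto intro: inv_into_into f_inv_into_f)
    then have "g x = g (inv_into A t (t x))" using assms(2)[of x "inv_into A t (t x)"] x(1) by simp
    then show "z \<in> (\<lambda>s. g (inv_into A t s)) ` t ` A" using x by blast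
  qed
  then show ?thesis using assms(1) finite_surj by blast
qed

theorem theorem5:
  fixes M :: "'a topology"
  assumes "closed_surface M"
  shows "finite ({C. regular_cell_decomposition M C \<and> polygonal_faces M C \<and>
                     min_degree (one_skeleton M C) \<ge> 7} // same_decomposition M)"
proof -
  define A where "A = {C. regular_cell_decomposition M C \<and> polygonal_faces M C \<and>
                     min_degree (one_skeleton M C) \<ge> 7}"
  have M: "compact_space M" "Hausdorff_space M" using assms by (auto simp: closed_surface_def)
  \<comment> \<open>\<open>P\<close> and \<open>d\<close> depend on \<open>M\<close> alone and are
    fixed before any decomposition is considered, so \<open>N\<close> bounds the number of cells of
    all of them.\<close>
  obtain P :: "('a \<times> 'a \<times> 'a) set" and d where P: "finite P" "\<And>\<phi>. d \<phi> \<subseteq> P"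
    "\<And>\<phi> \<phi>'. cocycle M \<phi> \<Longrightarrow> cocycle M \<phi>' \<Longrightarrow> d \<phi> = d \<phi>' \<Longrightarrow>
       \<exists>g. primitive_on M (\<lambda>x y. \<phi> x y \<noteq> \<phi>' x y) (topspace M) g"
    by (rule finitely_many_cocycle_classes[OF M closed_surface_locally_planar[OF assms]]) (rule that)
  define N where "N = 41 * card P"
  have A: "regular_cell_decomposition M C" "card C \<le> N" "finite C" if "C \<in> A" for C
  proof -
    show C: "regular_cell_decomposition M C" using that by (simp add: A_def)
    show "card C \<le> N"
      unfolding N_def using that by (intro card_decomposition_le[OF assms C _ _ P]) (auto simp: A_def)
    show "finite C" using C by (simp add: regular_cell_decomposition_def cell_decomposition_def)
  qed
  have "\<exists>i. inj_on i C \<and> i ` C \<subseteq> {..<N}" if "C \<in> A" for C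
    using card_le_inj[of C "{..<N}"] A[OF that] by auto
  then obtain \<iota> where \<iota>: "\<And>C. C \<in> A \<Longrightarrow> inj_on (\<iota> C) C" "\<And>C. C \<in> A \<Longrightarrow> \<iota> C ` C \<subseteq> {..<N}"
    by metis
  define t where "t = (\<lambda>C. incidence_type M (\<iota> C) C)"
  have "finite {F :: nat \<Rightarrow> nat set. \<forall>n. (n \<in> {..2} \<longrightarrow> F n \<in> Pow {..<N}) \<and> (n \<notin> {..2} \<longrightarrow> F n = {})}"
    by (rule finite_set_of_finite_funs) auto
  then have "finite ({F :: nat \<Rightarrow> nat set. \<forall>n. (n \<in> {..2} \<longrightarrow> F n \<in> Pow {..<N}) \<and> (n \<notin> {..2} \<longrightarrow> F n = {})}
      \<times> Pow ({..<N} \<times> {..<N}))"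
    by simp
  moreover have "t ` A \<subseteq> {F :: nat \<Rightarrow> nat set. \<forall>n. (n \<in> {..2} \<longrightarrow> F n \<in> Pow {..<N}) \<and> (n \<notin> {..2} \<longrightarrow> F n = {})}
      \<times> Pow ({..<N} \<times> {..<N})"
  proof
    fix z assume "z \<in> t ` A"
    then obtain C where C: "C \<in> A" "z = t C" by blast
    have "\<iota> C a \<in> {..<N}" if "a \<in> C" for a using \<iota>(2)[OF C(1)] that by blast
    moreover have "cells M C n \<subseteq> C" for n by (auto simp: cells_def)
    ultimately show "z \<in> {F :: nat \<Rightarrow> nat set. \<forall>n. (n \<in> {..2} \<longrightarrow> F n \<in> Pow {..<N}) \<and> (n \<notin> {..2} \<longrightarrow> F n = {})}
      \<times> Pow ({..<N} \<times> {..<N})"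
      unfolding C(2) t_def incidence_type_def by auto
  qed
  ultimately have "finite (t ` A)" by (rule finite_subset[rotated])
  then have "finite ((\<lambda>C. same_decomposition M `` {C}) ` A)"
  proof (rule finite_image_factor)
    fix C D assume CD: "C \<in> A" "D \<in> A" and eq: "t C = t D"
    show "same_decomposition M `` {C} = same_decomposition M `` {D}"
      by (rule same_incidence_type[OF assms A(1)[OF CD(1)] A(1)[OF CD(2)] \<iota>(1)[OF CD(1)] \<iota>(1)[OF CD(2)]])
         (use eq in \<open>simp add: t_def\<close>)
  qed
  moreover have "A // same_decomposition M = (\<lambda>C. same_decomposition M `` {C}) ` A"
    by (auto simp: quotient_def)
  ultimately show ?thesis unfolding A_def by simp
qed

end
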